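(* Let $\ell\ge 1$, let $T$ be the left shift on $\Omega=\mathcal A^{\mathbb Z}$ and $P$ a $T$-invariant probability measure as in the context. Assume that $$-\sum_{a\in\mathcal A}P([a])\ln P([a])<\infty.$$ Assume that $\sum_{n\ge1}\phi(n)<\infty$ if $\ell=1$, and that $\sum_{n\ge1}\psi(n)<\infty$ if $\ell>1$. Let $q_1,\ldots,q_\ell$ be functions taking nonnegative integer values on integers $n\ge 0$, and suppose there is a constant $K>0$ such that: (a) for any $i\ne j$, $1\le i,j\le\ell$, and every integer $k$ the number of integers $n\ge 0$ satisfying at least one of the equations $q_i(n)-q_j(n)=k$ and $q_i(n)=k$ does not exceed $K$ (when $\ell=1$ the requirement is only that for every integer $k$ the number of $n\ge 0$ with $q_1(n)=k$ does not exceed $K$); (b) the number of pairs of integers $n>m\ge 0$ satisfying $\max_{1\le i\le\ell}q_i(n)\le\max_{1\le i\le\ell}q_i(m)$ does not exceed $K$. Let $h$ be the Kolmogorov--Sinai entropy of the shift $T$ on $(\Omega,\mathcal F,P)$. For $\tilde\omega\in\Omega$ and $n\ge 1$ let $C_n(\tilde\omega)=\{\omega=(\omega_i)_{i\in\mathbb Z}\in\Omega:\ \omega_i=\tilde\omega_i\ \text{whenever}\ |i|\le n\}$, and set $$\tau_{C_n(\tilde\omega)}(\omega)=\min\Big\{k\ge 1:\ \prod_{i=1}^\ell\mathbb I_{C_n(\tilde\omega)}(T^{q_i(k)}\omega)=1\Big\}.$$ Then for $P\times P$-almost all pairs $(\omega,\tilde\omega)\in\Omega\times\Omega$, $$\lim_{n\to\infty}\frac1n\ln\tau_{C_n(\tilde\omega)}(\omega)=2\ell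 h.$$
   Context: Sequence space: $\mathcal A$ is a finite or countable alphabet which is not a singleton, $\Omega=\mathcal A^{\mathbb Z}$ is the space of sequences $\omega=(\omega_i)_{i\in\mathbb Z}$, $\mathcal F$ is the $\sigma$-algebra generated by all cylinder sets, $T:\Omega\to\Omega$ is the left shift $(T\omega)_i=\omega_{i+1}$, and $P$ is a $T$-invariant probability measure on $(\Omega,\mathcal F)$. It is assumed that $P([a])>0$ for every $a\in\mathcal A$, where $[a]=\{\omega:\omega_0=a\}$. $\mathbb I_\Gamma$ denotes the indicator of $\Gamma$, and $\min\emptyset=\infty$. Dependence coefficients: for $-\infty\le m\le n\le\infty$ let $\mathcal F_{mn}$ be the $\sigma$-algebra generated by the coordinates $\omega_i$ with $m\le i\le n$ ($i\in\mathbb Z$). For sub-$\sigma$-algebras $\mathcal G,\mathcal H$ set $$\phi(\mathcal G,\mathcal H)=\sup\Big\{\Big|\frac{P(\Gamma\cap\Delta)}{P(\Gamma)}-P(\Delta)\Big|:\ \Gamma\in\mathcal G,\ \Delta\in\mathcal H,\ P(\Gamma)\ne 0\Big\},$$ $$\psi(\mathcal G,\mathcal H)=\sup\Big\{\Big|\frac{P(\Gamma\cap\Delta)}{P(\Gamma)P(\Delta)}-1\Big|:\ \Gamma\in\mathcal G,\ \Delta\in\mathcal H,\ P(\Gamma)P(\Delta)\ne 0\Big\}\in[0,\infty],$$ and $\phi(k)=\sup_{m\in\mathbb Z}\phi(\mathcal F_{-\infty,m},\mathcal F_{m+k,\infty})$, $\psi(k)=\sup_{m\in\mathbb Z}\psi(\mathcal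 F_{-\infty,m},\mathcal F_{m+k,\infty})$ for $k=0,1,2,\ldots$. *)

theory Defs
  imports "HOL-Probability.Probability"
begin

section \<open>Kolmogorov--Sinai entropy\<close>

text \<open>Entropies use the natural logarithm. Since \<open>ln 0 = 0\<close>, null cells contribute nothing.\<close>

definition finite_partition :: "'b measure \<Rightarrow> 'b set set \<Rightarrow> bool" where
  "finite_partition M \<xi> \<longleftrightarrow> finite \<xi> \<and> \<xi> \<subseteq> sets M \<and> partition_on (space M) \<xi>"

definition partition_entropy :: "'b measure \<Rightarrow> 'b set set \<Rightarrow> real" where
  "partition_entropy M \<xi> = - (\<Sum>A\<in>\<xi>. measure M A * ln (measure M A))"

text \<open>The nonempty cells of the join of the preimages of \<open>\<xi>\<close> under
  \<open>T ^^ i\<close>, \<open>i < n\<close>; a cell is given by its itinerary \<open>c\<close>.\<close>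

definition iterated_join :: "'b measure \<Rightarrow> ('b \<Rightarrow> 'b) \<Rightarrow> 'b set set \<Rightarrow> nat \<Rightarrow> 'b set set" where
  "iterated_join M T \<xi> n =
     (\<lambda>c. {x \<in> space M. \<forall>i<n. (T ^^ i) x \<in> c i}) ` ({..<n} \<rightarrow>\<^sub>E \<xi>) - {{}}"

definition entropy_wrt_partition :: "'b measure \<Rightarrow> ('b \<Rightarrow> 'b) \<Rightarrow> 'b set set \<Rightarrow> real" where
  "entropy_wrt_partition M T \<xi> = lim (\<lambda>n. partition_entropy M (iterated_join M T \<xi> n) / real n)"

definition KS_entropy :: "'b measure \<Rightarrow> ('b \<Rightarrow> 'b) \<Rightarrow> ereal" where
  "KS_entropy M T = (SUP \<xi> \<in> {\<xi>. finite_partition M \<xi>}. ereal (entropy_wrt_partition M T \<xi>))"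

section \<open>Sequence space\<close>

definition seq_space :: "(int \<Rightarrow> 'a) measure" where
  "seq_space = Pi\<^sub>M UNIV (\<lambda>_. count_space UNIV)"

definition shift :: "(int \<Rightarrow> 'a) \<Rightarrow> int \<Rightarrow> 'a" where
  "shift \<omega> = (\<lambda>i. \<omega> (i + 1))"

definition invariant_prob :: "(int \<Rightarrow> 'a) measure \<Rightarrow> bool" where
  "invariant_prob P \<longleftrightarrow> prob_space P \<and> sets P = sets seq_space \<and> distr P P shift = P"

section \<open>Dependence coefficients\<close>

definition coord_sigma :: "int set \<Rightarrow> (int \<Rightarrow> 'a) set set" where
  "coord_sigma I = sigma_sets UNIV {{\<omega>. \<omega> i \<in> B} | i B. i \<in> I}"

definition phi_dep :: "'b measure \<Rightarrow> 'b set set \<Rightarrow> 'b set set \<Rightarrow> ennreal" where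
  "phi_dep P \<G> \<H> =
     (SUP (\<Gamma>, \<Delta>) \<in> {(\<Gamma>, \<Delta>). \<Gamma> \<in> \<G> \<and> \<Delta> \<in> \<H> \<and> measure P \<Gamma> \<noteq> 0}.
        ennreal \<bar>measure P (\<Gamma> \<inter> \<Delta>) / measure P \<Gamma> - measure P \<Delta>\<bar>)"

definition psi_dep :: "'b measure \<Rightarrow> 'b set set \<Rightarrow> 'b set set \<Rightarrow> ennreal" where
  "psi_dep P \<G> \<H> =
     (SUP (\<Gamma>, \<Delta>) \<in> {(\<Gamma>, \<Delta>). \<Gamma> \<in> \<G> \<and> \<Delta> \<in> \<H> \<and> measure P \<Gamma> * measure P \<Delta> \<noteq> 0}.
        ennreal \<bar>measure P (\<Gamma> \<inter> \<Delta>) / (measure P \<Gamma> * measure P \<Delta>) - 1\<bar>)"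

definition phi_mix :: "(int \<Rightarrow> 'a) measure \<Rightarrow> nat \<Rightarrow> ennreal" where
  "phi_mix P k = (SUP m. phi_dep P (coord_sigma {..m}) (coord_sigma {m + int k..}))"

definition psi_mix :: "(int \<Rightarrow> 'a) measure \<Rightarrow> nat \<Rightarrow> ennreal" where
  "psi_mix P k = (SUP m. psi_dep P (coord_sigma {..m}) (coord_sigma {m + int k..}))"

section \<open>Hitting times of cylinders\<close>

definition cyl :: "nat \<Rightarrow> (int \<Rightarrow> 'a) \<Rightarrow> (int \<Rightarrow> 'a) set" where
  "cyl n \<omega>' = {\<omega>. \<forall>i. \<bar>i\<bar> \<le> int n \<longrightarrow> \<omega> i = \<omega>' i}"

text \<open>The value is \<open>\<infinity>\<close> when there is no such \<open>k\<close>.\<close>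

definition hitting_time ::
    "nat \<Rightarrow> (nat \<Rightarrow> nat \<Rightarrow> nat) \<Rightarrow> (int \<Rightarrow> 'a) set \<Rightarrow> (int \<Rightarrow> 'a) \<Rightarrow> enat" where
  "hitting_time l q C \<omega> =
     Inf (enat ` {k. 1 \<le> k \<and> (\<Prod>i=1..l. indicator C ((shift ^^ q i k) \<omega>) :: real) = 1})"

definition ln_enat :: "enat \<Rightarrow> ereal" where
  "ln_enat t = (case t of enat k \<Rightarrow> ereal (ln (real k)) | \<infinity> \<Rightarrow> \<infinity>)"

end

theory Submission
  imports Defs "HOL-Real_Asymp.Real_Asymp"
begin

text \<open>
  Two facts are combined. The first is the Shannon--McMillan--Breiman theorem for two-sided cylinders:
  \<open>- ln P(C\<^sub>n(\<omega>')) / n\<close> tends to \<open>2 h\<close> almost surely. Mixing makes the shift ergodic, so Birkhoff's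
  theorem is available. From above, \<open>P(C\<^sub>n)\<close> is compared with Markov approximations of a coarse
  finite-alphabet factor times the probabilities of the rare letters. From below, Breiman's argument is
  used for an arbitrary finite partition: conditional informations \<open>info j\<close>, \<open>j \<ge> k\<close>, have a common
  minorant with almost the same integral, by a maximal inequality for the likelihood ratios
  \<open>ratio k j\<close>. The bound passes to the letters because the partition is nearly a function of finitely
  many coordinates.

  The second fact concerns a fixed typical \<open>\<omega>'\<close>. Up to time \<open>N\<close> the probability of hitting \<open>C\<^sub>n\<close> is at
  most of order \<open>N P(C\<^sub>n)\<^sup>l + n P(C\<^sub>n)\<close>, since only \<open>O(n)\<close> times \<open>k\<close> have two of the windows around
  \<open>q\<^sub>1(k), \<dots>, q\<^sub>l(k)\<close> overlapping. The second moment method bounds the probability of not hitting by a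
  multiple of \<open>f n + n / (N P(C\<^sub>n)\<^sup>l)\<close>, where \<open>f\<close> is the mixing coefficient: for \<open>l > 1\<close> the windows
  are required to be \<open>n\<close> apart, and for \<open>l = 1\<close> the covariances are summed over all gaps. Both bounds
  are summable in \<open>n\<close> for suitable \<open>N = exp (n (2 l h \<plusminus> \<epsilon>))\<close>, and Borel--Cantelli applies.
\<close>

section \<open>Birkhoff theorem for ergodic transformations\<close>

text \<open>The alphabet may be infinite, so the letters need not form a finite partition, while
  \<open>KS_entropy\<close> sees finite partitions only and could a priori be infinite. The entropy
  estimates are therefore proved for finite-valued factors and compared at one typical point, which
  also shows that \<open>h\<close> is finite. Symmetric windows grow at both ends, so they do not
  form one increasing coding. Each \<open>n\<close> gets a coding of its own; its likelihood ratio
  has integral at most 1, and Borel--Cantelli needs nothing more. The two coefficients shape the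
  second moment argument. A psi error is relative to both probabilities: at gap \<open>n\<close> it
  costs a relative error of order \<open>f n\<close>, which is summable. A phi error carries one
  factor \<open>P(C)\<close> only; at a fixed gap, \<open>N^2\<close> pairs would cost
  \<open>N^2 f P(C)\<close>, too much against \<open>(N P(C))^2\<close>. Since each \<open>k\<close>
  has boundedly many partners at each gap, summation over the gaps brings this down to order
  \<open>N P(C)\<close>. In the limit, 2 stems from the \<open>2 n + 1\<close> coordinates of a
  cylinder and \<open>l\<close> from nearly independent visits.\<close>

context prob_space
begin

text \<open>The running maxima satisfy \<open>m (Suc n) = max 0 (f + m n \<circ> T)\<close>. On the invariant set where they are
  unbounded, \<open>m (Suc n) - m n \<circ> T\<close> is eventually equal to \<open>f\<close>, and its integral is nonnegative; so that set
  cannot have full measure.\<close>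

lemma ergodic_limsup_aux:
  fixes f :: "'a \<Rightarrow> real"
  assumes T [measurable]: "T \<in> measurable M M" and inv: "distr M M T = M"
    and erg: "\<forall>A\<in>sets M. T -` A \<inter> space M = A \<longrightarrow> prob A = 0 \<or> prob A = 1"
    and f: "integrable M f" and neg: "integral\<^sup>L M f < 0"
  shows "AE x in M. \<exists>B. \<forall>n. (\<Sum>i<n. f ((T ^^ i) x)) \<le> B"
proof -
  have [measurable]: "f \<in> borel_measurable M" using f by auto
  have Tsp: "x \<in> space M \<Longrightarrow> T x \<in> space M" for x using T by (rule measurable_space)
  define m where "m = rec_nat (\<lambda>x. 0 :: real) (\<lambda>n g x. max 0 (f x + g (T x)))"
  have m0: "m 0 x = 0" and mS: "m (Suc n) x = max 0 (f x + m n (T x))" for n x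
    by (simp_all add: m_def)
  have mint: "integrable M (m n)" for n
  proof (induction n)
    case 0 then show ?case by (simp add: m_def)
  next
    case (Suc n)
    have "integrable (distr M M T) (m n)" by (simp add: inv Suc)
    then have "integrable M (\<lambda>x. m n (T x))"
      by (subst (asm) integrable_distr_eq) (auto intro: borel_measurable_integrable Suc)
    then show ?case using f unfolding mS[abs_def] by (intro integrable_max) auto
  qed
  have [measurable]: "m n \<in> borel_measurable M" for n using mint by auto
  have mnn: "m n x \<ge> 0" for n x by (cases n) (simp_all add: m0 mS)
  have mmono: "m n x \<le> m (Suc n) x" for n x
  proof (induction n arbitrary: x)
    case (Suc n)
    show ?case unfolding mS[of "Suc n" x] mS[of n x] using Suc[of "T x"] by linarith
  qed (simp add: m0 mS)
  have minc: "incseq (\<lambda>n. m n x)" for x using mmono by (intro incseq_SucI)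
  have sum_le: "(\<Sum>i<n. f ((T ^^ i) x)) \<le> m n x" for n x
  proof (induction n arbitrary: x)
    case (Suc n)
    have "(\<Sum>i<Suc n. f ((T ^^ i) x)) = f x + (\<Sum>i<n. f ((T ^^ i) (T x)))"
      by (subst sum.lessThan_Suc_shift) (simp add: funpow_swap1)
    also have "\<dots> \<le> f x + m n (T x)" using Suc by simp
    finally show ?case by (simp add: mS)
  qed (simp add: m0)
  define A where "A = {x \<in> space M. \<forall>B::nat. \<exists>n. m n x > real B}"
  have A [measurable]: "A \<in> sets M" unfolding A_def by measurable
  have Ainv: "T -` A \<inter> space M = A"
  proof -
    have "(\<forall>B::nat. \<exists>n. m n (T x) > real B) \<longleftrightarrow> (\<forall>B::nat. \<exists>n. m n x > real B)" for x
    proof safe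
      fix B :: nat assume H: "\<forall>B::nat. \<exists>n. m n (T x) > real B"
      obtain B' :: nat where "real B' > real B - f x" using reals_Archimedean2 by blast
      moreover obtain n where "m n (T x) > real B'" using H by blast
      ultimately have "m (Suc n) x > real B" unfolding mS by linarith
      then show "\<exists>n. m n x > real B" by blast
    next
      fix B :: nat assume H: "\<forall>B::nat. \<exists>n. m n x > real B"
      obtain B' :: nat where "real B' > real B + \<bar>f x\<bar>" using reals_Archimedean2 by blast
      moreover obtain n where "m n x > real B'" using H by blast
      moreover have "n \<noteq> 0" using calculation(2) m0[of x] by (intro notI) simp
      then obtain k where "n = Suc k" using not0_implies_Suc by blast
      ultimately have "real B' < max 0 (f x + m k (T x))" "real B + \<bar>f x\<bar> < real B'" by (simp_all add: mS)
      then have "m k (T x) > real B" using of_nat_0_le_iff[of B', where 'a = real] by linarith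
      then show "\<exists>n. m n (T x) > real B" by blast
    qed
    then show ?thesis unfolding A_def using Tsp by auto
  qed
  have "prob A \<noteq> 1"
  proof
    assume A1: "prob A = 1"
    define d where "d n x = m (Suc n) x - m n (T x)" for n x
    have mTint: "integrable M (\<lambda>x. m n (T x))" and mTeq: "(\<integral>x. m n (T x) \<partial>M) = (\<integral>x. m n x \<partial>M)" for n
    proof -
      have "integrable (distr M M T) (m n)" by (simp add: inv mint)
      then show "integrable M (\<lambda>x. m n (T x))"
        by (subst (asm) integrable_distr_eq) auto
      have "(\<integral>x. m n (T x) \<partial>M) = (\<integral>x. m n x \<partial>(distr M M T))"
        by (subst integral_distr) auto
      then show "(\<integral>x. m n (T x) \<partial>M) = (\<integral>x. m n x \<partial>M)" by (simp add: inv)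
    qed
    have dint: "(\<integral>x. d n x \<partial>M) \<ge> 0" for n
    proof -
      have "(\<integral>x. d n x \<partial>M) = (\<integral>x. m (Suc n) x \<partial>M) - (\<integral>x. m n x \<partial>M)"
        unfolding d_def using mint mTint by (subst Bochner_Integration.integral_diff) (auto simp: mTeq)
      moreover have "(\<integral>x. m n x \<partial>M) \<le> (\<integral>x. m (Suc n) x \<partial>M)"
        using mint mmono by (intro integral_mono) auto
      ultimately show ?thesis by simp
    qed
    have lim: "(\<lambda>n. \<integral>x. d n x \<partial>M) \<longlonglongrightarrow> (\<integral>x. f x \<partial>M)"
    proof (rule integral_dominated_convergence[where w = "\<lambda>x. \<bar>f x\<bar>"])
      have "AE x in M. x \<in> A" using A1 A by (simp add: prob_eq_1)
      then show "AE x in M. (\<lambda>n. d n x) \<longlonglongrightarrow> f x"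
      proof eventually_elim
        case (elim x)
        then have "T x \<in> A" using Ainv A_def by auto
        obtain B :: nat where B: "real B > - f x" using reals_Archimedean2 by blast
        obtain n0 where n0: "m n0 (T x) > real B" using \<open>T x \<in> A\<close> unfolding A_def by blast
        have "d n x = f x" if "n \<ge> n0" for n
        proof -
          have "m n (T x) \<ge> m n0 (T x)" using minc that by (simp add: incseq_def)
          then show ?thesis unfolding d_def mS using n0 B by auto
        qed
        then show ?case by (intro tendsto_eventually) (auto simp: eventually_sequentially)
      qed
      \<comment> \<open>Here \<open>d n x\<close> is the maximum of \<open>f x\<close> and
        \<open>- m n (T x)\<close>, and the second entry is at most 0.\<close>
      show "AE x in M. norm (d n x) \<le> \<bar>f x\<bar>" for n
      proof (rule AE_I2)
        fix x show "norm (d n x) \<le> \<bar>f x\<bar>"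
          unfolding d_def mS real_norm_def using mnn[of n "T x"] by linarith
      qed
      show "f \<in> borel_measurable M" by measurable
      show "d n \<in> borel_measurable M" for n
        unfolding d_def[abs_def] by measurable
      show "integrable M (\<lambda>x. \<bar>f x\<bar>)" using f by simp
    qed
    have "(\<integral>x. f x \<partial>M) \<ge> 0" by (rule LIMSEQ_le_const[OF lim]) (use dint in blast)
    then show False using neg by simp
  qed
  then have "prob A = 0" using erg[rule_format, OF A Ainv] by blast
  then have "AE x in M. x \<notin> A" using A by (simp add: prob_eq_0)
  then show ?thesis
  proof (rule AE_mp, intro AE_I2 impI)
    fix x assume "x \<in> space M" "x \<notin> A"
    then obtain B :: nat where "\<forall>n. m n x \<le> real B" unfolding A_def by (auto simp: not_less)
    then show "\<exists>B. \<forall>n. (\<Sum>i<n. f ((T ^^ i) x)) \<le> B" by (intro exI[of _ "real B"] allI order_trans[OF sum_le]) auto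
  qed
qed

text \<open>Subtracting slightly more than the mean makes the integral negative, so the sums of the
  difference stay bounded and become negligible against \<open>n\<close>. The margins run through
  \<open>1 / real (Suc j)\<close> so that one null set serves every \<open>e\<close>.\<close>

lemma ergodic_limsup:
  fixes f :: "'a \<Rightarrow> real"
  assumes T [measurable]: "T \<in> measurable M M" and inv: "distr M M T = M"
    and erg: "\<forall>A\<in>sets M. T -` A \<inter> space M = A \<longrightarrow> prob A = 0 \<or> prob A = 1"
    and f: "integrable M f"
  shows "AE x in M. \<forall>e>0. \<forall>\<^sub>F n in sequentially. (\<Sum>i<n. f ((T ^^ i) x)) \<le> real n * (integral\<^sup>L M f + e)"
proof -
  have "AE x in M. \<forall>\<^sub>F n in sequentially. (\<Sum>i<n. f ((T ^^ i) x)) \<le> real n * (integral\<^sup>L M f + 2 / real (Suc j))" for j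
  proof -
    define g where "g x = f x - (integral\<^sup>L M f + 1 / real (Suc j))" for x
    have gi: "integrable M g" unfolding g_def using f by auto
    have "integral\<^sup>L M g < 0" unfolding g_def using f by (simp add: prob_space)
    from ergodic_limsup_aux[OF T inv erg gi this]
    have "AE x in M. \<exists>B. \<forall>n. (\<Sum>i<n. g ((T ^^ i) x)) \<le> B" by blast
    then show ?thesis
    proof eventually_elim
      case (elim x)
      then obtain B where B: "\<And>n. (\<Sum>i<n. g ((T ^^ i) x)) \<le> B" by blast
      have ev: "\<forall>\<^sub>F n in sequentially. B \<le> real n * (1 / real (Suc j))"
        by real_asymp
      then show ?case
      proof eventually_elim
        case (elim n)
        have "(\<Sum>i<n. g ((T ^^ i) x)) = (\<Sum>i<n. f ((T ^^ i) x)) - real n * (integral\<^sup>L M f + 1 / real (Suc j))"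
          unfolding g_def by (simp add: sum_subtractf)
        then have "(\<Sum>i<n. f ((T ^^ i) x)) \<le> real n * (integral\<^sup>L M f + 1 / real (Suc j)) + real n * (1 / real (Suc j))"
          using B[of n] elim by linarith
        also have "\<dots> = real n * (integral\<^sup>L M f + 2 / real (Suc j))"
          by (simp only: distrib_left[symmetric] add.assoc add_divide_distrib[symmetric]) simp
        finally show ?case .
      qed
    qed
  qed
  then have "AE x in M. \<forall>j. \<forall>\<^sub>F n in sequentially. (\<Sum>i<n. f ((T ^^ i) x)) \<le> real n * (integral\<^sup>L M f + 2 / real (Suc j))"
    by (simp add: AE_all_countable)
  then show ?thesis
  proof eventually_elim
    case (elim x)
    show ?case
    proof (intro allI impI)
      fix e :: real assume "e > 0"
      then obtain j where j: "1 / real (Suc j) < e / 2" using nat_approx_posE[of "e/2"] by auto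
      show "\<forall>\<^sub>F n in sequentially. (\<Sum>i<n. f ((T ^^ i) x)) \<le> real n * (integral\<^sup>L M f + e)"
        using elim[rule_format, of j]
      proof eventually_elim
        case (elim n)
        also have "real n * (integral\<^sup>L M f + 2 / real (Suc j)) \<le> real n * (integral\<^sup>L M f + e)"
          using j by (intro mult_left_mono) auto
        finally show ?case .
      qed
    qed
  qed
qed

text \<open>The one-sided bound is used for \<open>f\<close> and for \<open>- f\<close>.\<close>

theorem ergodic_birkhoff:
  fixes f :: "'a \<Rightarrow> real"
  assumes T: "T \<in> measurable M M" and inv: "distr M M T = M"
    and erg: "\<forall>A\<in>sets M. T -` A \<inter> space M = A \<longrightarrow> prob A = 0 \<or> prob A = 1"
    and f: "integrable M f"
  shows "AE x in M. (\<lambda>n. (\<Sum>i<n. f ((T ^^ i) x)) / real n) \<longlonglongrightarrow> integral\<^sup>L M f"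
proof -
  have "integrable M (\<lambda>x. - f x)" using f by simp
  note ergodic_limsup[OF T inv erg f] ergodic_limsup[OF T inv erg this]
  then show ?thesis
proof eventually_elim
  case (elim x)
  show ?case
  proof (rule LIMSEQ_I)
    fix e :: real assume e: "e > 0"
    then have e2: "e / 2 > 0" by simp
    have "\<forall>\<^sub>F n in sequentially. norm ((\<Sum>i<n. f ((T ^^ i) x)) / real n - integral\<^sup>L M f) < e"
      using elim(1)[rule_format, OF e2] elim(2)[rule_format, OF e2] eventually_gt_at_top[of 0]
    proof eventually_elim
      case A: (elim n)
      let ?s = "(\<Sum>i<n. f ((T ^^ i) x))"
      have "?s / real n \<le> integral\<^sup>L M f + e/2" using A e by (simp add: field_simps)
      moreover have "- (integral\<^sup>L M f) + e/2 \<ge> - (?s / real n)"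
        using A e by (simp add: field_simps sum_negf)
      ultimately show ?case using e by (auto simp: abs_less_iff)
    qed
    then show "\<exists>no. \<forall>n\<ge>no. norm ((\<Sum>i<n. f ((T ^^ i) x)) / real n - integral\<^sup>L M f) < e"
      by (simp add: eventually_sequentially)
  qed
qed
qed

end

section \<open>Countable measurable partitions and likelihood ratios\<close>

locale full_prob_space = prob_space M for M :: "'b measure" +
  assumes space_UNIV: "space M = UNIV"
begin

text \<open>A countable measurable partition, encoded as the map from a point to its cell; the label
  \<open>X\<close> witnesses countability. In this form any function constant on cells is
  measurable, whatever its target, and refinement is intersection.\<close>

definition countable_cells :: "('b \<Rightarrow> 'b set) \<Rightarrow> bool" where
  "countable_cells E \<longleftrightarrow>
     (\<exists>X :: 'b \<Rightarrow> nat. X \<in> measurable M (count_space UNIV) \<and> (\<forall>\<omega>. E \<omega> = {\<omega>'. X \<omega>' = X \<omega>}))"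

lemma countable_cells_UNIV: "countable_cells (\<lambda>_. UNIV)"
  unfolding countable_cells_def by (intro exI[of _ "\<lambda>_. 0"]) auto

lemma countable_cells_Int:
  fixes Z :: "'b \<Rightarrow> 'z :: countable"
  assumes "countable_cells E" and Z: "Z \<in> measurable M (count_space UNIV)"
  shows "countable_cells (\<lambda>\<omega>. E \<omega> \<inter> {\<omega>'. Z \<omega>' = Z \<omega>})"
proof -
  obtain X :: "'b \<Rightarrow> nat" where X: "X \<in> measurable M (count_space UNIV)" "\<And>\<omega>. E \<omega> = {\<omega>'. X \<omega>' = X \<omega>}"
    using assms(1) unfolding countable_cells_def by blast
  have "(\<lambda>\<omega>. (\<lambda>i \<omega>. to_nat (i, Z \<omega>)) (X \<omega>) \<omega>) \<in> measurable M (count_space UNIV)"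
    by (rule measurable_compose_countable[OF _ X(1)]) (use Z in measurable)
  then show ?thesis unfolding countable_cells_def X(2)
    by (intro exI[of _ "\<lambda>\<omega>. to_nat (X \<omega>, Z \<omega>)"]) auto
qed

lemma nn_integral_countable_valued:
  fixes X :: "'b \<Rightarrow> 'x :: countable"
  assumes X [measurable]: "X \<in> measurable M (count_space UNIV)"
  shows "(\<integral>\<^sup>+\<omega>. F (X \<omega>) \<partial>M) = (\<integral>\<^sup>+x. F x * emeasure M {\<omega>. X \<omega> = x} \<partial>count_space UNIV)"
proof -
  have "(\<integral>\<^sup>+\<omega>. F (X \<omega>) \<partial>M) = (\<integral>\<^sup>+x. F x \<partial>distr M (count_space UNIV) X)"
    by (subst nn_integral_distr) auto
  also have "distr M (count_space UNIV) X = density (count_space UNIV) (\<lambda>x. emeasure M {\<omega>. X \<omega> = x})"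
  proof (rule measure_eqI_countable[of _ UNIV])
    fix a :: 'x
    have "emeasure (density (count_space UNIV) (\<lambda>x. emeasure M {\<omega>. X \<omega> = x})) {a}
      = (\<integral>\<^sup>+x. emeasure M {\<omega>. X \<omega> = x} * indicator {a} x \<partial>count_space UNIV)"
      by (subst emeasure_density) auto
    also have "\<dots> = emeasure M {\<omega>. X \<omega> = a}" by (subst nn_integral_indicator_singleton) auto
    also have "\<dots> = emeasure (distr M (count_space UNIV) X) {a}"
      by (subst emeasure_distr) (auto simp: space_UNIV vimage_def)
    finally show "emeasure (distr M (count_space UNIV) X) {a}
      = emeasure (density (count_space UNIV) (\<lambda>x. emeasure M {\<omega>. X \<omega> = x})) {a}" ..
  qed auto
  also have "(\<integral>\<^sup>+x. F x \<partial>\<dots>) = (\<integral>\<^sup>+x. F x * emeasure M {\<omega>. X \<omega> = x} \<partial>count_space UNIV)"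
    by (subst nn_integral_density) (auto simp: mult.commute)
  finally show ?thesis .
qed

lemma measurable_cells:
  assumes "countable_cells E" and g: "\<And>\<omega> \<omega>'. \<omega>' \<in> E \<omega> \<Longrightarrow> g \<omega>' = g \<omega>"
    and N: "\<And>\<omega>. g \<omega> \<in> space N"
  shows "g \<in> measurable M N"
proof -
  obtain X :: "'b \<Rightarrow> nat" where X: "X \<in> measurable M (count_space UNIV)" "\<And>\<omega>. E \<omega> = {\<omega>'. X \<omega>' = X \<omega>}"
    using assms(1) unfolding countable_cells_def by blast
  have "g = (\<lambda>n. g (SOME \<omega>. X \<omega> = n)) \<circ> X"
  proof
    fix \<omega>
    have "X (SOME \<omega>'. X \<omega>' = X \<omega>) = X \<omega>" by (rule someI) simp
    then have "(SOME \<omega>'. X \<omega>' = X \<omega>) \<in> E \<omega>" by (simp add: X(2))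
    from g[OF this] show "g \<omega> = ((\<lambda>n. g (SOME \<omega>. X \<omega> = n)) \<circ> X) \<omega>" by simp
  qed
  moreover have "(\<lambda>n. g (SOME \<omega>. X \<omega> = n)) \<circ> X \<in> measurable M N"
    using N by (intro measurable_comp[OF X(1)]) auto
  ultimately show ?thesis by simp
qed

lemma cell_sets: "countable_cells E \<Longrightarrow> E \<omega> \<in> sets M"
proof -
  assume "countable_cells E"
  then obtain X :: "'b \<Rightarrow> nat" where X: "X \<in> measurable M (count_space UNIV)" "\<And>\<omega>. E \<omega> = {\<omega>'. X \<omega>' = X \<omega>}"
    unfolding countable_cells_def by blast
  have "X -` {X \<omega>} \<inter> space M \<in> sets M" using X(1) by (rule measurable_sets) auto
  moreover have "X -` {X \<omega>} \<inter> space M = E \<omega>" by (auto simp: X(2) space_UNIV)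
  ultimately show ?thesis by simp
qed

lemma cell_eq: "countable_cells E \<Longrightarrow> \<omega>' \<in> E \<omega> \<Longrightarrow> E \<omega>' = E \<omega>"
  unfolding countable_cells_def by fastforce

lemma cell_self: "countable_cells E \<Longrightarrow> \<omega> \<in> E \<omega>"
  unfolding countable_cells_def by fastforce

lemma borel_measurable_prob_cell:
  assumes "countable_cells E"
  shows "(\<lambda>\<omega>. prob (E \<omega>)) \<in> borel_measurable M"
  using assms by (rule measurable_cells) (simp_all add: cell_eq[OF assms])

text \<open>There are only countably many cells, so the null ones together have measure 0. Outside
  them quotients and logarithms of cell probabilities are genuine.\<close>

lemma AE_cell_pos:
  assumes E: "countable_cells E"
  shows "AE \<omega> in M. prob (E \<omega>) > 0"
proof -
  obtain X :: "'b \<Rightarrow> nat" where X: "X \<in> measurable M (count_space UNIV)" "\<And>\<omega>. E \<omega> = {\<omega>'. X \<omega>' = X \<omega>}"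
    using assms(1) unfolding countable_cells_def by blast
  note [measurable] = borel_measurable_prob_cell[OF E]
  define F where "F n = (if prob {\<omega>. X \<omega> = n} = 0 then 1 else 0 :: ennreal)" for n
  have "(\<integral>\<^sup>+\<omega>. F (X \<omega>) \<partial>M) = 0"
    unfolding nn_integral_countable_valued[OF X(1)]
    by (subst nn_integral_0_iff) (auto simp: F_def emeasure_eq_measure)
  moreover have "(\<lambda>\<omega>. F (X \<omega>)) \<in> borel_measurable M" using X(1) by measurable
  ultimately have "AE \<omega> in M. F (X \<omega>) = 0" by (simp add: nn_integral_0_iff_AE)
  then show ?thesis
    by eventually_elim (auto simp: F_def X(2) zero_less_measure_iff split: if_splits)
qed

lemma nn_integral_emeasure_level_sets:
  fixes Z :: "'b \<Rightarrow> 'z :: countable"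
  assumes Z: "Z \<in> measurable M (count_space UNIV)" and A: "A \<in> sets M"
  shows "(\<integral>\<^sup>+z. emeasure M (A \<inter> {\<omega>. Z \<omega> = z}) \<partial>count_space UNIV) = emeasure M A"
proof -
  have Zs: "{\<omega>. Z \<omega> = z} \<in> sets M" for z
  proof -
    have "{\<omega>. Z \<omega> = z} = Z -` {z} \<inter> space M" by (auto simp: space_UNIV)
    then show ?thesis using Z by (metis measurable_sets UNIV_I sets_count_space Pow_UNIV)
  qed
  have "A = (\<Union>z\<in>UNIV. A \<inter> {\<omega>. Z \<omega> = z})" by auto
  then have "emeasure M A = emeasure M (\<Union>z\<in>UNIV. A \<inter> {\<omega>. Z \<omega> = z})" by simp
  also have "\<dots> = (\<integral>\<^sup>+z. emeasure M (A \<inter> {\<omega>. Z \<omega> = z}) \<partial>count_space UNIV)"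
    using A Zs by (intro emeasure_UN_countable) (auto simp: disjoint_family_on_def)
  finally show ?thesis ..
qed

text \<open>Likelihood ratios are supermartingales. Together with Markov's inequality and Borel--Cantelli
  this yields all almost sure comparisons of cell probabilities below.\<close>

lemma likelihood_step:
  fixes Z :: "'b \<Rightarrow> 'z :: countable" and G :: "'b \<Rightarrow> ennreal"
  assumes E: "countable_cells E" and Z [measurable]: "Z \<in> measurable M (count_space UNIV)"
    and G: "\<And>\<omega> \<omega>'. \<omega>' \<in> E \<omega> \<Longrightarrow> G \<omega>' = G \<omega>"
    and \<kappa>: "\<And>\<omega> \<omega>'. \<omega>' \<in> E \<omega> \<Longrightarrow> \<kappa> \<omega>' = \<kappa> \<omega>"
    and \<kappa>_sum: "\<And>\<omega>. (\<integral>\<^sup>+z. \<kappa> \<omega> z \<partial>count_space UNIV) \<le> L \<omega>"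
    and L: "\<And>\<omega> \<omega>'. \<omega>' \<in> E \<omega> \<Longrightarrow> L \<omega>' = L \<omega>"
  shows "(\<integral>\<^sup>+\<omega>. G \<omega> * \<kappa> \<omega> (Z \<omega>) / emeasure M (E \<omega> \<inter> {\<omega>'. Z \<omega>' = Z \<omega>}) \<partial>M)
      \<le> (\<integral>\<^sup>+\<omega>. G \<omega> * L \<omega> / emeasure M (E \<omega>) \<partial>M)"
proof -
  obtain X :: "'b \<Rightarrow> nat" where X[measurable]: "X \<in> measurable M (count_space UNIV)" and XE: "\<And>\<omega>. E \<omega> = {\<omega>'. X \<omega>' = X \<omega>}"
    using assms(1) unfolding countable_cells_def by blast
  \<comment> \<open>A representative of each label. Since \<open>G\<close>, \<open>\<kappa>\<close>
    and \<open>L\<close> are constant on cells, both integrals become sums over labels.\<close>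
  define s where "s n = (SOME \<omega>. X \<omega> = n)" for n
  have s: "s (X \<omega>) \<in> E \<omega>" for \<omega>
    unfolding s_def XE using someI[of "\<lambda>\<omega>'. X \<omega>' = X \<omega>" \<omega>] by simp
  define p where "p n = emeasure M {\<omega>'. X \<omega>' = n}" for n
  define pz where "pz n z = emeasure M {\<omega>'. X \<omega>' = n \<and> Z \<omega>' = z}" for n z
  have pz_le: "pz n z \<le> p n" for n z
  proof -
    have "{\<omega>. X \<omega> = n} = X -` {n} \<inter> space M" by (auto simp: space_UNIV)
    also have "\<dots> \<in> sets M" by measurable
    finally show ?thesis unfolding pz_def p_def by (intro emeasure_mono) auto
  qed
  have fin: "p n < \<infinity>" "pz n z < \<infinity>" for n z unfolding p_def pz_def by (simp_all add: less_top[symmetric])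
  \<comment> \<open>In \<open>ennreal\<close>, \<open>a / b * b\<close> is 0 for
    \<open>b = 0\<close> and \<open>a\<close> otherwise, so null cells drop out. Equality can be
    lost here: a refined cell may be null inside a cell of positive measure.\<close>
  have canc: "a / b * b \<le> (if b = 0 then 0 else a)" "(if b = 0 then 0 else a) \<le> a / b * b" if "b < \<infinity>" for a b :: ennreal
  proof -
    have "a / b * b = (if b = 0 then 0 else a)"
      using that by (cases "b = 0") (simp_all add: ennreal_divide_times ennreal_divide_self)
    then show "a / b * b \<le> (if b = 0 then 0 else a)" "(if b = 0 then 0 else a) \<le> a / b * b" by simp_all
  qed
  have [measurable]: "(\<lambda>\<omega>. (X \<omega>, Z \<omega>)) \<in> measurable M (count_space UNIV)"
    using measurable_compose_countable[OF _ X, of "\<lambda>i \<omega>. (i, Z \<omega>)" "count_space UNIV"] by simp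
  have "(\<integral>\<^sup>+\<omega>. G \<omega> * \<kappa> \<omega> (Z \<omega>) / emeasure M (E \<omega> \<inter> {\<omega>'. Z \<omega>' = Z \<omega>}) \<partial>M)
     = (\<integral>\<^sup>+\<omega>. (\<lambda>(n, z). G (s n) * \<kappa> (s n) z / pz n z) (X \<omega>, Z \<omega>) \<partial>M)"
    using G[OF s] \<kappa>[OF s] by (intro nn_integral_cong) (simp add: pz_def XE Collect_conj_eq)
  also have "\<dots> = (\<integral>\<^sup>+v. (\<lambda>(n, z). G (s n) * \<kappa> (s n) z / pz n z) v * emeasure M {\<omega>. (X \<omega>, Z \<omega>) = v} \<partial>count_space UNIV)"
    by (rule nn_integral_countable_valued) measurable
  also have "\<dots> = (\<integral>\<^sup>+v. (\<lambda>(n, z). G (s n) * \<kappa> (s n) z / pz n z * pz n z) v \<partial>count_space UNIV)"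
    by (intro nn_integral_cong) (auto simp: pz_def)
  also have "\<dots> \<le> (\<integral>\<^sup>+v. (\<lambda>(n, z). (if p n = 0 then 0 else G (s n)) * \<kappa> (s n) z) v \<partial>count_space UNIV)"
  proof (intro nn_integral_mono, clarify)
    fix n z
    have "G (s n) * \<kappa> (s n) z / pz n z * pz n z \<le> (if pz n z = 0 then 0 else G (s n) * \<kappa> (s n) z)"
      using fin by (intro canc)
    also have "\<dots> \<le> (if p n = 0 then 0 else G (s n)) * \<kappa> (s n) z" using pz_le[of n z] by auto
    finally show "G (s n) * \<kappa> (s n) z / pz n z * pz n z \<le> (if p n = 0 then 0 else G (s n)) * \<kappa> (s n) z" .
  qed
  also have "\<dots> = (\<integral>\<^sup>+n. \<integral>\<^sup>+z. (if p n = 0 then 0 else G (s n)) * \<kappa> (s n) z \<partial>count_space UNIV \<partial>count_space UNIV)"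
    by (subst nn_integral_fst_count_space[symmetric]) simp
  also have "\<dots> = (\<integral>\<^sup>+n. (if p n = 0 then 0 else G (s n)) * (\<integral>\<^sup>+z. \<kappa> (s n) z \<partial>count_space UNIV) \<partial>count_space UNIV)"
    by (subst nn_integral_cmult) auto
  also have "\<dots> \<le> (\<integral>\<^sup>+n. (if p n = 0 then 0 else G (s n) * L (s n)) \<partial>count_space UNIV)"
    using \<kappa>_sum by (intro nn_integral_mono) (auto intro!: mult_left_mono)
  also have "\<dots> \<le> (\<integral>\<^sup>+n. G (s n) * L (s n) / p n * p n \<partial>count_space UNIV)"
    by (intro nn_integral_mono canc fin)
  also have "\<dots> = (\<integral>\<^sup>+\<omega>. G (s (X \<omega>)) * L (s (X \<omega>)) / p (X \<omega>) \<partial>M)"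
    unfolding p_def by (rule nn_integral_countable_valued[symmetric]) measurable
  also have "\<dots> = (\<integral>\<^sup>+\<omega>. G \<omega> * L \<omega> / emeasure M (E \<omega>) \<partial>M)"
    using G[OF s] L[OF s] by (intro nn_integral_cong) (simp add: p_def XE)
  finally show ?thesis .
qed

lemma countable_cells_chain:
  fixes Z :: "nat \<Rightarrow> 'b \<Rightarrow> 'z :: countable"
  assumes E: "countable_cells E" and Z: "\<And>i. Z i \<in> measurable M (count_space UNIV)"
  shows "countable_cells (\<lambda>\<omega>. E \<omega> \<inter> {\<omega>'. \<forall>i<N. Z i \<omega>' = Z i \<omega>})"
proof (induction N)
  case (Suc N)
  have "(\<lambda>\<omega>. E \<omega> \<inter> {\<omega>'. \<forall>i<Suc N. Z i \<omega>' = Z i \<omega>})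
      = (\<lambda>\<omega>. (E \<omega> \<inter> {\<omega>'. \<forall>i<N. Z i \<omega>' = Z i \<omega>}) \<inter> {\<omega>'. Z N \<omega>' = Z N \<omega>})"
    by (auto simp: less_Suc_eq fun_eq_iff)
  then show ?case using countable_cells_Int[OF Suc Z[of N]] by simp
qed (simp add: E)

text \<open>The kernels \<open>\<kappa> i\<close> are predictable and have total mass at most 1, so
  the product times \<open>prob (E \<omega>)\<close> is the mass that a sub-probability gives to the
  final cell. The mean of its density is at most its total mass; each factor is removed by
  \<open>likelihood_step\<close> with \<open>L = 1\<close>.\<close>

lemma likelihood_chain:
  fixes Z :: "nat \<Rightarrow> 'b \<Rightarrow> 'z :: countable" and \<kappa> :: "nat \<Rightarrow> 'b \<Rightarrow> 'z \<Rightarrow> real"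
  assumes E: "countable_cells E" and Z: "\<And>i. Z i \<in> measurable M (count_space UNIV)"
    and \<kappa>_nonneg: "\<And>i \<omega> z. \<kappa> i \<omega> z \<ge> 0"
    and \<kappa>: "\<And>i \<omega> \<omega>'. \<omega>' \<in> E \<omega> \<Longrightarrow> (\<And>j. j < i \<Longrightarrow> Z j \<omega>' = Z j \<omega>) \<Longrightarrow> \<kappa> i \<omega>' = \<kappa> i \<omega>"
    and \<kappa>_sum: "\<And>i \<omega>. (\<integral>\<^sup>+z. ennreal (\<kappa> i \<omega> z) \<partial>count_space UNIV) \<le> 1"
  shows "(\<integral>\<^sup>+\<omega>. ennreal ((\<Prod>i<N. \<kappa> i \<omega> (Z i \<omega>)) * prob (E \<omega>))
           / emeasure M (E \<omega> \<inter> {\<omega>'. \<forall>i<N. Z i \<omega>' = Z i \<omega>}) \<partial>M) \<le> 1"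
proof (induction N)
  case 0
  have "ennreal (prob (E \<omega>)) / emeasure M (E \<omega>) \<le> 1" for \<omega>
    by (cases "prob (E \<omega>) = 0") (auto simp: emeasure_eq_measure ennreal_divide_self)
  then have "(\<integral>\<^sup>+\<omega>. ennreal (prob (E \<omega>)) / emeasure M (E \<omega>) \<partial>M) \<le> (\<integral>\<^sup>+\<omega>. 1 \<partial>M)"
    by (intro nn_integral_mono) auto
  then show ?case by (simp add: emeasure_space_1)
next
  case (Suc N)
  let ?E = "\<lambda>\<omega>. E \<omega> \<inter> {\<omega>'. \<forall>i<N. Z i \<omega>' = Z i \<omega>}"
  let ?G = "\<lambda>\<omega>. ennreal ((\<Prod>i<N. \<kappa> i \<omega> (Z i \<omega>)) * prob (E \<omega>))"
  have Eq: "E \<omega> \<inter> {\<omega>'. \<forall>i<Suc N. Z i \<omega>' = Z i \<omega>} = ?E \<omega> \<inter> {\<omega>'. Z N \<omega>' = Z N \<omega>}" for \<omega>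
    by (auto simp: less_Suc_eq)
  have nn: "(\<Prod>i<N. \<kappa> i \<omega> (Z i \<omega>)) * prob (E \<omega>) \<ge> 0" for \<omega>
    using \<kappa>_nonneg by (intro mult_nonneg_nonneg prod_nonneg) auto
  have prod_eq: "ennreal ((\<Prod>i<Suc N. \<kappa> i \<omega> (Z i \<omega>)) * prob (E \<omega>)) = ?G \<omega> * ennreal (\<kappa> N \<omega> (Z N \<omega>))" for \<omega>
    using ennreal_mult[OF nn[of \<omega>] \<kappa>_nonneg[of N \<omega> "Z N \<omega>"]]
    by (simp add: ac_simps)
  have "(\<integral>\<^sup>+\<omega>. ?G \<omega> * ennreal (\<kappa> N \<omega> (Z N \<omega>)) / emeasure M (?E \<omega> \<inter> {\<omega>'. Z N \<omega>' = Z N \<omega>}) \<partial>M)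
      \<le> (\<integral>\<^sup>+\<omega>. ?G \<omega> * 1 / emeasure M (?E \<omega>) \<partial>M)"
  proof (rule likelihood_step)
    show "countable_cells ?E" by (rule countable_cells_chain[OF E Z])
    fix \<omega> \<omega>' assume *: "\<omega>' \<in> ?E \<omega>"
    then have "\<kappa> i \<omega>' (Z i \<omega>') = \<kappa> i \<omega> (Z i \<omega>)" if "i < N" for i
      using \<kappa>[of \<omega>' \<omega> i] that by auto
    then show "?G \<omega>' = ?G \<omega>" using cell_eq[OF E, of \<omega>' \<omega>] * by simp
    show "(\<lambda>z. ennreal (\<kappa> N \<omega>' z)) = (\<lambda>z. ennreal (\<kappa> N \<omega> z))"
      using \<kappa>[of \<omega>' \<omega> N] * by auto
  qed (use \<kappa>_sum Z in auto)
  also have "\<dots> \<le> 1" using Suc by simp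
  finally show ?case unfolding Eq prod_eq .
qed

lemma AE_eventually_le_cell:
  assumes C: "\<And>n. countable_cells (C n)" and U: "\<And>n. U n \<in> borel_measurable M" "\<And>n \<omega>. U n \<omega> \<ge> 0"
    and int: "\<And>n. (\<integral>\<^sup>+\<omega>. ennreal (U n \<omega>) / emeasure M (C n \<omega>) \<partial>M) \<le> 1" and e: "e > 0"
  shows "AE \<omega> in M. \<forall>\<^sub>F n in sequentially. U n \<omega> \<le> exp (e * real n) * prob (C n \<omega>)"
proof -
  note [measurable] = borel_measurable_prob_cell[OF C] U(1)
  \<comment> \<open>Null cells are left out because Markov's inequality divides by
    \<open>prob (C n \<omega>)\<close>; \<open>AE_cell_pos\<close> excludes them at the end.\<close>
  define A where "A n = {\<omega> \<in> space M. prob (C n \<omega>) > 0 \<and> exp (e * real n) * prob (C n \<omega>) < U n \<omega>}" for n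
  have A [measurable]: "A n \<in> sets M" for n unfolding A_def by measurable
  have bound: "prob (A n) \<le> exp (- (e * real n))" for n
  proof -
    let ?x = "ennreal (exp (e * real n))"
    have "?x * emeasure M (A n) = (\<integral>\<^sup>+\<omega>. ?x * indicator (A n) \<omega> \<partial>M)"
      by (simp add: nn_integral_cmult)
    also have "\<dots> \<le> (\<integral>\<^sup>+\<omega>. ennreal (U n \<omega>) / emeasure M (C n \<omega>) \<partial>M)"
    proof (intro nn_integral_mono)
      fix \<omega>
      show "?x * indicator (A n) \<omega> \<le> ennreal (U n \<omega>) / emeasure M (C n \<omega>)"
      proof (cases "\<omega> \<in> A n")
        case True
        then have pos: "prob (C n \<omega>) > 0" and le: "exp (e * real n) \<le> U n \<omega> / prob (C n \<omega>)"
          by (auto simp: A_def field_simps)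
        show ?thesis using True pos ennreal_leI[OF le] U(2)[of n \<omega>] by (simp add: emeasure_eq_measure divide_ennreal)
      qed simp
    qed
    also have "\<dots> \<le> 1" by (rule int)
    finally have "ennreal (exp (e * real n) * prob (A n)) \<le> ennreal 1"
      by (simp add: emeasure_eq_measure ennreal_mult)
    then have "exp (e * real n) * prob (A n) \<le> 1" by (subst (asm) ennreal_le_iff) auto
    then show ?thesis by (simp add: exp_minus field_simps)
  qed
  have "summable (\<lambda>n. exp (- e) ^ n)" using e by (intro summable_geometric) auto
  then have "summable (\<lambda>n. exp (- (e * real n)))"
    by (simp add: exp_of_nat_mult[symmetric] mult.commute)
  then have "summable (\<lambda>n. prob (A n))"
    by (rule summable_comparison_test') (use bound in auto)
  then have "AE \<omega> in M. \<forall>\<^sub>F n in sequentially. \<omega> \<in> space M - A n"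
    by (intro borel_cantelli_AE1) (auto simp: emeasure_eq_measure)
  moreover have "AE \<omega> in M. \<forall>n. prob (C n \<omega>) > 0"
    using AE_cell_pos[OF C] by (simp add: AE_all_countable)
  ultimately show ?thesis
  proof eventually_elim
    case (elim \<omega>)
    from elim(1) show ?case
      by eventually_elim (use elim(2) in \<open>auto simp: A_def\<close>)
  qed
qed

text \<open>All data may depend on \<open>n\<close>, since every window is recoded from its left
  end. The initial partition \<open>E n\<close> carries side information, such as the letters on a
  longer window.\<close>

lemma AE_chain:
  fixes Z :: "nat \<Rightarrow> nat \<Rightarrow> 'b \<Rightarrow> 'z :: countable" and \<kappa> :: "nat \<Rightarrow> nat \<Rightarrow> 'b \<Rightarrow> 'z \<Rightarrow> real"
  assumes E: "\<And>n. countable_cells (E n)" and Z: "\<And>n i. Z n i \<in> measurable M (count_space UNIV)"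
    and \<kappa>_nonneg: "\<And>n i \<omega> z. \<kappa> n i \<omega> z \<ge> 0"
    and \<kappa>: "\<And>n i \<omega> \<omega>'. \<omega>' \<in> E n \<omega> \<Longrightarrow> (\<And>j. j < i \<Longrightarrow> Z n j \<omega>' = Z n j \<omega>) \<Longrightarrow> \<kappa> n i \<omega>' = \<kappa> n i \<omega>"
    and \<kappa>_sum: "\<And>n i \<omega>. (\<integral>\<^sup>+z. ennreal (\<kappa> n i \<omega> z) \<partial>count_space UNIV) \<le> 1"
    and e: "e > 0"
  shows "AE \<omega> in M. \<forall>\<^sub>F n in sequentially. (\<Prod>i<N n. \<kappa> n i \<omega> (Z n i \<omega>)) * prob (E n \<omega>)
           \<le> exp (e * real n) * prob (E n \<omega> \<inter> {\<omega>'. \<forall>i<N n. Z n i \<omega>' = Z n i \<omega>})"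
proof (rule AE_eventually_le_cell)
  show cc: "countable_cells (\<lambda>\<omega>. E n \<omega> \<inter> {\<omega>'. \<forall>i<N n. Z n i \<omega>' = Z n i \<omega>})" for n
    by (rule countable_cells_chain[OF E Z])
  show "(\<lambda>\<omega>. (\<Prod>i<N n. \<kappa> n i \<omega> (Z n i \<omega>)) * prob (E n \<omega>)) \<in> borel_measurable M" for n
  proof (rule measurable_cells[OF cc[of n]])
    fix \<omega> \<omega>' assume *: "\<omega>' \<in> E n \<omega> \<inter> {\<omega>'. \<forall>i<N n. Z n i \<omega>' = Z n i \<omega>}"
    then have "\<kappa> n i \<omega>' (Z n i \<omega>') = \<kappa> n i \<omega> (Z n i \<omega>)" if "i < N n" for i
      using \<kappa>[of \<omega>' n \<omega> i] that by auto
    then show "(\<Prod>i<N n. \<kappa> n i \<omega>' (Z n i \<omega>')) * prob (E n \<omega>') = (\<Prod>i<N n. \<kappa> n i \<omega> (Z n i \<omega>)) * prob (E n \<omega>)"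
      using cell_eq[OF E, of \<omega>' n \<omega>] * by simp
  qed simp
  show "(\<Prod>i<N n. \<kappa> n i \<omega> (Z n i \<omega>)) * prob (E n \<omega>) \<ge> 0" for n \<omega>
    using \<kappa>_nonneg by (intro mult_nonneg_nonneg prod_nonneg) auto
  show "(\<integral>\<^sup>+\<omega>. ennreal ((\<Prod>i<N n. \<kappa> n i \<omega> (Z n i \<omega>)) * prob (E n \<omega>))
           / emeasure M (E n \<omega> \<inter> {\<omega>'. \<forall>i<N n. Z n i \<omega>' = Z n i \<omega>}) \<partial>M) \<le> 1" for n
    by (rule likelihood_chain[OF E Z \<kappa>_nonneg \<kappa> \<kappa>_sum])
qed (rule e)

end

section \<open>Measure-preserving actions of the integers, two-sided Birkhoff sums and itinerary
  cells\<close>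

locale ergodic_action = full_prob_space M for M :: "'b measure" +
  fixes S :: "int \<Rightarrow> 'b \<Rightarrow> 'b"
  assumes S_measurable [measurable]: "S i \<in> measurable M M"
    and S_distr: "distr M M (S i) = M"
    and S_add: "S i (S j \<omega>) = S (i + j) \<omega>"
    and S_zero: "S 0 \<omega> = \<omega>"
    and S_ergodic: "A \<in> sets M \<Longrightarrow> S 1 -` A = A \<Longrightarrow> prob A = 0 \<or> prob A = 1"
begin

lemma AE_S: "AE \<omega> in M. Q \<omega> \<Longrightarrow> AE \<omega> in M. Q (S i \<omega>)"
  by (rule AE_distrD[OF S_measurable[of i]]) (simp only: S_distr)

lemma S_integrable: "integrable M f \<Longrightarrow> integrable M (\<lambda>\<omega>. f (S i \<omega>) :: real)"
  using integrable_distr[OF S_measurable[of i], where f = f] by (simp only: S_distr)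

lemma S_integral:
  assumes "f \<in> borel_measurable M" shows "(\<integral>\<omega>. f (S i \<omega>) \<partial>M) = (\<integral>\<omega>. f \<omega> \<partial>M :: real)"
  using integral_distr[OF S_measurable[of i] assms] by (simp only: S_distr)

lemma S_pow: "(S 1 ^^ n) \<omega> = S (int n) \<omega>" "(S (-1) ^^ n) \<omega> = S (- int n) \<omega>"
  by (induction n) (simp_all add: S_zero S_add algebra_simps)

text \<open>Forward and backward orbits are averaged separately; \<open>S 1\<close> and
  \<open>S (-1)\<close> have the same invariant sets, so both are ergodic. Time 0 occurs in both
  sums and is subtracted once.\<close>

lemma birkhoff_sum:
  fixes f :: "'b \<Rightarrow> real"
  assumes f: "integrable M f"
  shows "AE \<omega> in M. (\<lambda>n. (\<Sum>i\<in>{- int n..<int n + 1}. f (S i \<omega>)) / real n) \<longlonglongrightarrow> 2 * integral\<^sup>L M f"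
proof -
  have inv2: "prob A = 0 \<or> prob A = 1" if "A \<in> sets M" "S (-1) -` A = A" for A
  proof -
    have "S 1 -` A = S 1 -` (S (-1) -` A)" using that by simp
    also have "\<dots> = A" by (auto simp: S_add S_zero)
    finally show ?thesis using S_ergodic[OF that(1)] by blast
  qed
  have "AE \<omega> in M. (\<lambda>n. (\<Sum>i<n. f ((S 1 ^^ i) \<omega>)) / real n) \<longlonglongrightarrow> integral\<^sup>L M f"
    using S_ergodic by (intro ergodic_birkhoff S_measurable S_distr f) (auto simp: space_UNIV)
  moreover have "AE \<omega> in M. (\<lambda>n. (\<Sum>i<n. f ((S (-1) ^^ i) \<omega>)) / real n) \<longlonglongrightarrow> integral\<^sup>L M f"
    using inv2 by (intro ergodic_birkhoff S_measurable S_distr f) (auto simp: space_UNIV)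
  ultimately show ?thesis
  proof eventually_elim
    case (elim \<omega>)
    define a where "a n = (\<Sum>i<n. f (S (int i) \<omega>))" for n
    define b where "b n = (\<Sum>i<n. f (S (- int i) \<omega>))" for n
    have lims: "(\<lambda>n. a (Suc n) / real (Suc n)) \<longlonglongrightarrow> integral\<^sup>L M f" "(\<lambda>n. b (Suc n) / real (Suc n)) \<longlonglongrightarrow> integral\<^sup>L M f"
      using elim[THEN LIMSEQ_Suc] unfolding S_pow a_def b_def by simp_all
    have c: "(\<lambda>n. real (Suc n) / real n) \<longlonglongrightarrow> 1" "(\<lambda>n. f \<omega> / real n) \<longlonglongrightarrow> 0" by real_asymp+
    have "(\<lambda>n. a (Suc n) / real (Suc n) * (real (Suc n) / real n) + b (Suc n) / real (Suc n) * (real (Suc n) / real n) - f \<omega> / real n)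
       \<longlonglongrightarrow> integral\<^sup>L M f * 1 + integral\<^sup>L M f * 1 - 0"
      by (intro tendsto_intros lims c)
    moreover have "(\<Sum>i\<in>{- int n..<int n + 1}. f (S i \<omega>)) = a (Suc n) + b (Suc n) - f \<omega>" for n
    proof -
      have "{- int n..<int n + 1} = int ` {..<Suc n} \<union> (\<lambda>i. - int i) ` {1..<Suc n}"
      proof (intro set_eqI iffI)
        fix x assume "x \<in> {- int n..<int n + 1}"
        then have "x = int (nat x) \<and> nat x < Suc n \<or> x = - int (nat (- x)) \<and> nat (- x) \<in> {1..<Suc n}"
          by auto
        then show "x \<in> int ` {..<Suc n} \<union> (\<lambda>i. - int i) ` {1..<Suc n}" by blast
      qed auto
      then have "(\<Sum>i\<in>{- int n..<int n + 1}. f (S i \<omega>))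
        = (\<Sum>i\<in>int ` {..<Suc n}. f (S i \<omega>)) + (\<Sum>i\<in>(\<lambda>i. - int i) ` {1..<Suc n}. f (S i \<omega>))"
        by (simp only:) (intro sum.union_disjoint; auto)
      also have "\<dots> = a (Suc n) + (\<Sum>i\<in>{1..<Suc n}. f (S (- int i) \<omega>))"
        unfolding a_def by (subst (1 2) sum.reindex) (auto simp: inj_on_def)
      also have "(\<Sum>i\<in>{1..<Suc n}. f (S (- int i) \<omega>)) = b (Suc n) - f \<omega>"
        unfolding b_def lessThan_atLeast0 by (subst (2) sum.atLeast_Suc_lessThan) (auto simp: S_zero)
      finally show ?thesis by simp
    qed
    moreover have "x / real (Suc n) * (real (Suc n) / real n) = x / real n" for x n
      by (simp del: of_nat_Suc)
    ultimately show ?case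
      by (simp only: add_divide_distrib diff_divide_distrib) simp
  qed
qed

definition cell :: "('b \<Rightarrow> 'c) \<Rightarrow> int set \<Rightarrow> 'b \<Rightarrow> 'b set" where
  "cell y I \<omega> = {\<omega>'. \<forall>i\<in>I. y (S i \<omega>') = y (S i \<omega>)}"

lemma cell_interval_eq: "cell x {s..<s + int N} \<omega> = {\<omega>'. \<forall>i<N. x (S (s + int i) \<omega>') = x (S (s + int i) \<omega>)}"
proof -
  have "(\<forall>i\<in>{s..<s + int N}. R i) \<longleftrightarrow> (\<forall>i<N. R (s + int i))" for R
  proof (intro iffI ballI)
    fix i assume R: "\<forall>i<N. R (s + int i)" and i: "i \<in> {s..<s + int N}"
    then have "nat (i - s) < N" by auto
    then have "R (s + int (nat (i - s)))" using R by blast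
    then show "R i" using i by simp
  qed auto
  then show ?thesis by (simp add: cell_def)
qed

lemma countable_cells_cell:
  fixes y :: "'b \<Rightarrow> 'c :: countable"
  assumes y [measurable]: "y \<in> measurable M (count_space UNIV)" and "finite I"
  shows "countable_cells (cell y I)"
  using \<open>finite I\<close>
proof (induction I)
  case empty
  then show ?case using countable_cells_UNIV by (simp add: cell_def[abs_def])
next
  case (insert i I)
  have "cell y (insert i I) = (\<lambda>\<omega>. cell y I \<omega> \<inter> {\<omega>'. y (S i \<omega>') = y (S i \<omega>)})"
    by (auto simp: cell_def fun_eq_iff)
  moreover have "(\<lambda>\<omega>. y (S i \<omega>)) \<in> measurable M (count_space UNIV)" by measurable
  ultimately show ?case using countable_cells_Int[OF insert.IH, of "\<lambda>\<omega>. y (S i \<omega>)"] by simp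
qed

lemma prob_cell_shift:
  fixes y :: "'b \<Rightarrow> 'c :: countable"
  assumes y: "y \<in> measurable M (count_space UNIV)"
  shows "prob (cell y {a + s..<b + s} \<omega>) = prob (cell y {a..<b} (S s \<omega>))"
proof -
  have "cell y {a + s..<b + s} \<omega> = S s -` cell y {a..<b} (S s \<omega>) \<inter> space M"
  proof -
    have "(\<forall>i\<in>{a + s..<b + s}. R i) \<longleftrightarrow> (\<forall>i\<in>{a..<b}. R (i + s))" for R
    proof (intro iffI ballI)
      fix i assume "\<forall>i\<in>{a..<b}. R (i + s)" "i \<in> {a + s..<b + s}"
      then have "R (i - s + s)" by (intro bspec[of "{a..<b}" "\<lambda>i. R (i + s)"]) auto
      then show "R i" by simp
    qed auto
    then show ?thesis unfolding cell_def by (auto simp: S_add space_UNIV)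
  qed
  then have "prob (cell y {a + s..<b + s} \<omega>) = measure (distr M M (S s)) (cell y {a..<b} (S s \<omega>))"
    using cell_sets[OF countable_cells_cell[OF y]] by (subst measure_distr) auto
  then show ?thesis by (simp add: S_distr)
qed

lemma cell_antimono: "I \<subseteq> J \<Longrightarrow> cell y J \<omega> \<subseteq> cell y I \<omega>"
  unfolding cell_def by auto

lemma prob_cell_antimono:
  fixes y :: "'b \<Rightarrow> 'c :: countable"
  assumes "y \<in> measurable M (count_space UNIV)" "I \<subseteq> J" "finite J"
  shows "prob (cell y J \<omega>) \<le> prob (cell y I \<omega>)"
  using cell_antimono[OF assms(2)] finite_subset[OF assms(2,3)]
  by (intro finite_measure_mono cell_sets countable_cells_cell assms) auto

lemma AE_all_cells_pos:
  fixes y :: "'b \<Rightarrow> 'c :: countable"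
  assumes y: "y \<in> measurable M (count_space UNIV)"
  shows "AE \<omega> in M. \<forall>a b i. prob (cell y {a..<b} (S i \<omega>)) > 0"
  using AE_S[OF AE_cell_pos[OF countable_cells_cell[OF y]]] by (simp add: AE_all_countable)

end

section \<open>Finite-valued stationary processes\<close>

text \<open>A quantitative form of \<open>ln t \<le> t - 1\<close>, which turns a small loss of
  entropy into a small mean square of the deficit \<open>1 - t\<close>. For \<open>t < 1\<close> the
  difference of the two sides decreases to its zero at 1.\<close>

lemma ln_quadratic_bound:
  fixes t :: real
  assumes "t > 0"
  shows "(max 0 (1 - t))\<^sup>2 / 2 \<le> t - 1 - ln t"
proof (cases "t \<ge> 1")
  case True
  then show ?thesis using ln_le_minus_one[OF assms] by simp
next
  case False
  define g where "g u = u - 1 - ln u - (1 - u)\<^sup>2 / 2" for u :: real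
  have "g 1 \<le> g t"
  proof (rule DERIV_nonpos_imp_nonincreasing[of t 1 g])
    fix u assume u: "t \<le> u" "u \<le> 1"
    then have "u > 0" using assms by simp
    have "(g has_real_derivative (1 - 1 / u + (1 - u))) (at u)"
      unfolding g_def[abs_def] using \<open>u > 0\<close> by (auto intro!: derivative_eq_intros simp: field_simps)
    moreover have "1 - 1 / u + (1 - u) = - ((1 - u)\<^sup>2 / u)"
      using \<open>u > 0\<close> by (simp add: field_simps power2_eq_square)
    ultimately show "\<exists>y. (g has_real_derivative y) (at u) \<and> y \<le> 0"
      using \<open>u > 0\<close> by (intro exI[of _ "- ((1 - u)\<^sup>2 / u)"]) simp
  qed (use False in simp)
  then show ?thesis using False by (simp add: g_def)
qed

lemma cesaro_tendsto:
  fixes c :: "nat \<Rightarrow> real"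
  assumes "c \<longlonglongrightarrow> L"
  shows "(\<lambda>n. (\<Sum>i<n. c i) / real n) \<longlonglongrightarrow> L"
proof (rule LIMSEQ_I)
  fix e :: real assume e: "e > 0"
  then obtain N where N: "\<And>n. n \<ge> N \<Longrightarrow> \<bar>c n - L\<bar> < e / 2"
    using LIMSEQ_D[OF assms, of "e/2"] by auto
  define C where "C = (\<Sum>i<N. \<bar>c i - L\<bar>)"
  have "\<forall>\<^sub>F n in sequentially. C < real n * (e / 2)" using e by real_asymp
  then have "\<forall>\<^sub>F n in sequentially. norm ((\<Sum>i<n. c i) / real n - L) < e"
    using eventually_ge_at_top[of N] eventually_gt_at_top[of 0]
  proof eventually_elim
    case (elim n)
    have "\<bar>(\<Sum>i<n. c i) - real n * L\<bar> = \<bar>\<Sum>i<n. c i - L\<bar>" by (simp add: sum_subtractf)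
    also have "\<dots> \<le> (\<Sum>i<n. \<bar>c i - L\<bar>)" by (rule sum_abs)
    also have "\<dots> = (\<Sum>i\<in>{..<N} \<union> {N..<n}. \<bar>c i - L\<bar>)" using elim by (intro sum.cong) auto
    also have "\<dots> = C + (\<Sum>i\<in>{N..<n}. \<bar>c i - L\<bar>)"
      unfolding C_def by (intro sum.union_disjoint) auto
    also have "(\<Sum>i\<in>{N..<n}. \<bar>c i - L\<bar>) \<le> (\<Sum>i\<in>{N..<n}. e / 2)"
      using N by (intro sum_mono less_imp_le) auto
    also have "\<dots> \<le> real n * (e / 2)" using e by (simp add: mult_right_mono)
    finally have "\<bar>(\<Sum>i<n. c i) - real n * L\<bar> < real n * e" using elim by simp
    moreover have "(\<Sum>i<n. c i) / real n - L = ((\<Sum>i<n. c i) - real n * L) / real n"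
      using elim by (simp add: field_simps)
    ultimately show ?case using elim by (simp add: abs_divide pos_divide_less_eq mult.commute)
  qed
  then show "\<exists>no. \<forall>n\<ge>no. norm ((\<Sum>i<n. c i) / real n - L) < e"
    by (simp add: eventually_sequentially)
qed

lemma sum_int_interval: "(\<Sum>j<2 * n + 1. F (- int n + int j)) = (\<Sum>i\<in>{- int n..<int n + 1}. F i)"
  by (rule sum.reindex_bij_witness[where i = "\<lambda>i. nat (i + int n)" and j = "\<lambda>j. - int n + int j"]) auto

locale finite_process = ergodic_action M S for M :: "'b measure" and S +
  fixes y :: "'b \<Rightarrow> nat" and m :: nat
  assumes y_measurable [measurable]: "y \<in> measurable M (count_space UNIV)"
    and y_less: "y \<omega> < m"
begin

lemma m_pos: "m > 0"
  using y_less[of undefined] by simp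

definition past_prob :: "nat \<Rightarrow> 'b \<Rightarrow> real" where
  "past_prob k \<omega> = prob (cell y {- int k..<0} \<omega>)"

definition joint_prob :: "nat \<Rightarrow> 'b \<Rightarrow> real" where
  "joint_prob k \<omega> = prob (cell y {- int k..<1} \<omega>)"

text \<open>The conditional probability of the present symbol given the \<open>k\<close> preceding
  ones, read at \<open>\<omega>\<close>; \<open>info k\<close> is the corresponding information
  function. A null past gives 0 by division by zero, and \<open>ln 0 = 0\<close> keeps
  \<open>info\<close> nonnegative there.\<close>

definition step_prob :: "nat \<Rightarrow> 'b \<Rightarrow> real" where
  "step_prob k \<omega> = joint_prob k \<omega> / past_prob k \<omega>"

definition info :: "nat \<Rightarrow> 'b \<Rightarrow> real" where
  "info k \<omega> = - ln (step_prob k \<omega>)"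

definition cond_entropy :: "nat \<Rightarrow> real" where
  "cond_entropy k = (\<integral>\<omega>. info k \<omega> \<partial>M)"

lemma cell_cong: "\<omega>' \<in> cell y I \<omega> \<Longrightarrow> cell y I \<omega>' = cell y I \<omega>"
  unfolding cell_def by auto

lemma cells: "finite I \<Longrightarrow> countable_cells (cell y I)"
  by (rule countable_cells_cell) measurable

lemma measurable_probs [measurable]:
  "past_prob k \<in> borel_measurable M" "joint_prob k \<in> borel_measurable M"
  "step_prob k \<in> borel_measurable M" "info k \<in> borel_measurable M"
proof -
  show [measurable]: "past_prob k \<in> borel_measurable M" "joint_prob k \<in> borel_measurable M"
    unfolding past_prob_def[abs_def] joint_prob_def[abs_def] by (rule borel_measurable_prob_cell; simp add: cells)+
  show [measurable]: "step_prob k \<in> borel_measurable M" unfolding step_prob_def[abs_def] by measurable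
  show "info k \<in> borel_measurable M" unfolding info_def[abs_def] by measurable
qed

lemma AE_probs_pos: "AE \<omega> in M. \<forall>k. past_prob k \<omega> > 0 \<and> joint_prob k \<omega> > 0"
  using AE_all_cells_pos[OF y_measurable]
proof eventually_elim
  case (elim \<omega>)
  then have "0 < prob (cell y {a..<b} (S 0 \<omega>))" for a b by blast
  then show ?case unfolding past_prob_def joint_prob_def by (simp add: S_zero)
qed

lemma joint_le_past: "joint_prob k \<omega> \<le> past_prob k \<omega>"
  unfolding past_prob_def joint_prob_def by (rule prob_cell_antimono) auto

lemma step_prob_bounds: "0 \<le> step_prob k \<omega>" "step_prob k \<omega> \<le> 1"
  unfolding step_prob_def using joint_le_past[of k \<omega>]
  by (auto simp: past_prob_def joint_prob_def divide_le_eq_1 less_le)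

lemma info_nonneg: "info k \<omega> \<ge> 0"
  unfolding info_def using step_prob_bounds[of k \<omega>] by (cases "step_prob k \<omega> = 0") auto

lemma AE_step_prob_pos: "AE \<omega> in M. \<forall>k. step_prob k \<omega> > 0"
  using AE_probs_pos by eventually_elim (simp add: step_prob_def)

lemma cell_joint: "cell y {- int k..<1} \<omega> = cell y {- int k..<0} \<omega> \<inter> {\<omega>'. y \<omega>' = y \<omega>}"
proof -
  have "{- int k..<1} = insert 0 {- int k..<0}" by auto
  then show ?thesis by (auto simp: cell_def S_zero)
qed

text \<open>Given the past, a symbol of probability \<open>p > 0\<close> contributes
  \<open>p * (1 / p) = 1\<close>, and there are at most \<open>m\<close> symbols. That the bound
  does not involve \<open>k\<close> matters for the truncation of \<open>info k\<close>.\<close>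

lemma nn_integral_inverse_step_prob: "(\<integral>\<^sup>+\<omega>. ennreal (1 / step_prob k \<omega>) \<partial>M) \<le> ennreal (real m)"
proof -
  let ?E = "cell y {- int k..<0}"
  have "(\<integral>\<^sup>+\<omega>. ennreal (1 / step_prob k \<omega>) \<partial>M)
      = (\<integral>\<^sup>+\<omega>. ennreal (past_prob k \<omega>) * indicator {..<m} (y \<omega>) / emeasure M (?E \<omega> \<inter> {\<omega>'. y \<omega>' = y \<omega>}) \<partial>M)"
    using AE_probs_pos
  proof (intro nn_integral_cong_AE, eventually_elim)
    case (elim \<omega>)
    then show ?case using y_less[of \<omega>] divide_ennreal[of "past_prob k \<omega>" "joint_prob k \<omega>"]
      by (simp add: step_prob_def cell_joint[symmetric] emeasure_eq_measure joint_prob_def[symmetric] less_imp_le)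
  qed
  also have "\<dots> \<le> (\<integral>\<^sup>+\<omega>. ennreal (past_prob k \<omega>) * ennreal (real m) / emeasure M (?E \<omega>) \<partial>M)"
  proof (rule likelihood_step)
    show "countable_cells ?E" by (simp add: cells)
    show "ennreal (past_prob k \<omega>') = ennreal (past_prob k \<omega>)" if "\<omega>' \<in> ?E \<omega>" for \<omega> \<omega>'
      using cell_cong[OF that] unfolding past_prob_def by simp
    show "(\<integral>\<^sup>+z. indicator {..<m} z \<partial>count_space UNIV) \<le> ennreal (real m)"
      by (simp add: ennreal_of_nat_eq_real_of_nat)
  qed auto
  also have "\<dots> = (\<integral>\<^sup>+\<omega>. ennreal (real m) \<partial>M)"
    using AE_probs_pos
  proof (intro nn_integral_cong_AE, eventually_elim)
    case (elim \<omega>)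
    then have "ennreal (past_prob k \<omega>) * ennreal (real m) / emeasure M (?E \<omega>) = ennreal (past_prob k \<omega> * real m / past_prob k \<omega>)"
      by (subst divide_ennreal[symmetric])
        (auto simp: emeasure_eq_measure past_prob_def[symmetric] ennreal_mult less_imp_le)
    also have "past_prob k \<omega> * real m / past_prob k \<omega> = real m" using elim by (simp add: less_imp_neq[THEN not_sym])
    finally show ?case .
  qed
  also have "\<dots> = ennreal (real m)" by (simp add: emeasure_space_1)
  finally show ?thesis .
qed

lemma inverse_step_prob:
  "integrable M (\<lambda>\<omega>. 1 / step_prob k \<omega>)" "(\<integral>\<omega>. 1 / step_prob k \<omega> \<partial>M) \<le> real m"
proof -
  have nn: "AE \<omega> in M. 0 \<le> 1 / step_prob k \<omega>" using step_prob_bounds by auto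
  show int: "integrable M (\<lambda>\<omega>. 1 / step_prob k \<omega>)"
    using nn_integral_inverse_step_prob[of k] nn by (intro integrableI_nonneg) (auto simp: order_le_less_trans)
  have "ennreal (\<integral>\<omega>. 1 / step_prob k \<omega> \<partial>M) \<le> ennreal (real m)"
    using nn_integral_eq_integral[OF int nn] nn_integral_inverse_step_prob[of k] by simp
  then show "(\<integral>\<omega>. 1 / step_prob k \<omega> \<partial>M) \<le> real m" by simp
qed

lemma info_integrable: "integrable M (info k)"
proof (rule Bochner_Integration.integrable_bound[OF inverse_step_prob(1)[of k]])
  show "AE \<omega> in M. norm (info k \<omega>) \<le> norm (1 / step_prob k \<omega>)"
    using AE_step_prob_pos
  proof eventually_elim
    case (elim \<omega>)
    then have "step_prob k \<omega> > 0" by blast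
    then have "info k \<omega> = ln (1 / step_prob k \<omega>)" unfolding info_def by (simp add: ln_div)
    also have "\<dots> \<le> 1 / step_prob k \<omega>" using \<open>step_prob k \<omega> > 0\<close> by (intro less_imp_le ln_less_self) simp
    finally show ?case using info_nonneg[of k \<omega>] step_prob_bounds[of k \<omega>] by simp
  qed
qed measurable

text \<open>Under \<open>M\<close>, the likelihood ratio of the Markov measure of order \<open>k\<close> is a supermartingale
  in the length \<open>j\<close> of the observed past.\<close>

definition ratio :: "nat \<Rightarrow> nat \<Rightarrow> 'b \<Rightarrow> real" where
  "ratio k j \<omega> = step_prob k \<omega> / step_prob j \<omega>"

lemma ratio_nonneg: "ratio k j \<omega> \<ge> 0"
  unfolding ratio_def using step_prob_bounds by simp

lemma ratio_measurable [measurable]: "ratio k j \<in> borel_measurable M"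
  unfolding ratio_def[abs_def] by measurable

lemma step_prob_cell:
  assumes "k \<le> j" "\<omega>' \<in> cell y {- int j..<1} \<omega>"
  shows "step_prob k \<omega>' = step_prob k \<omega>"
proof -
  have "{- int k..<0} \<subseteq> {- int j..<1}" "{- int k..<1} \<subseteq> {- int j..<1}" using assms(1) by auto
  then have "\<omega>' \<in> cell y {- int k..<0} \<omega>" "\<omega>' \<in> cell y {- int k..<1} \<omega>"
    using cell_antimono assms(2) by blast+
  then have "cell y {- int k..<0} \<omega>' = cell y {- int k..<0} \<omega>" "cell y {- int k..<1} \<omega>' = cell y {- int k..<1} \<omega>"
    by (auto intro!: cell_cong)
  then show ?thesis unfolding step_prob_def joint_prob_def past_prob_def by simp
qed

text \<open>Up to null cells, \<open>ratio k j\<close> is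
  \<open>step_prob k * past_prob j / joint_prob j\<close>. Refining by the symbol at time
  \<open>- int (Suc j)\<close> splits the past cell into parts of the same total mass, while
  \<open>g\<close> and \<open>step_prob k\<close> are already fixed by the cell. The weight
  \<open>g\<close> replaces conditional expectations.\<close>

lemma ratio_supermartingale_step:
  assumes kj: "k \<le> j" and g: "\<And>\<omega> \<omega>'. \<omega>' \<in> cell y {- int j..<1} \<omega> \<Longrightarrow> g \<omega>' = g \<omega>" "\<And>\<omega>. g \<omega> \<ge> 0"
  shows "(\<integral>\<^sup>+\<omega>. ennreal (g \<omega> * ratio k (Suc j) \<omega>) \<partial>M) \<le> (\<integral>\<^sup>+\<omega>. ennreal (g \<omega> * ratio k j \<omega>) \<partial>M)"
proof -
  let ?E = "cell y {- int j..<1}" and ?P = "cell y {- int j..<0}"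
  let ?Z = "\<lambda>\<omega>. y (S (- int (Suc j)) \<omega>)"
  let ?G = "\<lambda>\<omega>. ennreal (g \<omega> * step_prob k \<omega>)"
  let ?\<kappa> = "\<lambda>\<omega> z. emeasure M (?P \<omega> \<inter> {\<omega>'. ?Z \<omega>' = z})"
  have Zm: "?Z \<in> measurable M (count_space UNIV)" by measurable
  have ins: "{- int (Suc j)..<b} = insert (- int (Suc j)) {- int j..<b}" if "b \<ge> 0" for b :: int using that by auto
  have E': "cell y {- int (Suc j)..<b} \<omega> = cell y {- int j..<b} \<omega> \<inter> {\<omega>'. ?Z \<omega>' = ?Z \<omega>}" if "b \<ge> 0" for b \<omega>
    unfolding ins[OF that] by (auto simp: cell_def)
  have Pm: "?P \<omega> \<in> sets M" for \<omega> by (intro cell_sets cells) simp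
  have rat: "ennreal (g \<omega> * ratio k i \<omega>) = ?G \<omega> * ennreal (past_prob i \<omega>) / ennreal (joint_prob i \<omega>)"
    if "past_prob i \<omega> > 0" "joint_prob i \<omega> > 0" for i \<omega>
  proof -
    have "g \<omega> * ratio k i \<omega> = g \<omega> * step_prob k \<omega> * past_prob i \<omega> / joint_prob i \<omega>"
      unfolding ratio_def step_prob_def[of i] by simp
    then show ?thesis using that step_prob_bounds(1)[of k \<omega>] g(2)[of \<omega>]
      by (simp add: divide_ennreal[symmetric] ennreal_mult)
  qed
  have "(\<integral>\<^sup>+\<omega>. ennreal (g \<omega> * ratio k (Suc j) \<omega>) \<partial>M)
     = (\<integral>\<^sup>+\<omega>. ?G \<omega> * ?\<kappa> \<omega> (?Z \<omega>) / emeasure M (?E \<omega> \<inter> {\<omega>'. ?Z \<omega>' = ?Z \<omega>}) \<partial>M)"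
    using AE_probs_pos
  proof (intro nn_integral_cong_AE, eventually_elim)
    case (elim \<omega>)
    then have "past_prob (Suc j) \<omega> > 0" "joint_prob (Suc j) \<omega> > 0" by auto
    from rat[OF this] show ?case unfolding past_prob_def joint_prob_def emeasure_eq_measure
      using E'[of 0 \<omega>] E'[of 1 \<omega>] by simp
  qed
  also have "\<dots> \<le> (\<integral>\<^sup>+\<omega>. ?G \<omega> * emeasure M (?P \<omega>) / emeasure M (?E \<omega>) \<partial>M)"
  proof (rule likelihood_step)
    show "countable_cells ?E" by (simp add: cells)
    fix \<omega> \<omega>' assume *: "\<omega>' \<in> ?E \<omega>"
    show "?G \<omega>' = ?G \<omega>" using g(1)[OF *] step_prob_cell[OF kj *] by simp
    have "{- int j..<0} \<subseteq> {- int j..<1}" by auto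
    then have "\<omega>' \<in> ?P \<omega>" using * cell_antimono by blast
    then have "?P \<omega>' = ?P \<omega>" by (rule cell_cong)
    then show "?\<kappa> \<omega>' = ?\<kappa> \<omega>" "emeasure M (?P \<omega>') = emeasure M (?P \<omega>)" by simp_all
  next
    fix \<omega>
    show "(\<integral>\<^sup>+z. ?\<kappa> \<omega> z \<partial>count_space UNIV) \<le> emeasure M (?P \<omega>)"
      by (rule eq_refl[OF nn_integral_emeasure_level_sets[OF Zm Pm]])
  qed (rule Zm)
  also have "\<dots> = (\<integral>\<^sup>+\<omega>. ennreal (g \<omega> * ratio k j \<omega>) \<partial>M)"
    using AE_probs_pos
  proof (intro nn_integral_cong_AE, eventually_elim)
    case (elim \<omega>)
    then have "past_prob j \<omega> > 0" "joint_prob j \<omega> > 0" by auto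
    from rat[OF this] show ?case unfolding past_prob_def joint_prob_def emeasure_eq_measure by simp
  qed
  finally show ?thesis .
qed

lemma ratio_supermartingale:
  assumes kj: "k \<le> j" "j \<le> i" and g: "\<And>\<omega> \<omega>'. \<omega>' \<in> cell y {- int j..<1} \<omega> \<Longrightarrow> g \<omega>' = g \<omega>" "\<And>\<omega>. g \<omega> \<ge> 0"
  shows "(\<integral>\<^sup>+\<omega>. ennreal (g \<omega> * ratio k i \<omega>) \<partial>M) \<le> (\<integral>\<^sup>+\<omega>. ennreal (g \<omega> * ratio k j \<omega>) \<partial>M)"
  using \<open>j \<le> i\<close>
proof (induction i rule: dec_induct)
  case (step i)
  have "g \<omega>' = g \<omega>" if "\<omega>' \<in> cell y {- int i..<1} \<omega>" for \<omega> \<omega>'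
  proof -
    have "{- int j..<1} \<subseteq> {- int i..<1}" using step by auto
    then show ?thesis using that cell_antimono g(1) by blast
  qed
  then have "(\<integral>\<^sup>+\<omega>. ennreal (g \<omega> * ratio k (Suc i) \<omega>) \<partial>M) \<le> (\<integral>\<^sup>+\<omega>. ennreal (g \<omega> * ratio k i \<omega>) \<partial>M)"
    using kj step g(2) by (intro ratio_supermartingale_step) auto
  then show ?case using step.IH by (rule order_trans)
qed simp

lemma ratio_integral:
  assumes "k \<le> j"
  shows "integrable M (ratio k j)" "(\<integral>\<omega>. ratio k j \<omega> \<partial>M) \<le> 1"
proof -
  have "(\<integral>\<^sup>+\<omega>. ennreal (ratio k j \<omega>) \<partial>M) \<le> (\<integral>\<^sup>+\<omega>. ennreal (ratio k k \<omega>) \<partial>M)"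
    using ratio_supermartingale[OF order_refl assms, of "\<lambda>_. 1"] by simp
  also have "\<dots> \<le> (\<integral>\<^sup>+\<omega>. 1 \<partial>M)"
    unfolding ratio_def by (intro nn_integral_mono) (auto simp: divide_self_if)
  finally have le: "(\<integral>\<^sup>+\<omega>. ennreal (ratio k j \<omega>) \<partial>M) \<le> 1" by (simp add: emeasure_space_1)
  have nn: "AE \<omega> in M. 0 \<le> ratio k j \<omega>" using ratio_nonneg by simp
  show int: "integrable M (ratio k j)"
    using le nn by (intro integrableI_nonneg) (auto simp: order_le_less_trans)
  show "(\<integral>\<omega>. ratio k j \<omega> \<partial>M) \<le> 1"
    using nn_integral_eq_integral[OF int nn] le by simp
qed

text \<open>Since \<open>ln (ratio k j) = info j - info k\<close> almost surely, integrating
  \<open>ln_quadratic_bound\<close> leaves only the entropy drop, because the mean of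
  \<open>ratio k j\<close> is at most 1. In particular conditional entropies decrease.\<close>

lemma ratio_deficit:
  assumes "k \<le> j"
  shows "integrable M (\<lambda>\<omega>. (max 0 (1 - ratio k j \<omega>))\<^sup>2)"
    "(\<integral>\<omega>. (max 0 (1 - ratio k j \<omega>))\<^sup>2 \<partial>M) \<le> 2 * (cond_entropy k - cond_entropy j)"
proof -
  have bd: "\<bar>max 0 (1 - ratio k j \<omega>)\<bar> \<le> 1" for \<omega> using ratio_nonneg[of k j \<omega>] by auto
  show int: "integrable M (\<lambda>\<omega>. (max 0 (1 - ratio k j \<omega>))\<^sup>2)"
    by (rule integrable_const_bound[where B = 1]) (use bd in \<open>auto simp: abs_square_le_1 simp del: abs_le_iff\<close>)
  have "(\<integral>\<omega>. (max 0 (1 - ratio k j \<omega>))\<^sup>2 / 2 \<partial>M) \<le> (\<integral>\<omega>. ratio k j \<omega> - 1 + info k \<omega> - info j \<omega> \<partial>M)"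
  proof (rule integral_mono_AE)
    show "AE \<omega> in M. (max 0 (1 - ratio k j \<omega>))\<^sup>2 / 2 \<le> ratio k j \<omega> - 1 + info k \<omega> - info j \<omega>"
      using AE_step_prob_pos
    proof eventually_elim
      case (elim \<omega>)
      then have pos: "step_prob k \<omega> > 0" "step_prob j \<omega> > 0" by auto
      then have "ratio k j \<omega> > 0" "ln (ratio k j \<omega>) = info j \<omega> - info k \<omega>"
        unfolding ratio_def info_def by (simp_all add: ln_div)
      then show ?case using ln_quadratic_bound[of "ratio k j \<omega>"] by simp
    qed
  qed (use int ratio_integral[OF assms] info_integrable in auto)
  also have "\<dots> = (\<integral>\<omega>. ratio k j \<omega> \<partial>M) - 1 + cond_entropy k - cond_entropy j"
    unfolding cond_entropy_def using ratio_integral[OF assms] info_integrable by (simp add: prob_space)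
  finally show "(\<integral>\<omega>. (max 0 (1 - ratio k j \<omega>))\<^sup>2 \<partial>M) \<le> 2 * (cond_entropy k - cond_entropy j)"
    using ratio_integral(2)[OF assms] by simp
qed

lemma cond_entropy_decseq: "decseq cond_entropy"
  unfolding decseq_def
proof (intro allI impI)
  fix k j :: nat assume "k \<le> j"
  have "0 \<le> (\<integral>\<omega>. (max 0 (1 - ratio k j \<omega>))\<^sup>2 \<partial>M)" by (intro Bochner_Integration.integral_nonneg) auto
  also have "\<dots> \<le> 2 * (cond_entropy k - cond_entropy j)" by (rule ratio_deficit(2)[OF \<open>k \<le> j\<close>])
  finally show "cond_entropy j \<le> cond_entropy k" by simp
qed

definition entropy_rate :: real where
  "entropy_rate = lim cond_entropy"

lemma cond_entropy_nonneg: "cond_entropy k \<ge> 0"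
  unfolding cond_entropy_def using info_nonneg by (intro Bochner_Integration.integral_nonneg) auto

lemma entropy_rate_tendsto: "cond_entropy \<longlonglongrightarrow> entropy_rate"
  and entropy_rate_le: "entropy_rate \<le> cond_entropy k"
proof -
  obtain L where "cond_entropy \<longlonglongrightarrow> L" "\<And>k. L \<le> cond_entropy k"
    using decseq_convergent[OF cond_entropy_decseq, of 0] cond_entropy_nonneg by auto
  moreover from this have "entropy_rate = L" unfolding entropy_rate_def by (intro limI)
  ultimately show "cond_entropy \<longlonglongrightarrow> entropy_rate" "entropy_rate \<le> cond_entropy k" by auto
qed

lemma entropy_rate_nonneg: "entropy_rate \<ge> 0"
  using entropy_rate_tendsto cond_entropy_nonneg by (intro LIMSEQ_le_const) auto

text \<open>The chain rule: the symbol at \<open>s + int j\<close> is read given the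
  \<open>j\<close> symbols before it, and stationarity moves this factor to the origin.\<close>

lemma AE_ln_cell:
  "AE \<omega> in M. \<forall>s N. - ln (prob (cell y {s..<s + int N} \<omega>)) = (\<Sum>j<N. info j (S (s + int j) \<omega>))"
  using AE_all_cells_pos[OF y_measurable]
proof eventually_elim
  case (elim \<omega>)
  show ?case
  proof (intro allI)
    fix s N
    show "- ln (prob (cell y {s..<s + int N} \<omega>)) = (\<Sum>j<N. info j (S (s + int j) \<omega>))"
    proof (induction N)
      case 0
      then show ?case by (simp add: cell_def prob_space flip: space_UNIV)
    next
      case (Suc N)
      have "joint_prob N (S (s + int N) \<omega>) = prob (cell y {s..<s + int (Suc N)} \<omega>)"
        unfolding joint_prob_def using prob_cell_shift[OF y_measurable, of "- int N" "s + int N" 1 \<omega>]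
        by (simp add: algebra_simps)
      moreover have "past_prob N (S (s + int N) \<omega>) = prob (cell y {s..<s + int N} \<omega>)"
        unfolding past_prob_def using prob_cell_shift[OF y_measurable, of "- int N" "s + int N" 0 \<omega>] by simp
      moreover have "prob (cell y {s..<s + int (Suc N)} \<omega>) > 0" "prob (cell y {s..<s + int N} \<omega>) > 0"
        using elim[rule_format, of _ _ 0] by (simp_all only: S_zero)
      ultimately have "info N (S (s + int N) \<omega>)
        = - ln (prob (cell y {s..<s + int (Suc N)} \<omega>)) + ln (prob (cell y {s..<s + int N} \<omega>))"
        unfolding info_def step_prob_def by (simp add: ln_div)
      then show ?case using Suc by simp
    qed
  qed
qed

lemma integral_ln_cell:
  "(\<integral>\<omega>. - ln (prob (cell y {0..<int n} \<omega>)) \<partial>M) = (\<Sum>j<n. cond_entropy j)"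
proof -
  have "(\<integral>\<omega>. - ln (prob (cell y {0..<int n} \<omega>)) \<partial>M) = (\<integral>\<omega>. (\<Sum>j<n. info j (S (int j) \<omega>)) \<partial>M)"
  proof (rule integral_cong_AE)
    have [measurable]: "(\<lambda>\<omega>. prob (cell y {0..<int n} \<omega>)) \<in> borel_measurable M"
      by (rule borel_measurable_prob_cell) (simp add: cells)
    show "(\<lambda>\<omega>. - ln (prob (cell y {0..<int n} \<omega>))) \<in> borel_measurable M" by measurable
    show "AE \<omega> in M. - ln (prob (cell y {0..<int n} \<omega>)) = (\<Sum>j<n. info j (S (int j) \<omega>))"
      using AE_ln_cell
    proof eventually_elim
      case (elim \<omega>)
      then show ?case using elim[rule_format, of 0 n] by simp
    qed
  qed measurable
  also have "\<dots> = (\<Sum>j<n. cond_entropy j)"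
    unfolding cond_entropy_def
    by (subst Bochner_Integration.integral_sum) (simp_all add: S_integrable info_integrable S_integral)
  finally show ?thesis .
qed

lemma entropy_rate_cesaro:
  "(\<lambda>n. (\<integral>\<omega>. - ln (prob (cell y {0..<int n} \<omega>)) \<partial>M) / real n) \<longlonglongrightarrow> entropy_rate"
  unfolding integral_ln_cell by (rule cesaro_tendsto[OF entropy_rate_tendsto])

text \<open>Split by the first \<open>j\<close> at which the ratio falls below \<open>t\<close>.
  That event is determined by the cell up to \<open>j\<close>, so the supermartingale property keeps
  the integral of \<open>ratio k J\<close> over it below \<open>t\<close> times its probability.
  Hence the deficit \<open>1 - ratio k J\<close> is large in mean on the whole event, while entropy
  bounds the deficit independently of \<open>J\<close>.\<close>

lemma ratio_maximal:
  assumes t: "0 < t" "t < 1" and \<eta>: "\<eta> > 0"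
  shows "prob {\<omega>. \<exists>j\<in>{k..J}. ratio k j \<omega> < t} * (1 - t) \<le> \<eta> / 2 + (cond_entropy k - entropy_rate) / \<eta>"
proof (cases "k \<le> J")
  case kJ: True
  define B where "B j = {\<omega>. ratio k j \<omega> < t \<and> (\<forall>i\<in>{k..<j}. \<not> ratio k i \<omega> < t)}" for j
  define E where "E = {\<omega>. \<exists>j\<in>{k..J}. ratio k j \<omega> < t}"
  have Bm [measurable]: "B j \<in> sets M" for j
  proof -
    have "{\<omega>\<in>space M. ratio k j \<omega> < t \<and> (\<forall>i\<in>{k..<j}. \<not> ratio k i \<omega> < t)} \<in> sets M" by measurable
    then show ?thesis by (simp add: B_def space_UNIV)
  qed
  have EB: "E = (\<Union>j\<in>{k..J}. B j)"
  proof (intro set_eqI iffI)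
    fix \<omega> assume "\<omega> \<in> E"
    then obtain j0 where j0: "k \<le> j0 \<and> j0 \<le> J \<and> ratio k j0 \<omega> < t" by (auto simp: E_def)
    define j where "j = (LEAST j. k \<le> j \<and> j \<le> J \<and> ratio k j \<omega> < t)"
    have "k \<le> j \<and> j \<le> J \<and> ratio k j \<omega> < t" 
      using LeastI[of "\<lambda>j. k \<le> j \<and> j \<le> J \<and> ratio k j \<omega> < t" j0] j0 unfolding j_def by blast
    moreover have "\<not> ratio k i \<omega> < t" if "i \<in> {k..<j}" for i
      using not_less_Least[of i "\<lambda>j. k \<le> j \<and> j \<le> J \<and> ratio k j \<omega> < t"] that calculation unfolding j_def by auto
    ultimately show "\<omega> \<in> (\<Union>j\<in>{k..J}. B j)" by (auto simp: B_def)
  qed (auto simp: B_def E_def)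
  have disj: "disjoint_family_on B {k..J}"
    unfolding disjoint_family_on_def
  proof (intro ballI impI)
    fix i j assume "i \<in> {k..J}" "j \<in> {k..J}" "i \<noteq> j"
    then show "B i \<inter> B j = {}" by (cases "i < j") (auto simp: B_def)
  qed
  have Em [measurable]: "E \<in> sets M" unfolding EB by measurable
  have ind: "indicator E \<omega> = (\<Sum>j\<in>{k..J}. indicator (B j) \<omega> :: real)" for \<omega>
    unfolding EB using disj by (intro indicator_UN_disjoint) auto
  have "(\<integral>\<^sup>+\<omega>. ennreal (indicator E \<omega> * ratio k J \<omega>) \<partial>M)
      = (\<integral>\<^sup>+\<omega>. (\<Sum>j\<in>{k..J}. ennreal (indicator (B j) \<omega> * ratio k J \<omega>)) \<partial>M)"
    using ratio_nonneg by (intro nn_integral_cong) (simp add: ind sum_distrib_right)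
  also have "\<dots> = (\<Sum>j\<in>{k..J}. \<integral>\<^sup>+\<omega>. ennreal (indicator (B j) \<omega> * ratio k J \<omega>) \<partial>M)"
    by (rule nn_integral_sum) measurable
  also have "\<dots> \<le> (\<Sum>j\<in>{k..J}. ennreal (t * prob (B j)))"
  proof (rule sum_mono)
    fix j assume j: "j \<in> {k..J}"
    have "(\<integral>\<^sup>+\<omega>. ennreal (indicator (B j) \<omega> * ratio k J \<omega>) \<partial>M) \<le> (\<integral>\<^sup>+\<omega>. ennreal (indicator (B j) \<omega> * ratio k j \<omega>) \<partial>M)"
    proof (rule ratio_supermartingale)
      fix \<omega> \<omega>' assume *: "\<omega>' \<in> cell y {- int j..<1} \<omega>"
      then have "ratio k i \<omega>' = ratio k i \<omega>" if "i \<in> {k..j}" for i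
        using that unfolding ratio_def by (simp add: step_prob_cell[of _ j])
      then show "indicator (B j) \<omega>' = (indicator (B j) \<omega> :: real)" using j
        by (simp add: B_def indicator_def)
    qed (use j in auto)
    also have "\<dots> \<le> (\<integral>\<^sup>+\<omega>. ennreal t * indicator (B j) \<omega> \<partial>M)"
      by (intro nn_integral_mono) (auto simp: indicator_def B_def intro!: ennreal_leI)
    also have "\<dots> = ennreal (t * prob (B j))" using t by (simp add: nn_integral_cmult emeasure_eq_measure ennreal_mult)
    finally show "(\<integral>\<^sup>+\<omega>. ennreal (indicator (B j) \<omega> * ratio k J \<omega>) \<partial>M) \<le> ennreal (t * prob (B j))" .
  qed
  also have "\<dots> = ennreal (t * (\<Sum>j\<in>{k..J}. prob (B j)))" using t by (simp add: sum_distrib_left)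
  also have "(\<Sum>j\<in>{k..J}. prob (B j)) = prob E"
    unfolding EB using disj by (subst finite_measure_finite_Union) auto
  finally have le: "(\<integral>\<^sup>+\<omega>. ennreal (indicator E \<omega> * ratio k J \<omega>) \<partial>M) \<le> ennreal (t * prob E)" .
  have int1: "integrable M (\<lambda>\<omega>. indicator E \<omega> * ratio k J \<omega>)"
    using integrable_mult_indicator[OF Em ratio_integral(1)[OF kJ]] by simp
  have "ennreal (\<integral>\<omega>. indicator E \<omega> * ratio k J \<omega> \<partial>M) \<le> ennreal (t * prob E)"
    using le nn_integral_eq_integral[OF int1] ratio_nonneg by simp
  then have le': "(\<integral>\<omega>. indicator E \<omega> * ratio k J \<omega> \<partial>M) \<le> t * prob E"
    using t by (subst (asm) ennreal_le_iff) auto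
  have intE: "integrable M (\<lambda>\<omega>. indicator E \<omega> :: real)" by (simp add: emeasure_eq_measure)
  have "prob E * (1 - t) \<le> (\<integral>\<omega>. indicator E \<omega> - indicator E \<omega> * ratio k J \<omega> \<partial>M)"
    using int1 intE le' by (simp add: algebra_simps space_UNIV)
  also have "\<dots> \<le> (\<integral>\<omega>. \<eta> / 2 + (max 0 (1 - ratio k J \<omega>))\<^sup>2 / (2 * \<eta>) \<partial>M)"
  proof (rule integral_mono)
    fix \<omega>
    let ?d = "max 0 (1 - ratio k J \<omega>)"
    \<comment> \<open>Young's inequality passes from the mean of the deficit to its mean square;
      \<open>\<eta>\<close> stays free and is fixed in \<open>ratio_maximal_small\<close>.\<close>
    have "0 \<le> (\<eta> - ?d)\<^sup>2 / (2 * \<eta>)" using \<eta> by simp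
    also have "\<dots> = \<eta> / 2 + ?d\<^sup>2 / (2 * \<eta>) - ?d" using \<eta> by (simp add: field_simps power2_eq_square)
    finally have "?d \<le> \<eta> / 2 + ?d\<^sup>2 / (2 * \<eta>)" by simp
    moreover have "indicator E \<omega> - indicator E \<omega> * ratio k J \<omega> \<le> ?d" by (simp add: indicator_def)
    ultimately show "indicator E \<omega> - indicator E \<omega> * ratio k J \<omega> \<le> \<eta> / 2 + ?d\<^sup>2 / (2 * \<eta>)" by linarith
  qed (use int1 intE ratio_deficit(1)[OF kJ] in auto)
  also have "\<dots> = \<eta> / 2 + (\<integral>\<omega>. (max 0 (1 - ratio k J \<omega>))\<^sup>2 \<partial>M) / (2 * \<eta>)"
    using ratio_deficit(1)[OF kJ] by (simp add: prob_space)
  also have "\<dots> \<le> \<eta> / 2 + (2 * (cond_entropy k - entropy_rate)) / (2 * \<eta>)"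
  proof -
    have "(\<integral>\<omega>. (max 0 (1 - ratio k J \<omega>))\<^sup>2 \<partial>M) \<le> 2 * (cond_entropy k - entropy_rate)"
      by (rule order_trans[OF ratio_deficit(2)[OF kJ]]) (simp add: entropy_rate_le)
    then show ?thesis using \<eta> by (intro add_left_mono divide_right_mono) auto
  qed
  also have "(2 * (cond_entropy k - entropy_rate)) / (2 * \<eta>) = (cond_entropy k - entropy_rate) / \<eta>"
    by (rule mult_divide_mult_cancel_left) simp
  finally show ?thesis unfolding E_def .
next
  case False
  then show ?thesis using \<eta> entropy_rate_le[of k] by simp
qed

text \<open>With \<open>\<eta> = a * (1 - t)\<close>, both terms of \<open>ratio_maximal\<close> are
  at most \<open>\<eta> / 2\<close> once \<open>cond_entropy k\<close> is within
  \<open>\<eta>^2 / 2\<close> of its limit. The bound is uniform in \<open>J\<close> and so passes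
  to the increasing union.\<close>

lemma ratio_maximal_small:
  assumes t: "0 < t" "t < 1" and a: "a > 0"
  obtains k where "prob {\<omega>. \<exists>j\<ge>k. ratio k j \<omega> < t} \<le> a" "{\<omega>. \<exists>j\<ge>k. ratio k j \<omega> < t} \<in> sets M"
proof -
  define \<eta> where "\<eta> = a * (1 - t)"
  have \<eta>: "\<eta> > 0" using t a by (simp add: \<eta>_def)
  have "(\<lambda>k. cond_entropy k - entropy_rate) \<longlonglongrightarrow> 0"
    using tendsto_diff[OF entropy_rate_tendsto tendsto_const[of entropy_rate]] by simp
  then have "\<forall>\<^sub>F k in sequentially. cond_entropy k - entropy_rate < \<eta>\<^sup>2 / 2"
    using \<eta> by (intro order_tendstoD) auto
  then obtain k where k: "cond_entropy k - entropy_rate < \<eta>\<^sup>2 / 2" by (auto simp: eventually_sequentially)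
  define E where "E J = {\<omega>. \<exists>j\<in>{k..J}. ratio k j \<omega> < t}" for J
  have Em [measurable]: "E J \<in> sets M" for J
  proof -
    have "{\<omega>\<in>space M. \<exists>j\<in>{k..J}. ratio k j \<omega> < t} \<in> sets M" by measurable
    then show ?thesis by (simp add: E_def space_UNIV)
  qed
  have le: "prob (E J) \<le> a" for J
  proof -
    have "prob (E J) * (1 - t) \<le> \<eta> / 2 + (cond_entropy k - entropy_rate) / \<eta>"
      unfolding E_def by (rule ratio_maximal[OF t \<eta>])
    also have "(cond_entropy k - entropy_rate) / \<eta> \<le> (\<eta>\<^sup>2 / 2) / \<eta>"
      using k \<eta> by (intro divide_right_mono) auto
    also have "\<eta> / 2 + (\<eta>\<^sup>2 / 2) / \<eta> = \<eta>" using \<eta> by (simp add: power2_eq_square)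
    also have "\<eta> = a * (1 - t)" by (simp add: \<eta>_def)
    finally show ?thesis using t by simp
  qed
  have U: "{\<omega>. \<exists>j\<ge>k. ratio k j \<omega> < t} = (\<Union>J. E J)"
  proof (intro set_eqI iffI)
    fix \<omega> assume "\<omega> \<in> {\<omega>. \<exists>j\<ge>k. ratio k j \<omega> < t}"
    then obtain j where "j \<ge> k" "ratio k j \<omega> < t" by blast
    then have "\<omega> \<in> E j" unfolding E_def by auto
    then show "\<omega> \<in> (\<Union>J. E J)" by blast
  qed (auto simp: E_def)
  have "incseq E" by (auto simp: incseq_def E_def)
  then have "(\<lambda>J. prob (E J)) \<longlonglongrightarrow> prob (\<Union>J. E J)"
    by (intro finite_Lim_measure_incseq) (use Em in auto)
  then have "prob (\<Union>J. E J) \<le> a" by (rule LIMSEQ_le_const2) (use le in blast)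
  moreover have "(\<Union>J. E J) \<in> sets M" by measurable
  ultimately show thesis using that[of k] unfolding U by blast
qed

text \<open>Outside the event of \<open>ratio_maximal_small\<close> every \<open>info j\<close> with \<open>j \<ge> k\<close> is at least \<open>info k - e / 3\<close>; the truncation
  at \<open>B\<close> costs at most \<open>m * exp (- B)\<close> because \<open>1 / step_prob k\<close> has integral at most \<open>m\<close>.\<close>

lemma info_minorant:
  assumes e: "e > 0"
  obtains k B G where "G \<in> borel_measurable M" "\<And>\<omega>. 0 \<le> G \<omega> \<and> G \<omega> \<le> B"
    "AE \<omega> in M. \<forall>j\<ge>k. G \<omega> \<le> info j \<omega>" "(\<integral>\<omega>. G \<omega> \<partial>M) \<ge> entropy_rate - e"
proof -
  \<comment> \<open>\<open>B\<close> is fixed before \<open>k\<close>, which is possible because the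
    mean of \<open>1 / step_prob k\<close> is bounded uniformly in \<open>k\<close>. Three thirds of
    \<open>e\<close> pay for the threshold of the ratio, for the exceptional event of probability at
    most \<open>e / (3 * B)\<close>, and for the truncation.\<close>
  have "\<forall>\<^sub>F B in at_top. real m * exp (- B) < e / 3" using e by real_asymp
  then obtain B where B: "real m * exp (- B) < e / 3" "B > 0"
    using eventually_happens[OF eventually_conj[OF _ eventually_gt_at_top[of 0]]] by auto
  have d: "0 < exp (- (e / 3))" "exp (- (e / 3)) < 1" "e / (3 * B) > 0" using e B by simp_all
  obtain k where k: "prob {\<omega>. \<exists>j\<ge>k. ratio k j \<omega> < exp (- (e / 3))} \<le> e / (3 * B)"
    and Em: "{\<omega>. \<exists>j\<ge>k. ratio k j \<omega> < exp (- (e / 3))} \<in> sets M"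
    using ratio_maximal_small[OF d] by blast
  define E where "E = {\<omega>. \<exists>j\<ge>k. ratio k j \<omega> < exp (- (e / 3))}"
  have Em [measurable]: "E \<in> sets M" and PE: "prob E \<le> e / (3 * B)" using k Em by (simp_all add: E_def)
  define G where "G \<omega> = (if \<omega> \<in> E then 0 else max 0 (min (info k \<omega>) B - e / 3))" for \<omega>
  have Gm [measurable]: "G \<in> borel_measurable M" unfolding G_def[abs_def] by measurable
  have Gb: "0 \<le> G \<omega> \<and> G \<omega> \<le> B" for \<omega> using e B by (auto simp: G_def)
  have "AE \<omega> in M. \<forall>j\<ge>k. G \<omega> \<le> info j \<omega>"
    using AE_step_prob_pos
  proof eventually_elim
    case (elim \<omega>)
    show ?case
    proof (intro allI impI)
      fix j assume "k \<le> j"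
      show "G \<omega> \<le> info j \<omega>"
      proof (cases "\<omega> \<in> E")
        case False
        then have "exp (- (e / 3)) \<le> ratio k j \<omega>" using \<open>k \<le> j\<close> by (auto simp: E_def not_less)
        then have "- (e / 3) \<le> ln (ratio k j \<omega>)" by (subst ln_ge_iff) (auto intro: order_less_le_trans[OF exp_gt_zero])
        also have "ln (ratio k j \<omega>) = info j \<omega> - info k \<omega>"
          using elim[rule_format, of k] elim[rule_format, of j] unfolding ratio_def info_def by (simp add: ln_div)
        finally show ?thesis using False info_nonneg[of j \<omega>] by (auto simp: G_def)
      qed (simp add: G_def info_nonneg)
    qed
  qed
  moreover have "(\<integral>\<omega>. G \<omega> \<partial>M) \<ge> entropy_rate - e"
  proof -
    have Gi: "integrable M G" by (rule integrable_const_bound[where B = B]) (use Gb in auto)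
    have Ei: "integrable M (\<lambda>\<omega>. indicator E \<omega> :: real)" by (simp add: emeasure_eq_measure)
    have "cond_entropy k \<le> (\<integral>\<omega>. G \<omega> + e / 3 + B * indicator E \<omega> + exp (- B) * (1 / step_prob k \<omega>) \<partial>M)"
      unfolding cond_entropy_def
    proof (rule integral_mono_AE)
      show "AE \<omega> in M. info k \<omega> \<le> G \<omega> + e / 3 + B * indicator E \<omega> + exp (- B) * (1 / step_prob k \<omega>)"
        using AE_step_prob_pos
      proof eventually_elim
        case (elim \<omega>)
        then have p: "step_prob k \<omega> > 0" by blast
        \<comment> \<open>The excess over \<open>B\<close> is at most its exponential, which is
          \<open>exp (- B) / step_prob k\<close> and has small mean.\<close>
        have "info k \<omega> - B \<le> exp (info k \<omega> - B)" using exp_ge_add_one_self[of "info k \<omega> - B"] by linarith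
        also have "\<dots> = exp (- B) * (1 / step_prob k \<omega>)" using p by (simp add: info_def exp_diff exp_minus field_simps)
        finally have "info k \<omega> \<le> min (info k \<omega>) B + exp (- B) * (1 / step_prob k \<omega>)"
          using p by (auto simp: min_def)
        moreover have "min (info k \<omega>) B \<le> G \<omega> + e / 3 + B * indicator E \<omega>"
          using e by (auto simp: G_def)
        ultimately show ?case by linarith
      qed
    qed (use info_integrable Gi Ei inverse_step_prob(1) in \<open>auto simp del: times_divide_eq_right\<close>)
    also have "\<dots> = (\<integral>\<omega>. G \<omega> \<partial>M) + e / 3 + B * prob E + exp (- B) * (\<integral>\<omega>. 1 / step_prob k \<omega> \<partial>M)"
      using Gi Ei inverse_step_prob(1)[of k] using prob_space by (simp add: space_UNIV del: times_divide_eq_right)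
    also have "\<dots> \<le> (\<integral>\<omega>. G \<omega> \<partial>M) + e / 3 + B * (e / (3 * B)) + exp (- B) * real m"
      using PE B inverse_step_prob(2)[of k] by (intro add_mono mult_left_mono order_refl) auto
    also have "\<dots> \<le> (\<integral>\<omega>. G \<omega> \<partial>M) + e" using B by (simp add: mult.commute)
    finally show ?thesis using entropy_rate_le[of k] by linarith
  qed
  ultimately show thesis using that Gm Gb by blast
qed

text \<open>The terms \<open>info j\<close> of the chain rule change with \<open>j\<close>, so
  Birkhoff's theorem is applied to their common minorant \<open>G\<close> instead. The first
  \<open>k\<close> symbols of the window have too short a past for the minorant and cost at most
  \<open>k * B\<close>.\<close>

theorem breiman_lower:
  assumes e: "e > 0"
  shows "AE \<omega> in M. \<forall>\<^sub>F n in sequentially.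
    - ln (prob (cell y {- int n..<int n + 1} \<omega>)) \<ge> real n * (2 * entropy_rate - e)"
proof -
  obtain k B G where Gm: "G \<in> borel_measurable M" and Gb: "\<And>\<omega>. 0 \<le> G \<omega> \<and> G \<omega> \<le> B"
    and Gle: "AE \<omega> in M. \<forall>j\<ge>k. G \<omega> \<le> info j \<omega>" and Gint: "(\<integral>\<omega>. G \<omega> \<partial>M) \<ge> entropy_rate - e / 8"
    by (rule info_minorant[of "e / 8"]) (use e in auto)
  have Gi: "integrable M G" by (rule integrable_const_bound[where B = B]) (use Gb Gm in auto)
  have "AE \<omega> in M. \<forall>i. \<forall>j\<ge>k. G (S i \<omega>) \<le> info j (S i \<omega>)"
    using AE_S[OF Gle] by (simp add: AE_all_countable)
  with birkhoff_sum[OF Gi] AE_ln_cell show ?thesis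
  proof eventually_elim
    case (elim \<omega>)
    have "2 * entropy_rate - e / 2 < 2 * integral\<^sup>L M G" using Gint e by simp
    then have "\<forall>\<^sub>F n in sequentially. 2 * entropy_rate - e / 2 < (\<Sum>i\<in>{- int n..<int n + 1}. G (S i \<omega>)) / real n"
      by (rule order_tendstoD(1)[OF elim(1)])
    moreover have "\<forall>\<^sub>F n in sequentially. real k * B < real n * (e / 2)" using e by real_asymp
    ultimately show ?case using eventually_gt_at_top[of 0]
    proof eventually_elim
      case A: (elim n)
      have "(\<Sum>i\<in>{- int n..<int n + 1}. G (S i \<omega>)) = (\<Sum>j<2 * n + 1. G (S (- int n + int j) \<omega>))"
        by (rule sum_int_interval[symmetric])
      also have "\<dots> \<le> (\<Sum>j<2 * n + 1. info j (S (- int n + int j) \<omega>) + (if j < k then B else 0))"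
      proof (rule sum_mono)
        fix j
        show "G (S (- int n + int j) \<omega>) \<le> info j (S (- int n + int j) \<omega>) + (if j < k then B else 0)"
          using Gb[of "S (- int n + int j) \<omega>"] info_nonneg[of j "S (- int n + int j) \<omega>"] elim(3)
          by (cases "j < k") (auto simp: not_less)
      qed
      also have "\<dots> = - ln (prob (cell y {- int n..<int n + 1} \<omega>)) + (\<Sum>j<2 * n + 1. if j < k then B else 0)"
        using elim(2)[rule_format, of "- int n" "2 * n + 1"] by (simp add: sum.distrib)
      also have "(\<Sum>j<2 * n + 1. if j < k then B else 0) = real (card ({..<2 * n + 1} \<inter> {..<k})) * B"
        by (simp add: sum.If_cases lessThan_def)
      also have "\<dots> \<le> real k * B"
        using Gb[of \<omega>] card_mono[of "{..<k}" "{..<2 * n + 1} \<inter> {..<k}"] by (intro mult_right_mono) auto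
      finally show ?case using A by (simp add: field_simps)
    qed
  qed
qed

text \<open>The cylinder is coded by \<open>k\<close> uniform symbols, then a Markov chain of order \<open>k\<close> for the factor \<open>y\<close>, and the
  weight \<open>K\<close> for each letter given its class.\<close>

theorem markov_upper:
  fixes x :: "'b \<Rightarrow> 'c :: countable" and K :: "'c \<Rightarrow> real"
  assumes x [measurable]: "x \<in> measurable M (count_space UNIV)"
    and y_eq: "\<And>\<omega>. y \<omega> = \<alpha> (x \<omega>)"
    and K: "\<And>a. 0 < K a" "\<And>b. (\<integral>\<^sup>+a. ennreal (K a) * indicator {a. \<alpha> a = b} a \<partial>count_space UNIV) \<le> 1"
    and int: "integrable M (\<lambda>\<omega>. - ln (K (x \<omega>)))" and e: "e > 0"
  shows "AE \<omega> in M. \<forall>\<^sub>F n in sequentially.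
    - ln (prob (cell x {- int n..<int n + 1} \<omega>)) \<le> real n * (2 * (cond_entropy k + (\<integral>\<omega>. - ln (K (x \<omega>)) \<partial>M)) + e)"
proof -
  define C where "C n i = cell y {- int n + int i - int k..<- int n + int i}" for n i :: nat
  define \<beta> where "\<beta> n i \<omega> b = (if i < k then (if b < m then 1 / real m else 0)
     else prob (C n i \<omega> \<inter> {\<omega>'. y (S (- int n + int i) \<omega>') = b}) / prob (C n i \<omega>))" for n i :: nat and \<omega> b
  define \<kappa> where "\<kappa> n i \<omega> a = \<beta> n i \<omega> (\<alpha> a) * K a" for n i \<omega> a
  define Z where "Z n i \<omega> = x (S (- int n + int i) \<omega>)" for n i :: nat and \<omega>
  have Zm: "Z n i \<in> measurable M (count_space UNIV)" for n i unfolding Z_def by measurable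
  have \<beta>_nonneg: "\<beta> n i \<omega> b \<ge> 0" for n i \<omega> b by (simp add: \<beta>_def)
  have \<beta>_sum: "(\<integral>\<^sup>+b. ennreal (\<beta> n i \<omega> b) \<partial>count_space UNIV) \<le> 1" for n i \<omega>
  proof (cases "i < k")
    case True
    have "(\<integral>\<^sup>+b. ennreal (\<beta> n i \<omega> b) \<partial>count_space UNIV) = (\<integral>\<^sup>+b. ennreal (1 / real m) * indicator {..<m} b \<partial>count_space UNIV)"
      using True by (intro nn_integral_cong) (simp add: \<beta>_def indicator_def)
    also have "\<dots> = ennreal (1 / real m) * ennreal (real m)"
      by (subst nn_integral_cmult_indicator) (auto simp: ennreal_of_nat_eq_real_of_nat)
    also have "\<dots> = 1" using m_pos by (subst ennreal_mult[symmetric]) auto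
    finally show ?thesis by simp
  next
    case False
    have "(\<integral>\<^sup>+b. ennreal (\<beta> n i \<omega> b) \<partial>count_space UNIV)
       = (\<integral>\<^sup>+b. ennreal (1 / prob (C n i \<omega>)) * emeasure M (C n i \<omega> \<inter> {\<omega>'. y (S (- int n + int i) \<omega>') = b}) \<partial>count_space UNIV)"
      using False by (intro nn_integral_cong) (simp add: \<beta>_def emeasure_eq_measure flip: ennreal_mult)
    also have "\<dots> = ennreal (1 / prob (C n i \<omega>)) * emeasure M (C n i \<omega>)"
    proof (subst nn_integral_cmult)
      show "ennreal (1 / prob (C n i \<omega>)) * (\<integral>\<^sup>+b. emeasure M (C n i \<omega> \<inter> {\<omega>'. y (S (- int n + int i) \<omega>') = b}) \<partial>count_space UNIV)
        = ennreal (1 / prob (C n i \<omega>)) * emeasure M (C n i \<omega>)"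
        by (subst nn_integral_emeasure_level_sets) (auto simp: C_def intro!: cell_sets cells)
    qed simp
    also have "\<dots> \<le> 1" by (simp add: emeasure_eq_measure divide_self_if flip: ennreal_mult)
    finally show ?thesis .
  qed
  \<comment> \<open>Summing over the letters of one class gives at most 1 by the choice of
    \<open>K\<close>; what remains is the sum of \<open>\<beta>\<close> over the classes.\<close>
  have \<kappa>_sum: "(\<integral>\<^sup>+a. ennreal (\<kappa> n i \<omega> a) \<partial>count_space UNIV) \<le> 1" for n i \<omega>
  proof -
    have "(\<integral>\<^sup>+a. ennreal (\<kappa> n i \<omega> a) \<partial>count_space UNIV)
       = (\<integral>\<^sup>+a. \<integral>\<^sup>+b. (\<lambda>(a, b). ennreal (\<beta> n i \<omega> b) * (ennreal (K a) * indicator {a. \<alpha> a = b} a)) (a, b) \<partial>count_space UNIV \<partial>count_space UNIV)"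
    proof (intro nn_integral_cong)
      fix a
      have "(\<integral>\<^sup>+b. ennreal (\<beta> n i \<omega> b) * (ennreal (K a) * indicator {a. \<alpha> a = b} a) \<partial>count_space UNIV)
        = (\<integral>\<^sup>+b. ennreal (\<beta> n i \<omega> b) * ennreal (K a) * indicator {\<alpha> a} b \<partial>count_space UNIV)"
        by (intro nn_integral_cong) (auto simp: indicator_def)
      also have "\<dots> = ennreal (\<kappa> n i \<omega> a)"
        using \<beta>_nonneg K(1)[of a] by (subst nn_integral_indicator_singleton) (auto simp: \<kappa>_def ennreal_mult less_imp_le)
      finally show "ennreal (\<kappa> n i \<omega> a) = (\<integral>\<^sup>+b. (\<lambda>(a, b). ennreal (\<beta> n i \<omega> b) * (ennreal (K a) * indicator {a. \<alpha> a = b} a)) (a, b) \<partial>count_space UNIV)"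
        by simp
    qed
    also have "\<dots> = (\<integral>\<^sup>+b. \<integral>\<^sup>+a. (\<lambda>(a, b). ennreal (\<beta> n i \<omega> b) * (ennreal (K a) * indicator {a. \<alpha> a = b} a)) (a, b) \<partial>count_space UNIV \<partial>count_space UNIV)"
      unfolding nn_integral_fst_count_space nn_integral_snd_count_space ..
    also have "\<dots> = (\<integral>\<^sup>+b. ennreal (\<beta> n i \<omega> b) * (\<integral>\<^sup>+a. ennreal (K a) * indicator {a. \<alpha> a = b} a \<partial>count_space UNIV) \<partial>count_space UNIV)"
      by (simp add: nn_integral_cmult)
    also have "\<dots> \<le> (\<integral>\<^sup>+b. ennreal (\<beta> n i \<omega> b) * 1 \<partial>count_space UNIV)"
      using K(2) by (intro nn_integral_mono mult_left_mono) auto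
    also have "\<dots> \<le> 1" using \<beta>_sum by simp
    finally show ?thesis .
  qed
  \<comment> \<open>For \<open>i \<ge> k\<close> the conditioning block lies among the coordinates
    already read, and \<open>y\<close> is a function of the letter; for \<open>i < k\<close> the
    kernel does not depend on the point.\<close>
  have \<kappa>_cong: "\<kappa> n i \<omega>' = \<kappa> n i \<omega>" if "\<And>j. j < i \<Longrightarrow> Z n j \<omega>' = Z n j \<omega>" for n i \<omega> \<omega>'
  proof (cases "i < k")
    case False
    have "\<omega>' \<in> C n i \<omega>"
      unfolding C_def cell_def
    proof (intro CollectI ballI)
      fix t assume t: "t \<in> {- int n + int i - int k..<- int n + int i}"
      then have "nat (t + int n) < i" "- int n + int (nat (t + int n)) = t" using False by auto
      then show "y (S t \<omega>') = y (S t \<omega>)" using that[of "nat (t + int n)"] by (simp add: Z_def y_eq)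
    qed
    then have C_eq: "C n i \<omega>' = C n i \<omega>" unfolding C_def by (rule cell_cong)
    show ?thesis unfolding \<kappa>_def[abs_def] \<beta>_def C_eq ..
  qed (simp add: \<kappa>_def[abs_def] \<beta>_def)
  have "AE \<omega> in M. \<forall>\<^sub>F n in sequentially. (\<Prod>i<2 * n + 1. \<kappa> n i \<omega> (Z n i \<omega>)) * prob UNIV
           \<le> exp (e / 4 * real n) * prob (UNIV \<inter> {\<omega>'. \<forall>i<2 * n + 1. Z n i \<omega>' = Z n i \<omega>})"
  proof (rule AE_chain)
    show "\<kappa> n i \<omega> z \<ge> 0" for n i \<omega> z using \<beta>_nonneg[of n i \<omega>] K(1)[of z] by (simp add: \<kappa>_def)
    show "\<kappa> n i \<omega>' = \<kappa> n i \<omega>" if "\<And>j. j < i \<Longrightarrow> Z n j \<omega>' = Z n j \<omega>" for n i \<omega> \<omega>'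
      by (rule \<kappa>_cong[OF that])
  qed (use e in \<open>simp_all add: countable_cells_UNIV Zm \<kappa>_sum\<close>)
  moreover have "AE \<omega> in M. \<forall>i. \<forall>k. 0 < step_prob k (S i \<omega>)"
    using AE_S[OF AE_step_prob_pos] by (subst AE_all_countable) auto
  moreover have fi: "integrable M (\<lambda>\<omega>. info k \<omega> - ln (K (x \<omega>)))" using info_integrable int by simp
  note birkhoff_sum[OF fi]
  ultimately show ?thesis using AE_all_cells_pos[OF x]
  proof eventually_elim
    case (elim \<omega>)
    let ?I = "\<integral>\<omega>. - ln (K (x \<omega>)) \<partial>M"
    have "(\<integral>\<omega>. info k \<omega> - ln (K (x \<omega>)) \<partial>M) = cond_entropy k + ?I"
      using info_integrable int unfolding cond_entropy_def by simp
    then have "2 * (\<integral>\<omega>. info k \<omega> - ln (K (x \<omega>)) \<partial>M) < 2 * (cond_entropy k + ?I) + e / 4" using e by simp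
    then have "\<forall>\<^sub>F n in sequentially. (\<Sum>i\<in>{- int n..<int n + 1}. info k (S i \<omega>) - ln (K (x (S i \<omega>)))) / real n < 2 * (cond_entropy k + ?I) + e / 4"
      by (rule order_tendstoD(2)[OF elim(3)])
    moreover have "\<forall>\<^sub>F n in sequentially. real k * ln (real m) < real n * (e / 4)" using e by real_asymp
    ultimately show ?case using elim(1) eventually_gt_at_top[of 0]
    proof eventually_elim
      case A: (elim n)
      let ?N = "2 * n + 1"
      have cells_eq: "{\<omega>'. \<forall>i<?N. Z n i \<omega>' = Z n i \<omega>} = cell x {- int n..<int n + 1} \<omega>"
        using cell_interval_eq[of x "- int n" ?N \<omega>] by (simp add: Z_def)
      have pos: "prob (cell x {- int n..<int n + 1} \<omega>) > 0" using elim(4)[rule_format, of _ _ 0] by (simp only: S_zero)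
      have kap: "\<kappa> n i \<omega> (Z n i \<omega>) = (if i < k then 1 / real m else step_prob k (S (- int n + int i) \<omega>)) * K (x (S (- int n + int i) \<omega>))" for i
      proof (cases "i < k")
        case True then show ?thesis using y_less[of "S (- int n + int i) \<omega>"] by (simp add: \<kappa>_def \<beta>_def Z_def y_eq)
      next
        case False
        let ?t = "- int n + int i"
        have "prob (C n i \<omega>) = past_prob k (S ?t \<omega>)"
          unfolding C_def past_prob_def using prob_cell_shift[OF y_measurable, of "- int k" ?t 0 \<omega>] by (simp add: algebra_simps)
        moreover have "C n i \<omega> \<inter> {\<omega>'. y (S ?t \<omega>') = y (S ?t \<omega>)} = cell y {- int k + ?t..<1 + ?t} \<omega>"
        proof -
          have "{- int k + ?t..<1 + ?t} = insert ?t {?t - int k..<?t}" by auto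
          then show ?thesis unfolding C_def cell_def by (simp only:) auto
        qed
        moreover have "prob (cell y {- int k + ?t..<1 + ?t} \<omega>) = joint_prob k (S ?t \<omega>)"
          unfolding joint_prob_def using prob_cell_shift[OF y_measurable, of "- int k" ?t 1 \<omega>] .
        ultimately show ?thesis using False by (simp add: \<kappa>_def \<beta>_def Z_def y_eq[symmetric] step_prob_def)
      qed
      have kpos: "\<kappa> n i \<omega> (Z n i \<omega>) > 0" for i
        unfolding kap using K(1) elim(2) m_pos by simp
      have ppos: "(\<Prod>i<?N. \<kappa> n i \<omega> (Z n i \<omega>)) > 0" using kpos by (intro prod_pos) auto
      have "(\<Prod>i<?N. \<kappa> n i \<omega> (Z n i \<omega>)) \<le> exp (e / 4 * real n) * prob (cell x {- int n..<int n + 1} \<omega>)"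
        using A(3) prob_space unfolding cells_eq by (simp add: space_UNIV)
      then have "ln (\<Prod>i<?N. \<kappa> n i \<omega> (Z n i \<omega>)) \<le> ln (exp (e / 4 * real n) * prob (cell x {- int n..<int n + 1} \<omega>))"
        by (rule iffD2[OF ln_le_cancel_iff[OF ppos mult_pos_pos[OF exp_gt_zero pos]]])
      also have "\<dots> = e / 4 * real n + ln (prob (cell x {- int n..<int n + 1} \<omega>))"
        using pos by (simp add: ln_mult)
      also have "ln (\<Prod>i<?N. \<kappa> n i \<omega> (Z n i \<omega>)) = (\<Sum>i<?N. ln (\<kappa> n i \<omega> (Z n i \<omega>)))"
        using kpos[THEN less_imp_neq, THEN not_sym] by (intro ln_prod) simp_all
      finally have 1: "- ln (prob (cell x {- int n..<int n + 1} \<omega>)) \<le> e / 4 * real n + (\<Sum>i<?N. - ln (\<kappa> n i \<omega> (Z n i \<omega>)))"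
        by (simp add: sum_negf)
      have "(\<Sum>i<?N. - ln (\<kappa> n i \<omega> (Z n i \<omega>)))
         \<le> (\<Sum>i<?N. (info k (S (- int n + int i) \<omega>) - ln (K (x (S (- int n + int i) \<omega>)))) + (if i < k then ln (real m) else 0))"
      proof (rule sum_mono)
        fix i
        show "- ln (\<kappa> n i \<omega> (Z n i \<omega>)) \<le> info k (S (- int n + int i) \<omega>) - ln (K (x (S (- int n + int i) \<omega>))) + (if i < k then ln (real m) else 0)"
          unfolding kap using K(1)[of "x (S (- int n + int i) \<omega>)"] elim(2)[rule_format, of k "- int n + int i"] m_pos
            info_nonneg[of k "S (- int n + int i) \<omega>"]
          by (cases "i < k") (simp_all add: ln_mult ln_div info_def)
      qed
      also have "\<dots> = (\<Sum>i\<in>{- int n..<int n + 1}. info k (S i \<omega>) - ln (K (x (S i \<omega>)))) + (\<Sum>i<?N. if i < k then ln (real m) else 0)"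
        by (simp only: sum.distrib sum_int_interval[where n = n and F = "\<lambda>i. info k (S i \<omega>) - ln (K (x (S i \<omega>)))"])
      also have "(\<Sum>i<?N. if i < k then ln (real m) else 0) = real (card ({..<?N} \<inter> {..<k})) * ln (real m)"
        by (simp add: sum.If_cases lessThan_def)
      also have "\<dots> \<le> real k * ln (real m)"
        using m_pos card_mono[of "{..<k}" "{..<?N} \<inter> {..<k}"] by (intro mult_right_mono) auto
      finally have 2: "(\<Sum>i<?N. - ln (\<kappa> n i \<omega> (Z n i \<omega>)))
        \<le> (\<Sum>i\<in>{- int n..<int n + 1}. info k (S i \<omega>) - ln (K (x (S i \<omega>)))) + real k * ln (real m)" by simp
      have 3: "(\<Sum>i\<in>{- int n..<int n + 1}. info k (S i \<omega>) - ln (K (x (S i \<omega>)))) \<le> real n * (2 * (cond_entropy k + ?I) + e / 4)"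
        using A(1,4) by (simp only: pos_divide_less_eq of_nat_0_less_iff mult.commute[of _ "real n"] less_imp_le)
      have "- ln (prob (cell x {- int n..<int n + 1} \<omega>))
        \<le> e / 4 * real n + (real n * (2 * (cond_entropy k + ?I) + e / 4) + real n * (e / 4))"
        by (rule order_trans[OF 1 add_left_mono[OF order_trans[OF 2 add_mono[OF 3 less_imp_le[OF A(2)]]]]])
      also have "\<dots> \<le> real n * (2 * (cond_entropy k + ?I) + e)" using e by (simp add: algebra_simps)
      finally show ?case .
    qed
  qed
qed

end

section \<open>Transfer of cell estimates from a finite factor to the letters\<close>

context ergodic_action
begin

text \<open>Given the letters, the symbol of \<open>\<xi>\<close> is guessed to be that of \<open>\<eta>\<close> with weight \<open>1 - d\<close>, the rest
  being uniform.\<close>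

theorem coarse_transfer:
  fixes x :: "'b \<Rightarrow> 'c :: countable" and \<xi> \<eta> :: "'b \<Rightarrow> nat"
  assumes x [measurable]: "x \<in> measurable M (count_space UNIV)"
    and \<xi> [measurable]: "\<xi> \<in> measurable M (count_space UNIV)" "\<And>\<omega>. \<xi> \<omega> < m"
    and \<eta>: "\<And>\<omega> \<omega>'. \<omega>' \<in> cell x {- int r..<int r + 1} \<omega> \<Longrightarrow> \<eta> \<omega>' = \<eta> \<omega>"
    and d: "0 < d" "d < 1" and e: "e > 0"
  shows "AE \<omega> in M. \<forall>\<^sub>F n in sequentially.
    - ln (prob (cell \<xi> {- int n..<int n + 1} \<omega>)) \<le> - ln (prob (cell x {- int (n + r)..<int (n + r) + 1} \<omega>))
       + real n * (2 * (ln (real m / d) * prob {\<omega>. \<xi> \<omega> \<noteq> \<eta> \<omega>} - ln (1 - d)) + e)"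
proof -
  have m: "m > 0" using \<xi>(2)[of undefined] by simp
  have \<eta>m [measurable]: "\<eta> \<in> measurable M (count_space UNIV)"
    by (rule measurable_cells[OF countable_cells_cell[OF x, of "{- int r..<int r + 1}"]]) (use \<eta> in auto)
  define w where "w a b = (if b = a then 1 - d else if b < m then d / real m else 0)" for a b :: nat
  have wpos: "w (\<eta> \<omega>) (\<xi> \<omega>) > 0" for \<omega> using d m \<xi>(2)[of \<omega>] by (simp add: w_def)
  have wn: "w a b \<ge> 0" for a b using d m by (simp add: w_def)
  have wsum: "(\<integral>\<^sup>+b. ennreal (w a b) \<partial>count_space UNIV) \<le> 1" for a
  proof -
    have "(\<integral>\<^sup>+b. ennreal (w a b) \<partial>count_space UNIV)
      \<le> (\<integral>\<^sup>+b. ennreal (1 - d) * indicator {a} b + ennreal (d / real m) * indicator {..<m} b \<partial>count_space UNIV)"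
      by (intro nn_integral_mono) (auto simp: w_def indicator_def)
    also have "\<dots> = ennreal (1 - d) + ennreal (d / real m) * ennreal (real m)"
      by (subst nn_integral_add) (auto simp: nn_integral_cmult_indicator ennreal_of_nat_eq_real_of_nat nn_integral_cmult)
    also have "\<dots> = ennreal (1 - d + d)" using d m by (simp flip: ennreal_mult ennreal_plus)
    finally show ?thesis by simp
  qed
  \<comment> \<open>The coding cost: \<open>- ln (1 - d)\<close> at a match and
    \<open>ln (real m / d)\<close> at a mismatch. It is bounded, and its mean governs the loss
    through Birkhoff's theorem.\<close>
  define g where "g \<omega> = - ln (w (\<eta> \<omega>) (\<xi> \<omega>))" for \<omega>
  have [measurable]: "(\<lambda>\<omega>. w (\<eta> \<omega>) (\<xi> \<omega>)) \<in> borel_measurable M"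
    by (rule measurable_compose_countable[OF _ \<eta>m, of "\<lambda>i \<omega>. w i (\<xi> \<omega>)"]) measurable
  have [measurable]: "g \<in> borel_measurable M" unfolding g_def[abs_def] by measurable
  have NEm: "{\<omega>. \<xi> \<omega> \<noteq> \<eta> \<omega>} \<in> sets M"
  proof -
    have "(\<lambda>\<omega>. (\<lambda>i \<omega>. \<xi> \<omega> \<noteq> i) (\<eta> \<omega>) \<omega>) \<in> measurable M (count_space UNIV)"
      by (rule measurable_compose_countable[OF _ \<eta>m]) measurable
    then show ?thesis by (simp add: pred_def space_UNIV)
  qed
  have lnm: "ln (real m / d) \<ge> 0" using d m by (simp add: field_simps order.trans[of d 1 "real m"] less_imp_le)
  have ln1d: "- ln (1 - d) \<ge> 0" using d by simp
  have gle: "0 \<le> g \<omega> \<and> g \<omega> \<le> ln (real m / d) * indicator {\<omega>. \<xi> \<omega> \<noteq> \<eta> \<omega>} \<omega> - ln (1 - d)" for \<omega>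
    using \<xi>(2)[of \<omega>] d m lnm ln1d by (auto simp: g_def w_def ln_div indicator_def)
  have bd: "g \<omega> \<le> ln (real m / d) - ln (1 - d)" for \<omega>
    using gle[of \<omega>] lnm ln1d by (cases "\<xi> \<omega> = \<eta> \<omega>") simp_all
  have gi: "integrable M g" by (rule integrable_const_bound[where B = "ln (real m / d) - ln (1 - d)"]) (use gle bd in auto)
  have gint: "(\<integral>\<omega>. g \<omega> \<partial>M) \<le> ln (real m / d) * prob {\<omega>. \<xi> \<omega> \<noteq> \<eta> \<omega>} - ln (1 - d)"
  proof -
    have i: "integrable M (\<lambda>\<omega>. indicator {\<omega>. \<xi> \<omega> \<noteq> \<eta> \<omega>} \<omega> :: real)" using NEm by (simp add: emeasure_eq_measure)
    have "(\<integral>\<omega>. g \<omega> \<partial>M) \<le> (\<integral>\<omega>. ln (real m / d) * indicator {\<omega>. \<xi> \<omega> \<noteq> \<eta> \<omega>} \<omega> - ln (1 - d) \<partial>M)"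
      using gle gi i by (intro integral_mono) auto
    also have "\<dots> = ln (real m / d) * prob {\<omega>. \<xi> \<omega> \<noteq> \<eta> \<omega>} - ln (1 - d)"
      using i prob_space by (simp add: space_UNIV)
    finally show ?thesis .
  qed
  let ?E = "\<lambda>n. cell x {- int (n + r)..<int (n + r) + 1}"
  let ?Z = "\<lambda>(n::nat) (i::nat) \<omega>. \<xi> (S (- int n + int i) \<omega>)"
  \<comment> \<open>The letters on the window enlarged by \<open>r\<close> at both ends determine
    \<open>\<eta>\<close> at the times from \<open>- n\<close> to \<open>n\<close>. Beyond these the
    kernel is set to 0 to stay predictable; those factors never enter the product.\<close>
  let ?\<kappa> = "\<lambda>(n::nat) (i::nat) \<omega> b. if i < 2 * n + 1 then w (\<eta> (S (- int n + int i) \<omega>)) b else 0"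
  have "AE \<omega> in M. \<forall>\<^sub>F n in sequentially. (\<Prod>i<2 * n + 1. ?\<kappa> n i \<omega> (?Z n i \<omega>)) * prob (?E n \<omega>)
           \<le> exp (e / 2 * real n) * prob (?E n \<omega> \<inter> {\<omega>'. \<forall>i<2 * n + 1. ?Z n i \<omega>' = ?Z n i \<omega>})"
  proof (rule AE_chain)
    show "countable_cells (?E n)" for n by (rule countable_cells_cell[OF x]) simp
    fix n i :: nat and \<omega> \<omega>' assume *: "\<omega>' \<in> ?E n \<omega>"
    have "\<eta> (S (- int n + int i) \<omega>') = \<eta> (S (- int n + int i) \<omega>)" if "i < 2 * n + 1"
    proof (rule \<eta>, unfold cell_def, intro CollectI ballI)
      fix t assume "t \<in> {- int r..<int r + 1}"
      then have "t + (- int n + int i) \<in> {- int (n + r)..<int (n + r) + 1}" using that by auto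
      then show "x (S t (S (- int n + int i) \<omega>')) = x (S t (S (- int n + int i) \<omega>))"
        using * unfolding cell_def by (simp add: S_add)
    qed
    then show "?\<kappa> n i \<omega>' = ?\<kappa> n i \<omega>" by auto
  next
    fix n i \<omega>
    show "(\<integral>\<^sup>+z. ennreal (?\<kappa> n i \<omega> z) \<partial>count_space UNIV) \<le> 1"
      using wsum by (cases "i < 2 * n + 1") auto
  qed (use wn e in auto)
  moreover note birkhoff_sum[OF gi]
  ultimately show ?thesis using AE_all_cells_pos[OF x] AE_all_cells_pos[OF \<xi>(1)]
  proof eventually_elim
    case (elim \<omega>)
    let ?J = "ln (real m / d) * prob {\<omega>. \<xi> \<omega> \<noteq> \<eta> \<omega>} - ln (1 - d)"
    have "2 * (\<integral>\<omega>. g \<omega> \<partial>M) < 2 * ?J + e / 2" using e gint by simp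
    then have "\<forall>\<^sub>F n in sequentially. (\<Sum>i\<in>{- int n..<int n + 1}. g (S i \<omega>)) / real n < 2 * ?J + e / 2"
      by (rule order_tendstoD(2)[OF elim(2)])
    then show ?case using elim(1) eventually_gt_at_top[of 0]
    proof eventually_elim
      case A: (elim n)
      let ?N = "2 * n + 1"
      have pos: "prob (?E n \<omega>) > 0" "prob (cell \<xi> {- int n..<int n + 1} \<omega>) > 0"
        using elim(3)[rule_format, of _ _ 0] elim(4)[rule_format, of _ _ 0] by (simp_all only: S_zero)
      have "{\<omega>'. \<forall>i<?N. ?Z n i \<omega>' = ?Z n i \<omega>} = cell \<xi> {- int n..<int n + 1} \<omega>"
        using cell_interval_eq[of \<xi> "- int n" ?N \<omega>] by simp
      then have le: "prob (?E n \<omega> \<inter> {\<omega>'. \<forall>i<?N. ?Z n i \<omega>' = ?Z n i \<omega>}) \<le> prob (cell \<xi> {- int n..<int n + 1} \<omega>)"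
        using cell_sets[OF countable_cells_cell[OF \<xi>(1)]] by (intro finite_measure_mono) auto
      have ppos: "(\<Prod>i<?N. w (\<eta> (S (- int n + int i) \<omega>)) (?Z n i \<omega>)) > 0" using wpos by (intro prod_pos) auto
      have "(\<Prod>i<?N. w (\<eta> (S (- int n + int i) \<omega>)) (?Z n i \<omega>)) * prob (?E n \<omega>)
          = (\<Prod>i<?N. ?\<kappa> n i \<omega> (?Z n i \<omega>)) * prob (?E n \<omega>)"
        by (intro arg_cong[where f = "\<lambda>z. z * _"] prod.cong) auto
      also have "\<dots> \<le> exp (e / 2 * real n) * prob (cell \<xi> {- int n..<int n + 1} \<omega>)"
        by (rule order_trans[OF A(2)]) (use le in simp)
      finally have "ln ((\<Prod>i<?N. w (\<eta> (S (- int n + int i) \<omega>)) (?Z n i \<omega>)) * prob (?E n \<omega>))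
          \<le> ln (exp (e / 2 * real n) * prob (cell \<xi> {- int n..<int n + 1} \<omega>))"
        using pos ppos by (subst ln_le_cancel_iff) auto
      then have "ln (\<Prod>i<?N. w (\<eta> (S (- int n + int i) \<omega>)) (?Z n i \<omega>)) + ln (prob (?E n \<omega>))
          \<le> e / 2 * real n + ln (prob (cell \<xi> {- int n..<int n + 1} \<omega>))"
        by (simp only: ln_mult_pos[OF ppos pos(1)] ln_mult_pos[OF exp_gt_zero pos(2)] ln_exp)
      moreover have "ln (\<Prod>i<?N. w (\<eta> (S (- int n + int i) \<omega>)) (?Z n i \<omega>)) = - (\<Sum>i\<in>{- int n..<int n + 1}. g (S i \<omega>))"
        unfolding sum_int_interval[symmetric] using wpos[THEN less_imp_neq, THEN not_sym]
        by (subst ln_prod) (simp_all add: g_def sum_negf)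
      moreover have "(\<Sum>i\<in>{- int n..<int n + 1}. g (S i \<omega>)) \<le> real n * (2 * ?J + e / 2)"
        using A by (simp add: divide_less_eq mult.commute)
      ultimately have "- ln (prob (cell \<xi> {- int n..<int n + 1} \<omega>)) \<le> - ln (prob (?E n \<omega>)) + e / 2 * real n + real n * (2 * ?J + e / 2)"
        by linarith
      also have "\<dots> = - ln (prob (?E n \<omega>)) + real n * (2 * ?J + e)" by (simp add: algebra_simps)
      finally show ?case .
    qed
  qed
qed

end

section \<open>The sequence space\<close>

definition translate :: "int \<Rightarrow> (int \<Rightarrow> 'a) \<Rightarrow> int \<Rightarrow> 'a" where
  "translate s \<omega> = (\<lambda>i. \<omega> (i + s))"

lemma translate_add: "translate i (translate j \<omega>) = translate (i + j) \<omega>"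
  by (simp add: translate_def add.assoc)

lemma translate_zero: "translate 0 \<omega> = \<omega>"
  by (simp add: translate_def)

lemma shift_eq_translate: "shift = translate 1"
  by (simp add: shift_def translate_def fun_eq_iff)

lemma shift_pow: "(shift ^^ n) \<omega> = translate (int n) \<omega>"
  by (induction n) (simp_all add: shift_eq_translate translate_add translate_zero)

lemma sets_seq_space: "sets seq_space = coord_sigma UNIV"
  unfolding seq_space_def sets_PiM_single coord_sigma_def
  by (intro arg_cong2[where f = sigma_sets]) (auto simp: PiE_UNIV_domain)

lemma coord_sigma_mono: "I \<subseteq> J \<Longrightarrow> coord_sigma I \<subseteq> coord_sigma J"
  unfolding coord_sigma_def by (intro sigma_sets_mono') blast

lemma sigma_algebra_coord_sigma: "sigma_algebra UNIV (coord_sigma I)"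
  unfolding coord_sigma_def by (rule sigma_algebra_sigma_sets) auto

lemma coord_sigma_cong:
  assumes "A \<in> coord_sigma I" "\<And>i. i \<in> I \<Longrightarrow> \<omega> i = \<omega>' i"
  shows "\<omega> \<in> A \<longleftrightarrow> \<omega>' \<in> A"
  using assms(1) unfolding coord_sigma_def by induction (use assms(2) in auto)

lemma coord_sigma_translate:
  assumes "A \<in> coord_sigma I" shows "translate s -` A \<in> coord_sigma ((\<lambda>i. i + s) ` I)"
  using assms unfolding coord_sigma_def[of I]
proof induction
  case (Basic a)
  then obtain i B where "i \<in> I" "a = {\<omega>. \<omega> i \<in> B}" by auto
  then show ?case unfolding coord_sigma_def translate_def
    by (intro sigma_sets.Basic) (auto simp: vimage_def)
next
  case Empty
  show ?case using sigma_algebra_coord_sigma by (simp add: sigma_algebra.sigma_sets_subset coord_sigma_def sigma_sets.Empty)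
next
  case (Compl a)
  then show ?case unfolding coord_sigma_def vimage_Diff by (simp add: sigma_sets.Compl)
next
  case (Union a)
  then show ?case unfolding coord_sigma_def vimage_UN by (intro sigma_sets.Union)
qed

section \<open>Invariant measures on the sequence space, finite-window approximation, and ergodicity
  from mixing\<close>

locale invariant_seq =
  fixes P :: "(int \<Rightarrow> 'a :: countable) measure"
  assumes inv: "invariant_prob P"
begin

sublocale full_prob_space P
proof -
  have *: "prob_space P" "sets P = sets seq_space" using inv by (auto simp: invariant_prob_def)
  interpret prob_space P by fact
  have "space P = UNIV" using sets_eq_imp_space_eq[OF *(2)] by (auto simp: seq_space_def space_PiM PiE_UNIV_domain)
  then show "full_prob_space P" by unfold_locales
qed

lemma sets_P: "sets P = coord_sigma UNIV"
  using inv by (simp add: invariant_prob_def sets_seq_space)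

lemma sets_P': "sets P = sets (Pi\<^sub>M UNIV (\<lambda>_. count_space UNIV))"
  using inv by (simp add: invariant_prob_def seq_space_def)

lemma coord_sigma_sets: "A \<in> coord_sigma I \<Longrightarrow> A \<in> sets P"
  unfolding sets_P using coord_sigma_mono[of I UNIV] by blast

lemma coord_measurable [measurable]: "(\<lambda>\<omega>. \<omega> i) \<in> measurable P (count_space UNIV)"
  unfolding measurable_cong_sets[OF sets_P' refl] by measurable

lemma translate_measurable [measurable]: "translate s \<in> measurable P P"
proof (rule measurableI)
  fix A assume "A \<in> sets P"
  then have "translate s -` A \<in> coord_sigma ((\<lambda>i. i + s) ` UNIV)" unfolding sets_P by (rule coord_sigma_translate)
  then show "translate s -` A \<inter> space P \<in> sets P" using coord_sigma_sets by (simp add: space_UNIV)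
qed (simp add: space_UNIV)

text \<open>Invariance is given for \<open>translate 1\<close>. Pushing that identity forward by
  \<open>translate (-1)\<close> yields the inverse, and iteration yields every integer.\<close>

lemma translate_distr: "distr P P (translate s) = P"
proof -
  have 1: "distr P P (translate 1) = P" using inv by (simp add: invariant_prob_def shift_eq_translate)
  have comp: "distr P P (translate (a + b)) = distr (distr P P (translate b)) P (translate a)" for a b
    by (subst distr_distr) (auto simp: comp_def translate_add)
  have idd: "distr P P (translate 0) = P" by (simp add: translate_zero[abs_def] distr_id2)
  have m1: "distr P P (translate (-1)) = P"
    using comp[of "-1" 1] idd unfolding 1 by simp
  have pos: "distr P P (translate (int n)) = P" for n
  proof (induction n)
    case (Suc n)
    then show ?case using comp[of 1 "int n"] 1 by (simp add: add.commute)
  qed (simp add: idd)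
  have neg: "distr P P (translate (- int n)) = P" for n
  proof (induction n)
    case (Suc n)
    have "- int (Suc n) = -1 + - int n" by simp
    then show ?case using comp[of "-1" "- int n"] Suc m1 by simp
  qed (simp add: idd)
  show ?thesis using pos[of "nat s"] neg[of "nat (- s)"] by (cases "s \<ge> 0") auto
qed

lemma prob_translate: "A \<in> sets P \<Longrightarrow> prob (translate s -` A) = prob A"
  using measure_distr[OF translate_measurable, of A s] by (simp add: translate_distr space_UNIV)

text \<open>Induction along the generation of the product sigma-algebra. In a countable union, half
  of \<open>e\<close> pays for cutting off the tail, by continuity from below, and the other half is
  shared by the remaining \<open>N\<close> sets; the sum of their radii is a common radius.\<close>

lemma coord_sigma_approx:
  assumes "A \<in> sets P" "e > 0"
  shows "\<exists>r. \<exists>B\<in>coord_sigma {- int r..int r}. prob (sym_diff A B) < e"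
  using assms unfolding sets_P coord_sigma_def[of UNIV]
proof (induction arbitrary: e)
  case (Basic a)
  then obtain i B where a: "a = {\<omega>. \<omega> i \<in> B}" by auto
  have "a \<in> coord_sigma {- int (nat \<bar>i\<bar>)..int (nat \<bar>i\<bar>)}"
    unfolding coord_sigma_def a by (intro sigma_sets.Basic) auto
  then show ?case using Basic.prems by (intro exI[of _ "nat \<bar>i\<bar>"] bexI[of _ a]) auto
next
  case Empty
  then show ?case by (intro exI[of _ 0] bexI[of _ "{}"]) (auto simp: coord_sigma_def sigma_sets.Empty)
next
  case (Compl a)
  then obtain r B where B: "B \<in> coord_sigma {- int r..int r}" "prob (sym_diff a B) < e" by blast
  then have "UNIV - B \<in> coord_sigma {- int r..int r}" unfolding coord_sigma_def by (intro sigma_sets.Compl)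
  moreover have "sym_diff (UNIV - a) (UNIV - B) = sym_diff a B" by auto
  ultimately show ?case using B(2) by metis
next
  case (Union a)
  have am [measurable]: "a i \<in> sets P" for i using Union(1) unfolding sets_P coord_sigma_def by blast
  have "(\<lambda>n. prob (\<Union>i<n. a i)) \<longlonglongrightarrow> prob (\<Union>n. \<Union>i<n. a i)"
    by (rule finite_Lim_measure_incseq) (auto simp: incseq_def, fastforce)
  moreover have "(\<Union>n. \<Union>i<n. a i) = (\<Union>i. a i)" by blast
  ultimately have "\<forall>\<^sub>F n in sequentially. prob (\<Union>i. a i) - e / 2 < prob (\<Union>i<n. a i)"
    using Union.prems by (intro order_tendstoD) auto
  then obtain N where N: "prob (\<Union>i. a i) - e / 2 < prob (\<Union>i<N. a i)" by (auto simp: eventually_sequentially)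
  define d where "d = e / (2 * real (Suc N))"
  have d: "d > 0" using Union.prems by (simp add: d_def)
  obtain r B where B: "\<And>i. B i \<in> coord_sigma {- int (r i)..int (r i)}" "\<And>i. prob (sym_diff (a i) (B i)) < d"
    using Union.IH[OF d] by metis
  have Bm [measurable]: "B i \<in> sets P" for i using B(1) coord_sigma_sets by blast
  define R where "R = (\<Sum>i<N. r i)"
  have "B i \<in> coord_sigma {- int R..int R}" if "i < N" for i
  proof -
    have "r i \<le> R" unfolding R_def using that by (intro member_le_sum) auto
    then have "{- int (r i)..int (r i)} \<subseteq> {- int R..int R}" by auto
    then show ?thesis using coord_sigma_mono B(1) by blast
  qed
  then have UB: "(\<Union>i<N. B i) \<in> coord_sigma {- int R..int R}"
  proof -
    interpret sigma_algebra UNIV "coord_sigma {- int R..int R} :: (int \<Rightarrow> 'a) set set" by (rule sigma_algebra_coord_sigma)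
    show ?thesis using \<open>\<And>i. i < N \<Longrightarrow> B i \<in> coord_sigma {- int R..int R}\<close> by (intro finite_UN) auto
  qed
  have "prob (sym_diff (\<Union>i. a i) (\<Union>i<N. B i)) \<le> prob (((\<Union>i. a i) - (\<Union>i<N. a i)) \<union> (\<Union>i<N. sym_diff (a i) (B i)))"
    by (rule finite_measure_mono) auto
  also have "\<dots> \<le> prob ((\<Union>i. a i) - (\<Union>i<N. a i)) + prob (\<Union>i<N. sym_diff (a i) (B i))"
    by (rule measure_Un_le) auto
  also have "prob ((\<Union>i. a i) - (\<Union>i<N. a i)) = prob (\<Union>i. a i) - prob (\<Union>i<N. a i)"
    by (rule finite_measure_Diff) auto
  also have "prob (\<Union>i<N. sym_diff (a i) (B i)) \<le> (\<Sum>i<N. prob (sym_diff (a i) (B i)))"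
    by (rule finite_measure_subadditive_finite) auto
  also have "\<dots> \<le> (\<Sum>i<N. d)" using B(2) by (intro sum_mono less_imp_le)
  also have "\<dots> \<le> e / 2" using Union.prems by (simp add: d_def field_simps)
  finally have "prob (sym_diff (\<Union>i. a i) (\<Union>i<N. B i)) < e" using N by linarith
  then show ?case using UB by blast
qed

text \<open>The form in which the dependence coefficients are used; it has no division by null events.\<close>

definition phi_bound :: "(nat \<Rightarrow> real) \<Rightarrow> bool" where
  "phi_bound f \<longleftrightarrow> (\<forall>k. f k \<ge> 0) \<and> (\<forall>k m \<Gamma> \<Delta>. k \<ge> 1 \<longrightarrow> \<Gamma> \<in> coord_sigma {..m} \<longrightarrow> \<Delta> \<in> coord_sigma {m + int k..} \<longrightarrow>
     \<bar>prob (\<Gamma> \<inter> \<Delta>) - prob \<Gamma> * prob \<Delta>\<bar> \<le> f k * prob \<Gamma>)"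

lemma prob_sym_diff_le:
  assumes "A \<in> sets P" "B \<in> sets P"
  shows "\<bar>prob A - prob B\<bar> \<le> prob (sym_diff A B)"
proof -
  have "prob A \<le> prob (B \<union> sym_diff A B)" "prob B \<le> prob (A \<union> sym_diff A B)"
    using assms by (auto intro!: finite_measure_mono)
  moreover have "prob (B \<union> sym_diff A B) \<le> prob B + prob (sym_diff A B)" "prob (A \<union> sym_diff A B) \<le> prob A + prob (sym_diff A B)"
    using assms by (auto intro!: measure_Un_le)
  ultimately show ?thesis by linarith
qed

text \<open>An invariant set is its own far translate. Replacing \<open>A\<close> by a window event
  \<open>B\<close> and mixing \<open>B\<close> with its translate gives
  \<open>prob A = prob A * prob A\<close> up to \<open>5 * e\<close>: \<open>2 * e\<close> for the
  intersection, \<open>e\<close> for mixing, \<open>2 * e\<close> for the squares.\<close>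

lemma phi_bound_ergodic:
  assumes f: "phi_bound f" "f \<longlonglongrightarrow> 0" and A: "A \<in> sets P" "translate 1 -` A = A"
  shows "prob A = 0 \<or> prob A = 1"
proof -
  have An: "translate (int n) -` A = A" for n
  proof (induction n)
    case (Suc n)
    have "translate (int (Suc n)) -` A = translate (int n) -` (translate 1 -` A)"
      by (auto simp: translate_add)
    then show ?case using Suc A(2) by simp
  qed (auto simp: translate_zero)
  have "\<bar>prob A - prob A * prob A\<bar> \<le> 5 * e" if e: "e > 0" for e
  proof -
    obtain r B where B: "B \<in> coord_sigma {- int r..int r}" "prob (sym_diff A B) < e"
      using coord_sigma_approx[OF A(1) e] by blast
    have "\<forall>\<^sub>F k in sequentially. f k < e" using f(2) e by (rule order_tendstoD)
    then obtain k where k: "f k < e" "k \<ge> 1"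
      using eventually_happens[OF eventually_conj[OF _ eventually_ge_at_top[of 1]]] by force
    \<comment> \<open>The translated window starts at \<open>r + k\<close>, at distance
      \<open>k\<close> from the end \<open>r\<close> of the original one.\<close>
    define n where "n = 2 * r + k"
    let ?B' = "translate (int n) -` B"
    have Bm [measurable]: "B \<in> sets P" using B coord_sigma_sets by blast
    have "translate (int n) \<in> measurable P P" by measurable
    then have B'm: "?B' \<in> sets P" using measurable_sets[of "translate (int n)" P P B] by (simp add: space_UNIV)
    have "?B' \<in> coord_sigma ((\<lambda>i. i + int n) ` {- int r..int r})" by (rule coord_sigma_translate[OF B(1)])
    moreover have "(\<lambda>i. i + int n) ` {- int r..int r} \<subseteq> {int r + int k..}" by (auto simp: n_def)
    ultimately have "?B' \<in> coord_sigma {int r + int k..}" using coord_sigma_mono by blast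
    moreover have "B \<in> coord_sigma {..int r}" using B(1) coord_sigma_mono[of "{- int r..int r}" "{..int r}"] by auto
    ultimately have "\<bar>prob (B \<inter> ?B') - prob B * prob ?B'\<bar> \<le> f k * prob B"
      using f(1) k(2) unfolding phi_bound_def by blast
    moreover have "prob ?B' = prob B" by (rule prob_translate[OF Bm])
    moreover have "f k * prob B \<le> e * 1" using k e by (intro mult_mono) auto
    ultimately have 1: "\<bar>prob (B \<inter> ?B') - prob B * prob B\<bar> \<le> e" by simp
    have "\<bar>prob A - prob (B \<inter> ?B')\<bar> \<le> prob (sym_diff A (B \<inter> ?B'))" using A B'm by (intro prob_sym_diff_le) auto
    also have "\<dots> \<le> prob (sym_diff A B \<union> translate (int n) -` sym_diff A B)"
    proof (rule finite_measure_mono)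
      show "sym_diff A (B \<inter> ?B') \<subseteq> sym_diff A B \<union> translate (int n) -` sym_diff A B"
        using An[of n] by auto
      show "sym_diff A B \<union> translate (int n) -` sym_diff A B \<in> sets P" using A B'm An[of n] by (auto simp: vimage_Diff)
    qed
    also have "\<dots> \<le> prob (sym_diff A B) + prob (translate (int n) -` sym_diff A B)"
      using A B'm An[of n] by (intro measure_Un_le) (auto simp: vimage_Diff)
    also have "prob (translate (int n) -` sym_diff A B) = prob (sym_diff A B)" using A by (intro prob_translate) auto
    finally have 2: "\<bar>prob A - prob (B \<inter> ?B')\<bar> \<le> 2 * e" using B(2) by linarith
    have 3: "\<bar>prob A - prob B\<bar> \<le> e" using prob_sym_diff_le[OF A(1) Bm] B(2) by linarith
    have "\<bar>prob A + prob B\<bar> \<le> 2" using measure_nonneg[of P A] measure_nonneg[of P B] prob_le_1[of A] prob_le_1[of B] by linarith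
    have "\<bar>prob A * prob A - prob B * prob B\<bar> = \<bar>prob A + prob B\<bar> * \<bar>prob A - prob B\<bar>"
      by (simp only: abs_mult[symmetric]) (simp add: algebra_simps)
    also have "\<dots> \<le> 2 * e" using 3 \<open>\<bar>prob A + prob B\<bar> \<le> 2\<close> by (intro mult_mono) simp_all
    finally show ?thesis using 1 2 by linarith
  qed
  from this[of "\<bar>prob A - prob A * prob A\<bar> / 10"] have "\<bar>prob A - prob A * prob A\<bar> \<le> 0"
    by (cases "\<bar>prob A - prob A * prob A\<bar> > 0") simp_all
  then have "prob A * (1 - prob A) = 0" by (simp add: algebra_simps)
  then show ?thesis by simp
qed

end

section \<open>Kolmogorov--Sinai entropy as the supremum of entropy rates of finite-valued
  processes\<close>

lemma finite_partition_level_sets: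
  assumes "finite_partition M \<xi>"
  obtains y :: "'b \<Rightarrow> nat" and m where "y \<in> measurable M (count_space UNIV)" "\<And>\<omega>. \<omega> \<in> space M \<Longrightarrow> y \<omega> < m"
    "\<xi> = {{\<omega>' \<in> space M. y \<omega>' = y \<omega>} | \<omega>. \<omega> \<in> space M}"
proof -
  have fin: "finite \<xi>" and sub: "\<xi> \<subseteq> sets M" and part: "partition_on (space M) \<xi>"
    using assms by (auto simp: finite_partition_def)
  obtain f where f: "bij_betw f \<xi> {0..<card \<xi>}" using ex_bij_betw_finite_nat[OF fin] by blast
  define c where "c \<omega> = (THE A. A \<in> \<xi> \<and> \<omega> \<in> A)" for \<omega>
  have c: "c \<omega> = A" if "A \<in> \<xi>" "\<omega> \<in> A" for A \<omega>
    unfolding c_def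
  proof (rule the_equality)
    fix B assume "B \<in> \<xi> \<and> \<omega> \<in> B"
    then show "B = A" using part that unfolding partition_on_def disjoint_def by blast
  qed (use that in blast)
  have ex: "\<exists>A\<in>\<xi>. \<omega> \<in> A" if "\<omega> \<in> space M" for \<omega>
    using part that unfolding partition_on_def by blast
  have sp: "A \<subseteq> space M" if "A \<in> \<xi>" for A using part that unfolding partition_on_def by blast
  have inj: "f A = f B \<longleftrightarrow> A = B" if "A \<in> \<xi>" "B \<in> \<xi>" for A B
    using f that by (auto simp: bij_betw_def inj_on_def)
  define y where "y \<omega> = (if \<omega> \<in> space M then f (c \<omega>) else 0)" for \<omega>
  have cell: "{\<omega>' \<in> space M. y \<omega>' = y \<omega>} = A" if "A \<in> \<xi>" "\<omega> \<in> A" for A \<omega>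
  proof (intro set_eqI iffI)
    fix \<omega>' assume *: "\<omega>' \<in> {\<omega>' \<in> space M. y \<omega>' = y \<omega>}"
    then obtain B where B: "B \<in> \<xi>" "\<omega>' \<in> B" using ex by blast
    have "\<omega> \<in> space M" using sp that by blast
    then have "f B = f A" using * c[OF B] c[OF that] by (auto simp: y_def)
    then show "\<omega>' \<in> A" using inj B that by blast
  next
    fix \<omega>' assume *: "\<omega>' \<in> A"
    have "\<omega> \<in> space M" "\<omega>' \<in> space M" using sp that * by blast+
    then show "\<omega>' \<in> {\<omega>' \<in> space M. y \<omega>' = y \<omega>}"
      using c[OF that] c[OF that(1) *] by (simp add: y_def)
  qed
  show thesis
  proof (rule that)
    show "y \<in> measurable M (count_space UNIV)"
    proof (subst measurable_count_space_eq2_countable)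
      have "y -` {n} \<inter> space M \<in> sets M" for n
      proof (cases "\<exists>\<omega>\<in>space M. y \<omega> = n")
        case True
        then obtain \<omega> where w: "\<omega> \<in> space M" "y \<omega> = n" by blast
        then obtain A where "A \<in> \<xi>" "\<omega> \<in> A" using ex by blast
        moreover have "y -` {n} \<inter> space M = {\<omega>' \<in> space M. y \<omega>' = y \<omega>}" using w by auto
        ultimately show ?thesis using cell sub by auto
      next
        case False
        then have "y -` {n} \<inter> space M = {}" by auto
        then show ?thesis by simp
      qed
      then show "y \<in> space M \<rightarrow> UNIV \<and> (\<forall>a\<in>UNIV. y -` {a} \<inter> space M \<in> sets M)" by simp
    qed
    show "y \<omega> < card \<xi>" if "\<omega> \<in> space M" for \<omega>
    proof -
      obtain A where A: "A \<in> \<xi>" "\<omega> \<in> A" using ex[OF \<open>\<omega> \<in> space M\<close>] by blast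
      have "f A \<in> {0..<card \<xi>}" using f A(1) by (auto simp: bij_betw_def)
      then show ?thesis using c[OF A] \<open>\<omega> \<in> space M\<close> by (simp add: y_def)
    qed
    show "\<xi> = {{\<omega>' \<in> space M. y \<omega>' = y \<omega>} | \<omega>. \<omega> \<in> space M}"
    proof (intro set_eqI iffI)
      fix A assume A: "A \<in> \<xi>"
      then have "A \<noteq> {}" using part unfolding partition_on_def by blast
      then obtain \<omega> where "\<omega> \<in> A" by blast
      then show "A \<in> {{\<omega>' \<in> space M. y \<omega>' = y \<omega>} | \<omega>. \<omega> \<in> space M}" using cell[OF A] sp[OF A] by blast
    next
      fix A assume "A \<in> {{\<omega>' \<in> space M. y \<omega>' = y \<omega>} | \<omega>. \<omega> \<in> space M}"
      then obtain \<omega> where "\<omega> \<in> space M" "A = {\<omega>' \<in> space M. y \<omega>' = y \<omega>}" by blast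
      moreover then obtain B where "B \<in> \<xi>" "\<omega> \<in> B" using ex by blast
      ultimately show "A \<in> \<xi>" using cell by simp
    qed
  qed
qed

lemma (in full_prob_space) partition_entropy_eq_integral:
  assumes E: "countable_cells E" and fin: "finite (range E)"
  shows "partition_entropy M (range E) = (\<integral>\<omega>. - ln (prob (E \<omega>)) \<partial>M)"
proof -
  have Em: "A \<in> sets M" if "A \<in> range E" for A using that cell_sets[OF E] by auto
  have "- ln (prob (E \<omega>)) = (\<Sum>A\<in>range E. - ln (prob A) * indicator A \<omega>)" for \<omega>
  proof -
    have "indicator A \<omega> = (if A = E \<omega> then 1 else 0 :: real)" if "A \<in> range E" for A
    proof -
      have "\<omega> \<in> A \<longleftrightarrow> A = E \<omega>"
        using that cell_eq[OF E] cell_self[OF E] by (metis rangeE)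
      then show ?thesis by (simp add: indicator_def)
    qed
    then have "(\<Sum>A\<in>range E. - ln (prob A) * indicator A \<omega>) = (\<Sum>A\<in>range E. if A = E \<omega> then - ln (prob A) else 0)"
      by (intro sum.cong) auto
    also have "\<dots> = - ln (prob (E \<omega>))" using fin by simp
    finally show ?thesis ..
  qed
  then have "(\<integral>\<omega>. - ln (prob (E \<omega>)) \<partial>M) = (\<integral>\<omega>. (\<Sum>A\<in>range E. - ln (prob A) * indicator A \<omega>) \<partial>M)" by simp
  also have "\<dots> = (\<Sum>A\<in>range E. \<integral>\<omega>. - ln (prob A) * indicator A \<omega> \<partial>M)"
    using Em by (intro Bochner_Integration.integral_sum) (auto simp: emeasure_eq_measure)
  also have "\<dots> = (\<Sum>A\<in>range E. - ln (prob A) * prob A)"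
    using Em by (intro sum.cong refl) (simp add: space_UNIV)
  finally show ?thesis unfolding partition_entropy_def by (simp add: sum_negf mult.commute)
qed

locale ergodic_seq = invariant_seq P for P :: "(int \<Rightarrow> 'a :: countable) measure" +
  assumes erg: "A \<in> sets P \<Longrightarrow> translate 1 -` A = A \<Longrightarrow> prob A = 0 \<or> prob A = 1"
begin

sublocale ergodic_action P translate
  by unfold_locales (auto simp: translate_distr translate_add translate_zero erg)

definition letter :: "(int \<Rightarrow> 'a) \<Rightarrow> 'a" where "letter \<omega> = \<omega> 0"

lemma letter_measurable [measurable]: "letter \<in> measurable P (count_space UNIV)"
  unfolding letter_def[abs_def] by measurable

lemma cyl_eq_cell: "cyl n \<omega> = cell letter {- int n..<int n + 1} \<omega>"
proof -
  have "i \<in> {- int n..<int n + 1} \<longleftrightarrow> \<bar>i\<bar> \<le> int n" for i by auto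
  then show ?thesis unfolding cyl_def cell_def letter_def translate_def Ball_def by simp
qed

text \<open>The nonempty cells of the join are the itinerary cells of points over
  \<open>{0..<int n}\<close>. The entropy of the join is thus the mean of \<open>- ln\<close> of a
  cell probability, which is a sum of conditional entropies; the averages of these share their
  limit.\<close>

lemma entropy_wrt_level_sets:
  assumes y: "y \<in> measurable P (count_space UNIV)" "\<And>\<omega>. y \<omega> < m"
  shows "finite_partition P (range (\<lambda>\<omega>. {\<omega>'. y \<omega>' = y \<omega>}))"
    "entropy_wrt_partition P shift (range (\<lambda>\<omega>. {\<omega>'. y \<omega>' = y \<omega>})) = finite_process.entropy_rate P translate y"
proof -
  interpret finite_process P translate y m by unfold_locales (use y in auto)
  let ?\<xi> = "range (\<lambda>\<omega>. {\<omega>'. y \<omega>' = y \<omega>})"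
  have cy: "countable_cells (\<lambda>\<omega>. UNIV \<inter> {\<omega>'. y \<omega>' = y \<omega>})"
    by (rule countable_cells_Int[OF countable_cells_UNIV y(1)])
  have fin: "finite ?\<xi>"
  proof (rule finite_subset)
    show "?\<xi> \<subseteq> (\<lambda>b. {\<omega>'. y \<omega>' = b}) ` {..<m}" using y(2) by auto
  qed simp
  show "finite_partition P ?\<xi>"
    unfolding finite_partition_def partition_on_def disjoint_def space_UNIV
    using fin cell_sets[OF cy] by auto
  have join: "iterated_join P shift ?\<xi> n = range (cell y {0..<int n})" for n
  proof (intro set_eqI iffI)
    fix A assume "A \<in> iterated_join P shift ?\<xi> n"
    then obtain c where c: "c \<in> {..<n} \<rightarrow>\<^sub>E ?\<xi>" "A = {\<omega>. \<forall>i<n. translate (int i) \<omega> \<in> c i}" "A \<noteq> {}"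
      unfolding iterated_join_def by (auto simp: space_UNIV shift_pow)
    obtain \<omega>0 where w0: "\<forall>i<n. translate (int i) \<omega>0 \<in> c i" using c by blast
    have "c i = {\<omega>'. y \<omega>' = y (translate (int i) \<omega>0)}" if "i < n" for i
    proof -
      have "c i \<in> ?\<xi>" using c(1) that by auto
      then show ?thesis using w0 that by auto
    qed
    then have "A = cell y {0..<0 + int n} \<omega>0" unfolding cell_interval_eq c(2) by auto
    then show "A \<in> range (cell y {0..<int n})" by simp
  next
    fix A assume "A \<in> range (cell y {0..<int n})"
    then obtain \<omega>0 where A: "A = cell y {0..<0 + int n} \<omega>0" by auto
    define c where "c i = (if i < n then {\<omega>'. y \<omega>' = y (translate (int i) \<omega>0)} else undefined)" for i
    have "c \<in> {..<n} \<rightarrow>\<^sub>E ?\<xi>" by (auto simp: c_def PiE_iff extensional_def)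
    moreover have "A = {\<omega> \<in> space P. \<forall>i<n. (shift ^^ i) \<omega> \<in> c i}"
      unfolding A cell_interval_eq by (auto simp: c_def space_UNIV shift_pow)
    moreover have "\<omega>0 \<in> A" unfolding A by (simp add: cell_def)
    ultimately show "A \<in> iterated_join P shift ?\<xi> n" unfolding iterated_join_def by blast
  qed
  have "finite (iterated_join P shift ?\<xi> n)" for n
    unfolding iterated_join_def by (intro finite_Diff finite_imageI finite_PiE finite_lessThan fin)
  then have "partition_entropy P (iterated_join P shift ?\<xi> n) = (\<integral>\<omega>. - ln (prob (cell y {0..<int n} \<omega>)) \<partial>P)" for n
    unfolding join by (intro partition_entropy_eq_integral cells) simp
  then show "entropy_wrt_partition P shift ?\<xi> = entropy_rate"
    unfolding entropy_wrt_partition_def using entropy_rate_cesaro by (simp add: limI)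
qed

lemma entropy_rate_le_KS:
  assumes "y \<in> measurable P (count_space UNIV)" "\<And>\<omega>. y \<omega> < m"
  shows "ereal (finite_process.entropy_rate P translate y) \<le> KS_entropy P shift"
  unfolding KS_entropy_def entropy_wrt_level_sets(2)[OF assms, symmetric]
  using entropy_wrt_level_sets(1)[OF assms] by (intro SUP_upper) simp

lemma KS_entropy_eq_SUP:
  "KS_entropy P shift = (SUP (y, m) \<in> {(y, m). y \<in> measurable P (count_space UNIV) \<and> (\<forall>\<omega>. y \<omega> < m)}.
      ereal (finite_process.entropy_rate P translate y))" (is "_ = Sup (?f ` ?S)")
proof (rule antisym)
  show "KS_entropy P shift \<le> Sup (?f ` ?S)"
    unfolding KS_entropy_def
  proof (rule SUP_least)
    fix \<xi> assume "\<xi> \<in> {\<xi>. finite_partition P \<xi>}"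
    then obtain y :: "(int \<Rightarrow> 'a) \<Rightarrow> nat" and m where y: "y \<in> measurable P (count_space UNIV)" "\<And>\<omega>. y \<omega> < m"
      "\<xi> = {{\<omega>' \<in> space P. y \<omega>' = y \<omega>} | \<omega>. \<omega> \<in> space P}"
      using finite_partition_level_sets[of P \<xi>] by (auto simp: space_UNIV)
    then have "\<xi> = range (\<lambda>\<omega>. {\<omega>'. y \<omega>' = y \<omega>})" by (auto simp: space_UNIV)
    then have "ereal (entropy_wrt_partition P shift \<xi>) = ?f (y, m)"
      using entropy_wrt_level_sets(2)[OF y(1,2)] by simp
    also have "\<dots> \<le> Sup (?f ` ?S)" using y by (intro SUP_upper) auto
    finally show "ereal (entropy_wrt_partition P shift \<xi>) \<le> Sup (?f ` ?S)" .
  qed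
  show "Sup (?f ` ?S) \<le> KS_entropy P shift"
    using entropy_rate_le_KS by (intro SUP_least) auto
qed

text \<open>The level sets of \<open>y\<close> need not depend on finitely many letters. Each is
  within \<open>\<delta>\<close> of a window event, and decoding from these events gives an
  \<open>\<eta>\<close> that rarely differs from \<open>y\<close>; \<open>coarse_transfer\<close>
  then compares cells of \<open>y\<close> with slightly longer cylinders.\<close>

lemma lower_rate:
  assumes y: "y \<in> measurable P (count_space UNIV)" "\<And>\<omega>. y \<omega> < m" and e: "e > 0"
  shows "AE \<omega> in P. \<forall>\<^sub>F n in sequentially.
    real n * (2 * finite_process.entropy_rate P translate y - e) \<le> - ln (prob (cyl n \<omega>))"
proof -
  interpret finite_process P translate y m by unfold_locales (use y in auto)
  have m: "m > 0" by (rule m_pos)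
  \<comment> \<open>Chosen so that a correct guess costs \<open>e / 16\<close>;
    \<open>\<delta>\<close> below makes wrong guesses cost at most \<open>e / 16\<close> in mean.
    Twice their sum plus \<open>e / 4\<close> is \<open>e / 2\<close>. The \<open>+ 1\<close> in
    \<open>\<delta>\<close> keeps its denominator positive.\<close>
  define d where "d = 1 - exp (- (e / 16))"
  have d: "0 < d" "d < 1" "- ln (1 - d) = e / 16" using e by (auto simp: d_def)
  have ln_md: "0 \<le> ln (real m / d)" using d m by (simp add: field_simps order.trans[of d 1 "real m"] less_imp_le)
  define \<delta> where "\<delta> = e / (16 * real m * (ln (real m / d) + 1))"
  have \<delta>: "\<delta> > 0" using e m ln_md by (simp add: \<delta>_def add_nonneg_pos)
  define A where "A b = {\<omega>. y \<omega> = b}" for b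
  have Am [measurable]: "A b \<in> sets P" for b
  proof -
    have "y -` {b} \<inter> space P \<in> sets P" using y(1) by (rule measurable_sets) simp
    then show ?thesis by (simp add: A_def space_UNIV vimage_def)
  qed
  have "\<exists>r. \<exists>B\<in>coord_sigma {- int r..int r}. prob (sym_diff (A b) B) < \<delta>" for b
    by (rule coord_sigma_approx[OF Am \<delta>])
  then obtain r B where B: "\<And>b. B b \<in> coord_sigma {- int (r b)..int (r b)}" "\<And>b. prob (sym_diff (A b) (B b)) < \<delta>"
    by metis
  have Bm [measurable]: "B b \<in> sets P" for b using B(1) coord_sigma_sets by blast
  define R where "R = (\<Sum>b<m. r b)"
  \<comment> \<open>The first matching window event, with default \<open>m\<close>. The default lies
    outside the range of \<open>y\<close>, which is allowed because \<open>coarse_transfer\<close>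
    puts no bound on the values of \<open>\<eta>\<close>.\<close>
  define \<eta> where "\<eta> \<omega> = (LEAST b. \<omega> \<in> B b \<or> b \<ge> m)" for \<omega>
  have \<eta>_cong: "\<eta> \<omega>' = \<eta> \<omega>" if "\<omega>' \<in> cell letter {- int R..<int R + 1} \<omega>" for \<omega> \<omega>'
  proof -
    have eq: "\<omega>' i = \<omega> i" if "i \<in> {- int R..int R}" for i
      using \<open>\<omega>' \<in> _\<close> that by (auto simp: cell_def letter_def translate_def)
    have "\<omega>' \<in> B b \<longleftrightarrow> \<omega> \<in> B b" if "b < m" for b
    proof (rule coord_sigma_cong[OF B(1)])
      fix i assume "i \<in> {- int (r b)..int (r b)}"
      moreover have "r b \<le> R" unfolding R_def using that by (intro member_le_sum) auto
      ultimately show "\<omega>' i = \<omega> i" by (intro eq) auto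
    qed
    then have "(\<omega>' \<in> B b \<or> b \<ge> m) = (\<omega> \<in> B b \<or> b \<ge> m)" for b by (cases "b < m") auto
    then show ?thesis unfolding \<eta>_def by simp
  qed
  have sub: "{\<omega>. y \<omega> \<noteq> \<eta> \<omega>} \<subseteq> (\<Union>b<m. sym_diff (A b) (B b))"
  proof (rule subsetI, rule ccontr)
    fix \<omega> assume "\<omega> \<in> {\<omega>. y \<omega> \<noteq> \<eta> \<omega>}" and "\<omega> \<notin> (\<Union>b<m. sym_diff (A b) (B b))"
    then have nin: "\<omega> \<notin> sym_diff (A b) (B b)" if "b < m" for b using that by blast
    have eqv: "\<omega> \<in> B b \<longleftrightarrow> y \<omega> = b" if "b < m" for b
    proof -
      have "\<omega> \<in> B b \<longleftrightarrow> \<omega> \<in> A b" using nin[OF that] by blast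
      then show ?thesis by (simp add: A_def)
    qed
    have "\<eta> \<omega> = y \<omega>" unfolding \<eta>_def
    proof (rule Least_equality)
      show "\<omega> \<in> B (y \<omega>) \<or> m \<le> y \<omega>" using eqv[OF y(2)] by simp
      fix b assume "\<omega> \<in> B b \<or> m \<le> b"
      then show "y \<omega> \<le> b" using eqv[of b] y(2)[of \<omega>] by (cases "b < m") auto
    qed
    then show False using \<open>\<omega> \<in> {\<omega>. y \<omega> \<noteq> \<eta> \<omega>}\<close> by simp
  qed
  have "prob {\<omega>. y \<omega> \<noteq> \<eta> \<omega>} \<le> prob (\<Union>b<m. sym_diff (A b) (B b))"
    using sub by (rule finite_measure_mono) auto
  also have "\<dots> \<le> (\<Sum>b<m. prob (sym_diff (A b) (B b)))"
    by (rule finite_measure_subadditive_finite) auto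
  also have "\<dots> \<le> (\<Sum>b<m. \<delta>)" using B(2) by (intro sum_mono less_imp_le)
  finally have PN: "prob {\<omega>. y \<omega> \<noteq> \<eta> \<omega>} \<le> real m * \<delta>" by simp
  have "ln (real m / d) * prob {\<omega>. y \<omega> \<noteq> \<eta> \<omega>} \<le> (ln (real m / d) + 1) * (real m * \<delta>)"
    using PN ln_md by (intro mult_mono) auto
  also have "\<dots> = e / 16" using m ln_md by (simp add: \<delta>_def field_simps add_nonneg_eq_0_iff)
  finally have cost: "2 * (ln (real m / d) * prob {\<omega>. y \<omega> \<noteq> \<eta> \<omega>} - ln (1 - d)) + e / 4 \<le> e / 2"
    using d(3) by simp
  have e4: "e / 4 > 0" using e by simp
  have "AE \<omega> in P. \<forall>\<^sub>F n in sequentially.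
    - ln (prob (cell y {- int n..<int n + 1} \<omega>)) \<le> - ln (prob (cell letter {- int (n + R)..<int (n + R) + 1} \<omega>))
       + real n * (2 * (ln (real m / d) * prob {\<omega>. y \<omega> \<noteq> \<eta> \<omega>} - ln (1 - d)) + e / 4)"
    by (rule coarse_transfer[OF letter_measurable y _ d(1,2) e4]) (rule \<eta>_cong)
  with breiman_lower[OF e4] show ?thesis
  proof eventually_elim
    case (elim \<omega>)
    let ?h = "entropy_rate"
    from elim have "\<forall>\<^sub>F n in sequentially. real n * (2 * ?h - 3 / 4 * e) \<le> - ln (prob (cyl (n + R) \<omega>))"
    proof eventually_elim
      case A: (elim n)
      have "real n * (2 * (ln (real m / d) * prob {\<omega>. y \<omega> \<noteq> \<eta> \<omega>} - ln (1 - d)) + e / 4) \<le> real n * (e / 2)"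
        using cost by (intro mult_left_mono) auto
      then have "real n * (2 * ?h - e / 4) \<le> - ln (prob (cyl (n + R) \<omega>)) + real n * (e / 2)"
        using A unfolding cyl_eq_cell by linarith
      then show ?case by (simp add: algebra_simps)
    qed
    \<comment> \<open>The cylinder is longer by the constant \<open>R\<close>; the spare
      \<open>e / 4\<close> absorbs this for large \<open>n\<close>.\<close>
    moreover have "\<forall>\<^sub>F n in sequentially. real (n + R) * (2 * ?h - e) \<le> real n * (2 * ?h - 3 / 4 * e)"
    proof -
      have "\<forall>\<^sub>F n in sequentially. a \<le> real n * (e / 4)" for a :: real using e by real_asymp
      from this[of "real R * (2 * ?h)"] show ?thesis
      proof eventually_elim
        case (elim n)
        moreover have "0 \<le> real R * e" using e by simp
        ultimately show ?case by (simp add: algebra_simps)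
      qed
    qed
    ultimately have "\<forall>\<^sub>F n in sequentially. real (n + R) * (2 * ?h - e) \<le> - ln (prob (cyl (n + R) \<omega>))"
      by eventually_elim linarith
    then show ?case using eventually_sequentially_seg[of "\<lambda>n. real n * (2 * ?h - e) \<le> - ln (prob (cyl n \<omega>))" R] by simp
  qed
qed

end

section \<open>The Shannon--McMillan--Breiman theorem\<close>

locale finite_entropy_seq = ergodic_seq P for P :: "(int \<Rightarrow> 'a :: countable) measure" +
  assumes letter_pos: "\<And>a. measure P {\<omega>. \<omega> 0 = a} > 0"
    and finite_entropy: "(\<lambda>a. - (measure P {\<omega>. \<omega> 0 = a} * ln (measure P {\<omega>. \<omega> 0 = a}))) summable_on UNIV"
begin

definition lprob :: "'a \<Rightarrow> real" where "lprob a = prob {\<omega>. \<omega> 0 = a}"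

lemma lprob: "0 < lprob a" "lprob a \<le> 1"
  using letter_pos by (auto simp: lprob_def)

text \<open>The mean is a tail of the convergent entropy series along the enumeration
  \<open>to_nat\<close>. It is the price of naming a rare letter.\<close>

lemma tail_entropy:
  assumes e: "e > 0"
  obtains N where "(\<integral>\<^sup>+\<omega>. ennreal (if to_nat (\<omega> 0) < N then 0 else - ln (lprob (\<omega> 0))) \<partial>P) \<le> ennreal e"
proof -
  define x where "x \<omega> = to_nat (\<omega> (0::int))" for \<omega> :: "int \<Rightarrow> 'a"
  have x: "x \<in> measurable P (count_space UNIV)" unfolding x_def[abs_def] by measurable
  define u where "u a = - (lprob a * ln (lprob a))" for a
  \<comment> \<open>Numbers outside the range of \<open>to_nat\<close> code no letter and get the
    value 0, so finite alphabets are covered too.\<close>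
  define g where "g n = (if n \<in> range (to_nat :: 'a \<Rightarrow> nat) then u (from_nat n) else 0)" for n
  have u0: "u a \<ge> 0" for a using lprob[of a] by (simp add: u_def mult_nonneg_nonpos)
  then have g0: "g n \<ge> 0" for n by (simp add: g_def)
  have "u summable_on UNIV" using finite_entropy by (simp add: u_def[abs_def] lprob_def)
  then have "(g \<circ> to_nat) summable_on (UNIV :: 'a set)" by (simp add: g_def comp_def)
  then have "g summable_on range (to_nat :: 'a \<Rightarrow> nat)" by (subst summable_on_reindex) (auto intro: inj_to_nat)
  then have "g summable_on UNIV" by (rule summable_on_cong_neutral[THEN iffD1, rotated -1]) (auto simp: g_def)
  then have sg: "summable g" using g0 by (subst (asm) summable_on_UNIV_nonneg_real_iff) auto
  then have "(\<lambda>N. \<Sum>n. g (n + N)) \<longlonglongrightarrow> 0" by (rule suminf_exist_split2)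
  then have "\<forall>\<^sub>F N in sequentially. (\<Sum>n. g (n + N)) < e" using e by (rule order_tendstoD)
  then obtain N where N: "(\<Sum>n. g (n + N)) < e" by (auto simp: eventually_sequentially)
  define F where "F n = ennreal (if n < N then 0 else - ln (lprob (from_nat n :: 'a)))" for n
  have "(\<integral>\<^sup>+\<omega>. ennreal (if to_nat (\<omega> 0) < N then 0 else - ln (lprob (\<omega> 0))) \<partial>P) = (\<integral>\<^sup>+\<omega>. F (x \<omega>) \<partial>P)"
    unfolding F_def x_def from_nat_to_nat ..
  also have "\<dots> = (\<integral>\<^sup>+n. F n * emeasure P {\<omega>. x \<omega> = n} \<partial>count_space UNIV)"
    by (rule nn_integral_countable_valued[OF x])
  also have "\<dots> = (\<integral>\<^sup>+n. ennreal (if n < N then 0 else g n) \<partial>count_space UNIV)"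
  proof (rule nn_integral_cong)
    fix n
    show "F n * emeasure P {\<omega>. x \<omega> = n} = ennreal (if n < N then 0 else g n)"
    proof (cases "n \<in> range (to_nat :: 'a \<Rightarrow> nat)")
      case True
      then obtain a :: 'a where n: "n = to_nat a" by blast
      have "{\<omega>. x \<omega> = n} = {\<omega>. \<omega> 0 = a}" by (auto simp: x_def n)
      then have "emeasure P {\<omega>. x \<omega> = n} = ennreal (lprob a)" by (simp add: lprob_def emeasure_eq_measure)
      moreover have "- ln (lprob a) \<ge> 0" using lprob[of a] by simp
      ultimately show ?thesis using True lprob[of a] by (simp add: F_def g_def n u_def mult.commute flip: ennreal_mult)
    next
      case False
      then have "{\<omega>. x \<omega> = n} = {}" by (auto simp: x_def)
      then show ?thesis using False by (simp add: g_def)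
    qed
  qed
  also have "\<dots> = (\<Sum>n. ennreal (if n < N then 0 else g n))" by (rule nn_integral_count_space_nat)
  also have "\<dots> = ennreal (\<Sum>n. if n < N then 0 else g n)"
  proof (rule suminf_ennreal2)
    show "summable (\<lambda>n. if n < N then 0 else g n)"
      by (rule summable_comparison_test'[OF sg]) (use g0 in auto)
  qed (use g0 in auto)
  also have "(\<Sum>n. if n < N then 0 else g n) = (\<Sum>n. g (n + N))"
  proof -
    have "summable (\<lambda>n. if n < N then 0 else g n)"
      by (rule summable_comparison_test'[OF sg]) (use g0 in auto)
    from suminf_split_initial_segment[OF this, of N] show ?thesis by simp
  qed
  finally show thesis using N by (intro that[of N]) (auto intro: order_trans ennreal_leI)
qed

text \<open>Letters with code at least \<open>N\<close> are merged into the symbol \<open>N\<close>.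
  Any other letter is determined by its symbol and gets weight 1; a merged letter gets its own
  probability, so each class has weight at most 1. Only the merged letters cost anything: the
  entropy tail, at most \<open>e / 8\<close>. With \<open>e / 8\<close> for the choice of
  \<open>k\<close>, both doubled, and \<open>e / 2\<close> from \<open>markov_upper\<close>, the
  total is \<open>e\<close>.\<close>

lemma upper_rate:
  assumes e: "e > 0"
  obtains y m where "y \<in> measurable P (count_space UNIV)" "\<And>\<omega>. y \<omega> < m"
    "AE \<omega> in P. \<forall>\<^sub>F n in sequentially.
       - ln (prob (cyl n \<omega>)) \<le> real n * (2 * finite_process.entropy_rate P translate y + e)"
proof -
  have e8: "e / 8 > 0" using e by simp
  obtain N where N: "(\<integral>\<^sup>+\<omega>. ennreal (if to_nat (\<omega> 0) < N then 0 else - ln (lprob (\<omega> 0))) \<partial>P) \<le> ennreal (e / 8)"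
    using tail_entropy[OF e8] by blast
  define \<alpha> where "\<alpha> a = min (to_nat a) N" for a :: 'a
  define y where "y \<omega> = \<alpha> (letter \<omega>)" for \<omega>
  define K where "K a = (if to_nat a < N then 1 else lprob a)" for a :: 'a
  have ym: "y \<in> measurable P (count_space UNIV)" unfolding y_def[abs_def] by measurable
  have ylt: "y \<omega> < Suc N" for \<omega> by (simp add: y_def \<alpha>_def)
  interpret finite_process P translate y "Suc N" by unfold_locales (use ym ylt in auto)
  have K1: "0 < K a" "K a \<le> 1" for a using lprob[of a] by (auto simp: K_def)
  have Ksum: "(\<integral>\<^sup>+a. ennreal (K a) * indicator {a. \<alpha> a = b} a \<partial>count_space UNIV) \<le> 1" for b
  proof (cases "b < N")
    case True
    then have sub: "{a. \<alpha> a = b} \<subseteq> {from_nat b :: 'a}" by (auto simp: \<alpha>_def min_def split: if_splits)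
    have "(\<integral>\<^sup>+a. ennreal (K a) * indicator {a. \<alpha> a = b} a \<partial>count_space UNIV) \<le> (\<integral>\<^sup>+a. ennreal 1 * indicator {from_nat b :: 'a} a \<partial>count_space UNIV)"
    proof (rule nn_integral_mono)
      fix a
      show "ennreal (K a) * indicator {a. \<alpha> a = b} a \<le> ennreal 1 * indicator {from_nat b :: 'a} a"
      proof (cases "\<alpha> a = b")
        case True
        then have "a = from_nat b" using sub by blast
        then show ?thesis using K1(2)[of a] by (simp add: indicator_def)
      qed simp
    qed
    also have "\<dots> = 1" by simp
    finally show ?thesis .
  next
    case False
    have "(\<integral>\<^sup>+a. ennreal (K a) * indicator {a. \<alpha> a = b} a \<partial>count_space UNIV) \<le> (\<integral>\<^sup>+a. emeasure P (UNIV \<inter> {\<omega>. letter \<omega> = a}) \<partial>count_space UNIV)"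
    proof (rule nn_integral_mono)
      fix a
      have "to_nat a \<ge> N" if "\<alpha> a = b" using that False by (auto simp: \<alpha>_def)
      then show "ennreal (K a) * indicator {a. \<alpha> a = b} a \<le> emeasure P (UNIV \<inter> {\<omega>. letter \<omega> = a})"
        by (auto simp: K_def indicator_def emeasure_eq_measure lprob_def letter_def)
    qed
    also have "\<dots> = emeasure P UNIV"
      by (rule nn_integral_emeasure_level_sets[OF letter_measurable]) (simp flip: space_UNIV)
    also have "\<dots> = 1" using emeasure_space_1 by (simp add: space_UNIV)
    finally show ?thesis .
  qed
  have Kle: "(\<integral>\<^sup>+\<omega>. ennreal (- ln (K (letter \<omega>))) \<partial>P) \<le> ennreal (e / 8)"
  proof -
    have "- ln (K (letter \<omega>)) = (if to_nat (\<omega> 0) < N then 0 else - ln (lprob (\<omega> 0)))" for \<omega>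
      by (simp add: K_def letter_def)
    then show ?thesis using N by simp
  qed
  have Kn: "AE \<omega> in P. 0 \<le> - ln (K (letter \<omega>))" using K1 by simp
  have "(\<lambda>\<omega>. ln (K (letter \<omega>))) \<in> borel_measurable P"
    by (rule measurable_compose[OF letter_measurable, of "\<lambda>a. ln (K a)"]) simp
  then have Ki: "integrable P (\<lambda>\<omega>. - ln (K (letter \<omega>)))"
    using Kle Kn by (intro integrableI_nonneg) (auto intro: order_le_less_trans)
  have "ennreal (\<integral>\<omega>. - ln (K (letter \<omega>)) \<partial>P) \<le> ennreal (e / 8)"
    using nn_integral_eq_integral[OF Ki Kn] Kle by simp
  then have KI: "(\<integral>\<omega>. - ln (K (letter \<omega>)) \<partial>P) \<le> e / 8" by (subst (asm) ennreal_le_iff) (use e in auto)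
  have "\<forall>\<^sub>F k in sequentially. cond_entropy k < entropy_rate + e / 8"
    using entropy_rate_tendsto e by (intro order_tendstoD) auto
  then obtain k where k: "cond_entropy k < entropy_rate + e / 8" by (auto simp: eventually_sequentially)
  have "AE \<omega> in P. \<forall>\<^sub>F n in sequentially. - ln (prob (cell letter {- int n..<int n + 1} \<omega>))
      \<le> real n * (2 * (cond_entropy k + (\<integral>\<omega>. - ln (K (letter \<omega>)) \<partial>P)) + e / 2)"
    by (rule markov_upper[where \<alpha> = \<alpha>]) (use K1 Ksum Ki e in \<open>auto simp: y_def\<close>)
  then have "AE \<omega> in P. \<forall>\<^sub>F n in sequentially. - ln (prob (cyl n \<omega>)) \<le> real n * (2 * entropy_rate + e)"
  proof eventually_elim
    case (elim \<omega>)
    then show ?case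
    proof eventually_elim
      case (elim n)
      also have "real n * (2 * (cond_entropy k + (\<integral>\<omega>. - ln (K (letter \<omega>)) \<partial>P)) + e / 2) \<le> real n * (2 * entropy_rate + e)"
        using k KI by (intro mult_left_mono) auto
      finally show ?case by (simp add: cyl_eq_cell)
    qed
  qed
  then show thesis using that ym ylt by blast
qed

lemma AE_witness: "AE \<omega> in P. Q \<omega> \<Longrightarrow> \<exists>\<omega>. Q \<omega>"
  by (rule ccontr) simp

text \<open>The factor \<open>y0\<close> from \<open>upper_rate\<close> with error 1 bounds the rate
  of every other factor, because both estimates hold at a common point; so \<open>h\<close> is
  finite. For given \<open>e\<close>, the lower estimate uses a factor nearly attaining the
  supremum, and the upper one a factor whose rate is at most \<open>h\<close> in any case.\<close>

theorem shannon_mcmillan_breiman: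
  obtains h where "KS_entropy P shift = ereal h" "h \<ge> 0"
    "\<And>e. e > 0 \<Longrightarrow> AE \<omega> in P. \<forall>\<^sub>F n in sequentially.
       real n * (2 * h - e) \<le> - ln (prob (cyl n \<omega>)) \<and> - ln (prob (cyl n \<omega>)) \<le> real n * (2 * h + e)"
proof -
  let ?S = "{(y :: (int \<Rightarrow> 'a) \<Rightarrow> nat, m). y \<in> measurable P (count_space UNIV) \<and> (\<forall>\<omega>. y \<omega> < m)}"
  let ?H = "\<lambda>y. finite_process.entropy_rate P translate y"
  obtain y0 :: "(int \<Rightarrow> 'a) \<Rightarrow> nat" and m0 where y0: "y0 \<in> measurable P (count_space UNIV)" "\<And>\<omega>. y0 \<omega> < m0"
    and up0: "AE \<omega> in P. \<forall>\<^sub>F n in sequentially. - ln (prob (cyl n \<omega>)) \<le> real n * (2 * ?H y0 + 1)"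
    by (rule upper_rate[OF zero_less_one]) (rule that)
  have bound: "?H y \<le> ?H y0 + 1" if y: "y \<in> measurable P (count_space UNIV)" "\<And>\<omega>. y \<omega> < m"
    for y :: "(int \<Rightarrow> 'a) \<Rightarrow> nat" and m
  proof -
    have "AE \<omega> in P. \<exists>n>0. real n * (2 * ?H y - 1) \<le> real n * (2 * ?H y0 + 1)"
      using lower_rate[OF y zero_less_one] up0
    proof eventually_elim
      case (elim \<omega>)
      then have "\<forall>\<^sub>F n in sequentially. n > 0 \<and> real n * (2 * ?H y - 1) \<le> real n * (2 * ?H y0 + 1)"
        using eventually_gt_at_top[of 0] by eventually_elim linarith
      then show ?case by (auto simp: eventually_sequentially)
    qed
    from AE_witness[OF this] obtain n :: nat where "n > 0" "real n * (2 * ?H y - 1) \<le> real n * (2 * ?H y0 + 1)" by blast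
    then show ?thesis by simp
  qed
  have le: "KS_entropy P shift \<le> ereal (?H y0 + 1)"
    unfolding KS_entropy_eq_SUP
  proof (rule SUP_least)
    fix z assume "z \<in> ?S"
    then obtain y m where "z = (y, m)" "y \<in> measurable P (count_space UNIV)" "\<forall>\<omega>. y \<omega> < m" by auto
    then show "(case z of (y, m) \<Rightarrow> ereal (?H y)) \<le> ereal (?H y0 + 1)" using bound[of y m] by simp
  qed
  have ge: "ereal (?H y0) \<le> KS_entropy P shift" by (rule entropy_rate_le_KS[OF y0])
  obtain h where h: "KS_entropy P shift = ereal h" using le ge by (cases "KS_entropy P shift") auto
  have Hle: "?H y \<le> h" if "y \<in> measurable P (count_space UNIV)" "\<And>\<omega>. y \<omega> < m" for y :: "(int \<Rightarrow> 'a) \<Rightarrow> nat" and m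
    using entropy_rate_le_KS[OF that] h by simp
  have "0 \<le> ?H y0"
  proof -
    interpret finite_process P translate y0 m0 by unfold_locales (use y0 in auto)
    show ?thesis by (rule entropy_rate_nonneg)
  qed
  then have h0: "h \<ge> 0" using Hle[OF y0] by linarith
  show thesis
  proof (rule that[OF h h0])
    fix e :: real assume e: "e > 0"
    obtain y :: "(int \<Rightarrow> 'a) \<Rightarrow> nat" and m where y: "y \<in> measurable P (count_space UNIV)" "\<And>\<omega>. y \<omega> < m" "h - e / 4 < ?H y"
    proof -
      have "ereal (h - e / 4) < KS_entropy P shift" using e by (simp add: h)
      then show thesis unfolding KS_entropy_eq_SUP less_SUP_iff using that by auto
    qed
    have e2: "e / 2 > 0" using e by simp
    obtain y1 :: "(int \<Rightarrow> 'a) \<Rightarrow> nat" and m1 where y1: "y1 \<in> measurable P (count_space UNIV)" "\<And>\<omega>. y1 \<omega> < m1"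
      and up1: "AE \<omega> in P. \<forall>\<^sub>F n in sequentially. - ln (prob (cyl n \<omega>)) \<le> real n * (2 * ?H y1 + e)"
      by (rule upper_rate[OF e]) (rule that)
    show "AE \<omega> in P. \<forall>\<^sub>F n in sequentially.
       real n * (2 * h - e) \<le> - ln (prob (cyl n \<omega>)) \<and> - ln (prob (cyl n \<omega>)) \<le> real n * (2 * h + e)"
      using lower_rate[OF y(1,2) e2] up1
    proof eventually_elim
      case (elim \<omega>)
      then show ?case
      proof eventually_elim
        case (elim n)
        have "real n * (2 * h - e) \<le> real n * (2 * ?H y - e / 2)" using y(3) by (intro mult_left_mono) auto
        moreover have "real n * (2 * ?H y1 + e) \<le> real n * (2 * h + e)" using Hle[OF y1] by (intro mult_left_mono) auto
        ultimately show ?case using elim by linarith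
      qed
    qed
  qed
qed

end

section \<open>Second moments and mixing\<close>

text \<open>Chebyshev's inequality about an arbitrary centre: where no \<open>D k\<close> occurs,
  the count is 0 and its distance from \<open>real (card G) * b\<close> is the centre itself. The
  freedom of \<open>b\<close> serves the case \<open>l > 1\<close>, where the mean is known only
  approximately.\<close>

lemma (in prob_space) second_moment:
  assumes G: "finite G" and D [measurable]: "\<And>k. D k \<in> events"
  shows "prob (space M - (\<Union>k\<in>G. D k)) * (real (card G) * b)\<^sup>2
    \<le> (\<Sum>k\<in>G. \<Sum>k'\<in>G. prob (D k \<inter> D k')) - 2 * (real (card G) * b) * (\<Sum>k\<in>G. prob (D k)) + (real (card G) * b)\<^sup>2"
proof -
  let ?b = "real (card G) * b" and ?E = "space M - (\<Union>k\<in>G. D k)"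
  define s where "s \<omega> = (\<Sum>k\<in>G. indicator (D k) \<omega> :: real)" for \<omega>
  have E [measurable]: "?E \<in> events" using G D by (intro sets.Diff sets.top sets.finite_UN) auto
  have ii: "integrable M (\<lambda>\<omega>. indicator (D k) \<omega> :: real)" for k by (simp add: emeasure_eq_measure)
  have ii2: "integrable M (\<lambda>\<omega>. indicator (D k \<inter> D k') \<omega> :: real)" for k k' by (simp add: emeasure_eq_measure)
  have sq: "(s \<omega> - ?b)\<^sup>2 = (\<Sum>k\<in>G. \<Sum>k'\<in>G. indicator (D k \<inter> D k') \<omega>) - 2 * ?b * (\<Sum>k\<in>G. indicator (D k) \<omega>) + ?b\<^sup>2" for \<omega>
    unfolding s_def by (simp add: power2_eq_square sum_product indicator_inter_arith algebra_simps)
  have "prob ?E * ?b\<^sup>2 = (\<integral>\<omega>. indicator ?E \<omega> * ?b\<^sup>2 \<partial>M)" by simp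
  also have "\<dots> \<le> (\<integral>\<omega>. (s \<omega> - ?b)\<^sup>2 \<partial>M)"
  proof (rule integral_mono)
    show "integrable M (\<lambda>\<omega>. indicator ?E \<omega> * ?b\<^sup>2)" by (simp add: emeasure_eq_measure)
    show "integrable M (\<lambda>\<omega>. (s \<omega> - ?b)\<^sup>2)" unfolding sq
      by (intro Bochner_Integration.integrable_add Bochner_Integration.integrable_diff Bochner_Integration.integrable_sum
          integrable_mult_right ii ii2) simp
    fix \<omega>
    have "s \<omega> = 0" if "\<omega> \<in> ?E" using that by (auto simp: s_def)
    then show "indicator ?E \<omega> * ?b\<^sup>2 \<le> (s \<omega> - ?b)\<^sup>2" by (auto simp: indicator_def)
  qed
  also have "\<dots> = (\<Sum>k\<in>G. \<Sum>k'\<in>G. prob (D k \<inter> D k')) - 2 * ?b * (\<Sum>k\<in>G. prob (D k)) + ?b\<^sup>2"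
  proof -
    have "(\<integral>\<omega>. (s \<omega> - ?b)\<^sup>2 \<partial>M) = (\<integral>\<omega>. (\<Sum>k\<in>G. \<Sum>k'\<in>G. indicator (D k \<inter> D k') \<omega>) \<partial>M)
      - (\<integral>\<omega>. 2 * ?b * (\<Sum>k\<in>G. indicator (D k) \<omega>) \<partial>M) + (\<integral>\<omega>. ?b\<^sup>2 \<partial>M)"
      unfolding sq
      by (subst Bochner_Integration.integral_add Bochner_Integration.integral_diff;
          (intro Bochner_Integration.integrable_diff Bochner_Integration.integrable_sum integrable_mult_right ii ii2)?; simp)+
    then show ?thesis using ii ii2 prob_space
      by (simp add: Bochner_Integration.integral_sum del: Int_iff)
  qed
  finally show ?thesis .
qed

lemma card_window_le:
  fixes f :: "nat \<Rightarrow> int"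
  assumes f: "\<And>z. finite {k. f k = z} \<and> real (card {k. f k = z}) \<le> K"
  shows "finite {k. \<bar>f k - a\<bar> < int W}" "real (card {k. \<bar>f k - a\<bar> < int W}) \<le> 2 * real W * K"
proof -
  have eq: "{k. \<bar>f k - a\<bar> < int W} = (\<Union>z\<in>{a - int W<..<a + int W}. {k. f k = z})" by auto
  show "finite {k. \<bar>f k - a\<bar> < int W}" unfolding eq using f by auto
  have K: "K \<ge> 0" using f[of 0] by (meson of_nat_0_le_iff order_trans)
  have "real (card {k. \<bar>f k - a\<bar> < int W}) \<le> real (\<Sum>z\<in>{a - int W<..<a + int W}. card {k. f k = z})"
    unfolding eq by (intro of_nat_mono card_UN_le) simp
  also have "\<dots> \<le> (\<Sum>z\<in>{a - int W<..<a + int W}. K)" unfolding of_nat_sum using f by (intro sum_mono) blast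
  also have "\<dots> = real (card {a - int W<..<a + int W}) * K" by simp
  also have "\<dots> \<le> 2 * real W * K" using K by (intro mult_right_mono) auto
  finally show "real (card {k. \<bar>f k - a\<bar> < int W}) \<le> 2 * real W * K" .
qed

section \<open>Mixing estimates for translated windows\<close>

context invariant_seq
begin

text \<open>In contrast to \<open>phi_bound\<close> the error is relative to both probabilities.
  Only \<open>k \<ge> 1\<close> is constrained, since the psi coefficient at 0 may be
  infinite.\<close>

definition psi_bound :: "(nat \<Rightarrow> real) \<Rightarrow> bool" where
  "psi_bound f \<longleftrightarrow> (\<forall>k. f k \<ge> 0) \<and> (\<forall>k m \<Gamma> \<Delta>. k \<ge> 1 \<longrightarrow> \<Gamma> \<in> coord_sigma {..m} \<longrightarrow> \<Delta> \<in> coord_sigma {m + int k..} \<longrightarrow>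
     \<bar>prob (\<Gamma> \<inter> \<Delta>) - prob \<Gamma> * prob \<Delta>\<bar> \<le> f k * (prob \<Gamma> * prob \<Delta>))"

lemma translate_window:
  assumes C: "C \<in> coord_sigma {- int n..int n}"
  shows "translate t -` C \<in> coord_sigma {t - int n..t + int n}"
proof -
  have eq: "(\<lambda>i. i + t) ` {- int n..int n} = {t - int n..t + int n}" by (simp add: add.commute)
  show ?thesis using coord_sigma_translate[OF C, of t] unfolding eq .
qed

text \<open>Induction on the largest time \<open>b\<close>. All other windows end by
  \<open>b - n - g\<close> and the window at \<open>b\<close> starts at \<open>b - n\<close>, so one
  use of the bound at gap \<open>g\<close> splits off a factor
  \<open>(1 \<plusminus> f g) * prob C\<close>. In the lower bound \<open>f g \<le> 1\<close> keeps
  this factor nonnegative.\<close>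

lemma psi_product:
  assumes f: "psi_bound f" and g: "g \<ge> 1" and C: "C \<in> coord_sigma {- int n..int n}" and "finite A"
    and sep: "\<And>s t. s \<in> A \<Longrightarrow> t \<in> A \<Longrightarrow> s \<noteq> t \<Longrightarrow> \<bar>s - t\<bar> \<ge> 2 * int n + int g"
  shows "prob {\<omega>. \<forall>t\<in>A. translate t \<omega> \<in> C} \<le> ((1 + f g) * prob C) ^ card A"
    "f g \<le> 1 \<Longrightarrow> prob {\<omega>. \<forall>t\<in>A. translate t \<omega> \<in> C} \<ge> ((1 - f g) * prob C) ^ card A"
proof -
  have Cm: "C \<in> sets P" using C coord_sigma_sets by blast
  have fg: "f g \<ge> 0" using f by (simp add: psi_bound_def)
  have "prob {\<omega>. \<forall>t\<in>A. translate t \<omega> \<in> C} \<le> ((1 + f g) * prob C) ^ card A \<and>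
    (f g \<le> 1 \<longrightarrow> prob {\<omega>. \<forall>t\<in>A. translate t \<omega> \<in> C} \<ge> ((1 - f g) * prob C) ^ card A)"
    using \<open>finite A\<close> sep
  proof (induction A rule: finite_linorder_max_induct)
    case empty
    then show ?case using prob_space by (simp add: space_UNIV)
  next
    case (insert b A)
    let ?m = "b - int n - int g"
    let ?\<Gamma> = "{\<omega>. \<forall>t\<in>A. translate t \<omega> \<in> C}" and ?\<Delta> = "translate b -` C"
    have "translate t -` C \<in> coord_sigma {..?m}" if "t \<in> A" for t
    proof -
      have "t < b" using insert.hyps that by blast
      moreover have "\<bar>b - t\<bar> \<ge> 2 * int n + int g" using insert.prems that insert.hyps by auto
      ultimately have "{t - int n..t + int n} \<subseteq> {..?m}" by auto
      then show ?thesis using translate_window[OF C, of t] coord_sigma_mono by blast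
    qed
    then have "UNIV - (\<Union>t\<in>A. UNIV - translate t -` C) \<in> coord_sigma {..?m}"
    proof -
      interpret sigma_algebra UNIV "coord_sigma {..?m} :: (int \<Rightarrow> 'a) set set" by (rule sigma_algebra_coord_sigma)
      show ?thesis using \<open>\<And>t. t \<in> A \<Longrightarrow> translate t -` C \<in> coord_sigma {..?m}\<close> insert.hyps(1)
        by (intro compl_sets finite_UN) auto
    qed
    also have "UNIV - (\<Union>t\<in>A. UNIV - translate t -` C) = ?\<Gamma>" by auto
    finally have G: "?\<Gamma> \<in> coord_sigma {..?m}" .
    have "{b - int n..b + int n} \<subseteq> {?m + int g..}" by auto
    then have "?\<Delta> \<in> coord_sigma {?m + int g..}" using translate_window[OF C, of b] coord_sigma_mono by blast
    then have "\<bar>prob (?\<Gamma> \<inter> ?\<Delta>) - prob ?\<Gamma> * prob ?\<Delta>\<bar> \<le> f g * (prob ?\<Gamma> * prob ?\<Delta>)"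
      using f g G unfolding psi_bound_def by blast
    moreover have "?\<Gamma> \<inter> ?\<Delta> = {\<omega>. \<forall>t\<in>insert b A. translate t \<omega> \<in> C}" by auto
    moreover have "prob ?\<Delta> = prob C" by (rule prob_translate[OF Cm])
    ultimately have *: "\<bar>prob {\<omega>. \<forall>t\<in>insert b A. translate t \<omega> \<in> C} - prob ?\<Gamma> * prob C\<bar> \<le> f g * (prob ?\<Gamma> * prob C)" by simp
    have IH: "prob ?\<Gamma> \<le> ((1 + f g) * prob C) ^ card A" "f g \<le> 1 \<Longrightarrow> ((1 - f g) * prob C) ^ card A \<le> prob ?\<Gamma>"
      using insert.IH insert.prems by auto
    have card: "card (insert b A) = Suc (card A)" using insert.hyps by (subst card_insert_disjoint) auto
    have "prob {\<omega>. \<forall>t\<in>insert b A. translate t \<omega> \<in> C} \<le> ((1 + f g) * prob C) * prob ?\<Gamma>"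
      using * by (simp add: algebra_simps abs_le_iff)
    also have "\<dots> \<le> ((1 + f g) * prob C) * ((1 + f g) * prob C) ^ card A"
      using IH fg by (intro mult_left_mono) auto
    finally have 1: "prob {\<omega>. \<forall>t\<in>insert b A. translate t \<omega> \<in> C} \<le> ((1 + f g) * prob C) ^ card (insert b A)"
      unfolding card by simp
    have 2: "prob {\<omega>. \<forall>t\<in>insert b A. translate t \<omega> \<in> C} \<ge> ((1 - f g) * prob C) ^ card (insert b A)" if "f g \<le> 1"
    proof -
      have "((1 - f g) * prob C) ^ card (insert b A) \<le> ((1 - f g) * prob C) * prob ?\<Gamma>"
        unfolding card using IH(2)[OF that] that by (simp add: mult_left_mono)
      also have "\<dots> \<le> prob {\<omega>. \<forall>t\<in>insert b A. translate t \<omega> \<in> C}"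
        using * by (simp add: algebra_simps abs_le_iff)
      finally show ?thesis .
    qed
    from 1 2 show ?case by blast
  qed
  then show "prob {\<omega>. \<forall>t\<in>A. translate t \<omega> \<in> C} \<le> ((1 + f g) * prob C) ^ card A"
    "f g \<le> 1 \<Longrightarrow> prob {\<omega>. \<forall>t\<in>A. translate t \<omega> \<in> C} \<ge> ((1 - f g) * prob C) ^ card A" by blast+
qed

text \<open>The windows are \<open>\<bar>s - t\<bar> - 2 * int n\<close> apart. The phi coefficient
  treats past and future differently, but both windows have probability \<open>prob C\<close>, so
  either order of \<open>s\<close> and \<open>t\<close> gives the same bound.\<close>

lemma phi_pair:
  assumes f: "phi_bound f" and C: "C \<in> coord_sigma {- int n..int n}" and st: "\<bar>s - t\<bar> > 2 * int n"
  shows "prob (translate s -` C \<inter> translate t -` C) - (prob C)\<^sup>2 \<le> f (nat (\<bar>s - t\<bar> - 2 * int n)) * prob C"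
proof -
  have Cm: "C \<in> sets P" using C coord_sigma_sets by blast
  have main: "prob (translate u -` C \<inter> translate v -` C) - (prob C)\<^sup>2 \<le> f (nat (v - u - 2 * int n)) * prob C"
    if "v - u > 2 * int n" for u v :: int
  proof -
    let ?g = "nat (v - u - 2 * int n)"
    have "{u - int n..u + int n} \<subseteq> {..u + int n}" "{v - int n..v + int n} \<subseteq> {u + int n + int ?g..}" using that by auto
    then have "translate u -` C \<in> coord_sigma {..u + int n}" "translate v -` C \<in> coord_sigma {u + int n + int ?g..}"
      using translate_window[OF C] coord_sigma_mono by blast+
    moreover have "?g \<ge> 1" using that by simp
    ultimately have "\<bar>prob (translate u -` C \<inter> translate v -` C) - prob (translate u -` C) * prob (translate v -` C)\<bar>
       \<le> f ?g * prob (translate u -` C)"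
      using f unfolding phi_bound_def by blast
    then show ?thesis unfolding prob_translate[OF Cm] power2_eq_square by linarith
  qed
  show ?thesis
  proof (cases "s < t")
    case True
    then show ?thesis using main[of t s] st by (simp add: abs_if)
  next
    case False
    then show ?thesis using main[of s t] st by (simp add: abs_if Int_commute split: if_splits)
  qed
qed

end

text \<open>The right side is the chord over \<open>[0, 1]\<close> of a convex function; it makes
  the error linear in \<open>x\<close>.\<close>

lemma one_plus_power_le:
  fixes x :: real
  assumes "0 \<le> x" "x \<le> 1"
  shows "(1 + x) ^ n \<le> 1 + (2 ^ n - 1) * x"
proof (induction n)
  case (Suc n)
  have "x * x \<le> x" using assms by (simp add: mult_left_le)
  then have "(2 ^ n - 1) * (x * x) \<le> (2 ^ n - 1) * x" by (intro mult_left_mono) auto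
  then have "(1 + x) * (1 + (2 ^ n - 1) * x) \<le> 1 + (2 ^ Suc n - 1) * x" by (simp add: algebra_simps)
  moreover have "(1 + x) ^ Suc n \<le> (1 + x) * (1 + (2 ^ n - 1) * x)"
    using Suc assms by (simp add: mult_left_mono)
  ultimately show ?case by linarith
qed simp

section \<open>Counting simultaneous visits: separated indices and second moments\<close>

locale hitting = invariant_seq P for P :: "(int \<Rightarrow> 'a :: countable) measure" +
  fixes l :: nat and q :: "nat \<Rightarrow> nat \<Rightarrow> nat" and K :: real and f :: "nat \<Rightarrow> real"
  assumes l: "l \<ge> 1"
    and count1: "\<And>i z. i \<in> {1..l} \<Longrightarrow> finite {n. int (q i n) = z} \<and> real (card {n. int (q i n) = z}) \<le> K"
    and count2: "\<And>i j z. i \<in> {1..l} \<Longrightarrow> j \<in> {1..l} \<Longrightarrow> i \<noteq> j \<Longrightarrow>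
      finite {n. int (q i n) - int (q j n) = z} \<and> real (card {n. int (q i n) - int (q j n) = z}) \<le> K"
    and phi: "phi_bound f" and psi: "l > 1 \<Longrightarrow> psi_bound f" and f_summable: "summable f"
begin

definition hit :: "(int \<Rightarrow> 'a) set \<Rightarrow> nat \<Rightarrow> (int \<Rightarrow> 'a) set" where
  "hit C k = {\<omega>. \<forall>i\<in>{1..l}. translate (int (q i k)) \<omega> \<in> C}"

definition hit_times :: "nat \<Rightarrow> int set" where
  "hit_times k = (\<lambda>i. int (q i k)) ` {1..l}"

definition separated :: "nat \<Rightarrow> nat \<Rightarrow> bool" where
  "separated W k \<longleftrightarrow> (\<forall>i\<in>{1..l}. \<forall>j\<in>{1..l}. i \<noteq> j \<longrightarrow> \<bar>int (q i k) - int (q j k)\<bar> \<ge> int W)"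

text \<open>For \<open>W \<ge> 1\<close> the index \<open>k\<close> itself belongs to this set, so
  the diagonal of the double sum is treated together with the close pairs.\<close>

definition near :: "nat \<Rightarrow> nat \<Rightarrow> nat set" where
  "near W k = {k'. \<exists>i\<in>{1..l}. \<exists>j\<in>{1..l}. \<bar>int (q j k') - int (q i k)\<bar> < int W}"

lemma f_nonneg: "f n \<ge> 0"
  using phi by (simp add: phi_bound_def)

lemma K_nonneg: "K \<ge> 0"
  using count1[of 1 0] l by (auto intro: order_trans[OF of_nat_0_le_iff])

lemma hit_eq: "hit C k = {\<omega>. \<forall>t\<in>hit_times k. translate t \<omega> \<in> C}"
  by (auto simp: hit_def hit_times_def)

lemma hit_sets [measurable]: "C \<in> sets P \<Longrightarrow> hit C k \<in> sets P"
proof -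
  assume [measurable]: "C \<in> sets P"
  have "{\<omega> \<in> space P. \<forall>i\<in>{1..l}. translate (int (q i k)) \<omega> \<in> C} \<in> sets P" by measurable
  then show ?thesis by (simp add: hit_def space_UNIV)
qed

lemma hit_le_prob: "C \<in> sets P \<Longrightarrow> prob (hit C k) \<le> prob C"
proof -
  assume C: "C \<in> sets P"
  have "translate (int (q 1 k)) -` C \<inter> space P \<in> sets P" by (rule measurable_sets[OF translate_measurable C])
  then have "prob (hit C k) \<le> prob (translate (int (q 1 k)) -` C)"
    using l by (intro finite_measure_mono) (auto simp: hit_def space_UNIV)
  then show ?thesis using prob_translate[OF C] by simp
qed

text \<open>For each of at most \<open>l^2\<close> pairs of functions, the difference is confined to
  fewer than \<open>2 W\<close> integers (or none if \<open>W = 0\<close>), and each value is taken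
  at most \<open>K\<close> times.\<close>

lemma not_separated_card:
  "finite {k. \<not> separated W k}" "real (card {k. \<not> separated W k}) \<le> 2 * (real l)\<^sup>2 * real W * K"
proof -
  let ?I = "{(i, j). i \<in> {1..l} \<and> j \<in> {1..l} \<and> i \<noteq> j}"
  let ?B = "\<lambda>(i, j). {k. \<bar>(int (q i k) - int (q j k)) - 0\<bar> < int W}"
  have sub: "?I \<subseteq> {1..l} \<times> {1..l}" by auto
  then have finI: "finite ?I" by (rule finite_subset) simp
  have "card ?I \<le> card ({1..l} \<times> {1..l})" using sub by (intro card_mono) auto
  then have cI: "real (card ?I) \<le> (real l)\<^sup>2" by (simp add: power2_eq_square flip: of_nat_mult)
  have eq: "{k. \<not> separated W k} = (\<Union>z\<in>?I. ?B z)"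
  proof (intro set_eqI iffI)
    fix k assume "k \<in> {k. \<not> separated W k}"
    then obtain i j where "i \<in> {1..l}" "j \<in> {1..l}" "i \<noteq> j" "\<not> int W \<le> \<bar>int (q i k) - int (q j k)\<bar>"
      unfolding separated_def by blast
    then have "(i, j) \<in> ?I" "k \<in> ?B (i, j)" by simp_all
    then show "k \<in> (\<Union>z\<in>?I. ?B z)" by blast
  next
    fix k assume "k \<in> (\<Union>z\<in>?I. ?B z)"
    then obtain i j where ij: "i \<in> {1..l}" "j \<in> {1..l}" "i \<noteq> j" "\<bar>int (q i k) - int (q j k)\<bar> < int W" by auto
    then have "\<not> int W \<le> \<bar>int (q i k) - int (q j k)\<bar>" by simp
    then show "k \<in> {k. \<not> separated W k}" unfolding separated_def using ij(1-3) by blast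
  qed
  have B: "finite (?B z) \<and> real (card (?B z)) \<le> 2 * real W * K" if "z \<in> ?I" for z
    using that card_window_le[OF count2, of "fst z" "snd z" 0 W] by auto
  show "finite {k. \<not> separated W k}" unfolding eq using finI B by blast
  have "real (card {k. \<not> separated W k}) \<le> real (\<Sum>z\<in>?I. card (?B z))"
    unfolding eq by (intro of_nat_mono card_UN_le finI)
  also have "\<dots> \<le> (\<Sum>z\<in>?I. 2 * real W * K)" unfolding of_nat_sum using B by (intro sum_mono) blast
  also have "\<dots> = real (card ?I) * (2 * real W * K)" by simp
  also have "\<dots> \<le> (real l)\<^sup>2 * (2 * real W * K)" using cI K_nonneg by (intro mult_right_mono) auto
  finally show "real (card {k. \<not> separated W k}) \<le> 2 * (real l)\<^sup>2 * real W * K" by (simp add: ac_simps)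
qed

text \<open>The same count with the values of \<open>q j\<close> around the fixed centre
  \<open>q i k\<close> in place of differences around 0.\<close>

lemma near_card: "finite (near W k)" "real (card (near W k)) \<le> 2 * (real l)\<^sup>2 * real W * K"
proof -
  let ?I = "{1..l} \<times> {1..l}"
  let ?B = "\<lambda>(i, j). {k'. \<bar>int (q j k') - int (q i k)\<bar> < int W}"
  have eq: "near W k = (\<Union>z\<in>?I. ?B z)" unfolding near_def by auto
  have B: "finite (?B z) \<and> real (card (?B z)) \<le> 2 * real W * K" if "z \<in> ?I" for z
    using that card_window_le[OF count1, of "snd z" "int (q (fst z) k)" W] by auto
  show "finite (near W k)" unfolding eq using B by blast
  have "real (card (near W k)) \<le> real (\<Sum>z\<in>?I. card (?B z))"
    unfolding eq by (intro of_nat_mono card_UN_le) simp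
  also have "\<dots> \<le> (\<Sum>z\<in>?I. 2 * real W * K)" unfolding of_nat_sum using B by (intro sum_mono) blast
  also have "\<dots> = 2 * (real l)\<^sup>2 * real W * K" by (simp add: power2_eq_square)
  finally show "real (card (near W k)) \<le> 2 * (real l)\<^sup>2 * real W * K" .
qed

lemma hit_times_separated:
  assumes "separated W k" "W \<ge> 1"
  shows "finite (hit_times k)" "card (hit_times k) = l"
    "\<And>s t. s \<in> hit_times k \<Longrightarrow> t \<in> hit_times k \<Longrightarrow> s \<noteq> t \<Longrightarrow> \<bar>s - t\<bar> \<ge> int W"
proof -
  show "finite (hit_times k)" by (simp add: hit_times_def)
  have "inj_on (\<lambda>i. int (q i k)) {1..l}"
  proof (rule inj_onI, rule ccontr)
    fix i j assume "i \<in> {1..l}" "j \<in> {1..l}" "int (q i k) = int (q j k)" "i \<noteq> j"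
    then have "\<bar>int (q i k) - int (q j k)\<bar> \<ge> int W" using assms(1) unfolding separated_def by blast
    then show False using assms(2) \<open>int (q i k) = int (q j k)\<close> by simp
  qed
  then show "card (hit_times k) = l" by (simp add: hit_times_def card_image)
  show "\<bar>s - t\<bar> \<ge> int W" if "s \<in> hit_times k" "t \<in> hit_times k" "s \<noteq> t" for s t
    using that assms(1) unfolding hit_times_def separated_def by fastforce
qed

lemma prob_hit_separated:
  assumes f: "psi_bound f" and g: "g \<ge> 1" and C: "C \<in> coord_sigma {- int n..int n}" and k: "separated (2 * n + g) k"
  shows "prob (hit C k) \<le> ((1 + f g) * prob C) ^ l" "f g \<le> 1 \<Longrightarrow> ((1 - f g) * prob C) ^ l \<le> prob (hit C k)"
proof -
  have W: "2 * n + g \<ge> 1" using g by simp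
  note t = hit_times_separated[OF k W]
  have sep: "\<bar>s - t\<bar> \<ge> 2 * int n + int g" if "s \<in> hit_times k" "t \<in> hit_times k" "s \<noteq> t" for s t
    using t(3)[OF that] by simp
  show "prob (hit C k) \<le> ((1 + f g) * prob C) ^ l" "f g \<le> 1 \<Longrightarrow> ((1 - f g) * prob C) ^ l \<le> prob (hit C k)"
    using psi_product[OF f g C t(1) sep] unfolding hit_eq t(2) by blast+
qed

text \<open>As \<open>k'\<close> is not near \<open>k\<close>, their visiting times are disjoint and
  mutually separated: together they form \<open>2 * l\<close> separated times.\<close>

lemma prob_hit_far:
  assumes f: "psi_bound f" and g: "g \<ge> 1" and C: "C \<in> coord_sigma {- int n..int n}"
    and k: "separated (2 * n + g) k" "separated (2 * n + g) k'" and far: "k' \<notin> near (2 * n + g) k"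
  shows "prob (hit C k \<inter> hit C k') \<le> ((1 + f g) * prob C) ^ (2 * l)"
proof -
  have W: "2 * n + g \<ge> 1" using g by simp
  note t = hit_times_separated[OF k(1) W] and t' = hit_times_separated[OF k(2) W]
  have cross: "\<bar>s - t\<bar> \<ge> 2 * int n + int g" if "s \<in> hit_times k'" "t \<in> hit_times k" for s t
    using that far unfolding hit_times_def near_def by (auto simp: not_less)
  have sep: "\<bar>s - t\<bar> \<ge> 2 * int n + int g" if "s \<in> hit_times k \<union> hit_times k'" "t \<in> hit_times k \<union> hit_times k'" "s \<noteq> t" for s t
    using that t(3)[of s t] t'(3)[of s t] cross[of s t] cross[of t s] by (auto simp: abs_minus_commute)
  have "hit_times k \<inter> hit_times k' = {}"
  proof (rule ccontr)
    assume "hit_times k \<inter> hit_times k' \<noteq> {}"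
    then obtain s where "s \<in> hit_times k" "s \<in> hit_times k'" by blast
    then show False using cross[of s s] g by simp
  qed
  then have card: "card (hit_times k \<union> hit_times k') = 2 * l"
    using t(1,2) t'(1,2) by (subst card_Un_disjoint) auto
  have "hit C k \<inter> hit C k' = {\<omega>. \<forall>t\<in>hit_times k \<union> hit_times k'. translate t \<omega> \<in> C}" unfolding hit_eq by auto
  then show ?thesis
    using psi_product(1)[OF f g C, of "hit_times k \<union> hit_times k'"] sep t(1) t'(1) unfolding card by simp
qed

text \<open>The union bound. Gap 1 is enough, since it costs only the constant factor
  \<open>(1 + f 1) ^ l\<close>. An index with windows that may overlap is bounded by
  \<open>prob C\<close> alone, but there are only \<open>O(n)\<close> of them, whatever
  \<open>N\<close> is.\<close>

lemma prob_hit_before: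
  assumes C: "C \<in> coord_sigma {- int n..int n}"
  shows "prob (\<Union>k\<in>{1..N}. hit C k) \<le> real N * ((1 + f 1) * prob C) ^ l + 2 * (real l)\<^sup>2 * real (2 * n + 1) * K * prob C"
proof -
  have Cm: "C \<in> sets P" using C coord_sigma_sets by blast
  let ?b = "((1 + f 1) * prob C) ^ l" and ?B = "{k. \<not> separated (2 * n + 1) k}"
  have b0: "?b \<ge> 0" using f_nonneg by simp
  have good: "prob (hit C k) \<le> ?b" if "separated (2 * n + 1) k" for k
  proof (cases "l > 1")
    case True
    then show ?thesis using prob_hit_separated(1)[OF psi[OF True] _ C that] by simp
  next
    case False
    then have "l = 1" using l by simp
    then show ?thesis using hit_le_prob[OF Cm, of k] f_nonneg[of 1] mult_right_mono[of 1 "1 + f 1" "prob C"] by simp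
  qed
  have "prob (\<Union>k\<in>{1..N}. hit C k) \<le> (\<Sum>k\<in>{1..N}. prob (hit C k))"
    using Cm by (intro finite_measure_subadditive_finite) auto
  also have "\<dots> \<le> (\<Sum>k\<in>{1..N}. ?b + (if k \<in> ?B then prob C else 0))"
    using good hit_le_prob[OF Cm] b0 by (intro sum_mono) (auto simp: add_increasing)
  also have "\<dots> = real N * ?b + real (card ({1..N} \<inter> ?B)) * prob C"
    by (simp add: sum.distrib sum.If_cases)
  also have "\<dots> \<le> real N * ?b + real (card ?B) * prob C"
    using not_separated_card(1) by (intro add_left_mono mult_right_mono of_nat_mono card_mono) auto
  also have "\<dots> \<le> real N * ?b + (2 * (real l)\<^sup>2 * real (2 * n + 1) * K) * prob C"
    by (intro add_left_mono mult_right_mono not_separated_card(2)) simp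
  finally show ?thesis .
qed

text \<open>The hitting probability is exactly \<open>prob C\<close>, so the centre is the mean and
  only covariances remain. In each row the \<open>O(n)\<close> indices with overlapping windows
  contribute at most \<open>prob C\<close> each, the others \<open>prob C\<close> times
  \<open>f\<close> at their gap. The variance is thus of order \<open>n N P(C)\<close>, to be
  divided by the square of \<open>N P(C)\<close>.\<close>

lemma prob_not_hit_single:
  assumes l1: "l = 1" and C: "C \<in> coord_sigma {- int n..int n}" and p: "prob C > 0" and N: "N \<ge> 1"
  shows "prob (UNIV - (\<Union>k\<in>{1..N}. hit C k)) \<le> (4 * K + 2 * K * suminf f) * (real n + 1) / (real N * prob C)"
proof -
  have Cm: "C \<in> sets P" using C coord_sigma_sets by blast
  let ?p = "prob C" and ?t = "\<lambda>k. int (q 1 k)"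
  have l_set: "{1..l} = {1}" using l1 by simp
  have hit1: "hit C k = translate (?t k) -` C" for k unfolding hit_def l_set by auto
  have ph: "prob (hit C k) = ?p" for k unfolding hit1 by (rule prob_translate[OF Cm])
  have c1: "finite {k. ?t k = z} \<and> real (card {k. ?t k = z}) \<le> K" for z using count1[of 1] l1 by simp
  have row: "(\<Sum>k'\<in>{1..N}. prob (hit C k \<inter> hit C k') - ?p\<^sup>2) \<le> (2 * real (2 * n + 1) * K + 2 * K * suminf f) * ?p" for k
  proof -
    let ?H = "{k'\<in>{1..N}. \<bar>?t k' - ?t k\<bar> > 2 * int n}"
    let ?d = "\<lambda>k'. nat (\<bar>?t k' - ?t k\<bar> - 2 * int n)"
    have "(\<Sum>k'\<in>{1..N}. prob (hit C k \<inter> hit C k') - ?p\<^sup>2)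
       \<le> (\<Sum>k'\<in>{1..N}. (if \<bar>?t k' - ?t k\<bar> < int (2 * n + 1) then ?p else 0) + (if \<bar>?t k' - ?t k\<bar> > 2 * int n then f (?d k') * ?p else 0))"
    proof (rule sum_mono)
      fix k'
      show "prob (hit C k \<inter> hit C k') - ?p\<^sup>2 \<le> (if \<bar>?t k' - ?t k\<bar> < int (2 * n + 1) then ?p else 0) + (if \<bar>?t k' - ?t k\<bar> > 2 * int n then f (?d k') * ?p else 0)"
      proof (cases "\<bar>?t k' - ?t k\<bar> > 2 * int n")
        case True
        then have "prob (translate (?t k') -` C \<inter> translate (?t k) -` C) - ?p\<^sup>2 \<le> f (?d k') * ?p"
          by (rule phi_pair[OF phi C])
        then show ?thesis using True by (simp add: hit1 Int_commute)
      next
        case False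
        have "prob (hit C k \<inter> hit C k') \<le> prob (hit C k)" using Cm by (intro finite_measure_mono) auto
        moreover have "0 \<le> ?p\<^sup>2" by simp
        ultimately have "prob (hit C k \<inter> hit C k') - ?p\<^sup>2 \<le> ?p" unfolding ph by linarith
        then show ?thesis using False by simp
      qed
    qed
    also have "\<dots> = real (card ({1..N} \<inter> {k'. \<bar>?t k' - ?t k\<bar> < int (2 * n + 1)})) * ?p + (\<Sum>k'\<in>?H. f (?d k')) * ?p"
      by (simp add: sum.distrib sum.If_cases sum_distrib_right Int_def)
    also have "real (card ({1..N} \<inter> {k'. \<bar>?t k' - ?t k\<bar> < int (2 * n + 1)})) \<le> real (card {k'. \<bar>?t k' - ?t k\<bar> < int (2 * n + 1)})"
      by (intro of_nat_mono card_mono card_window_le(1)[of ?t K, OF c1]) simp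
    also have "\<dots> \<le> 2 * real (2 * n + 1) * K" by (rule card_window_le(2)[of ?t K, OF c1])
    also have "(\<Sum>k'\<in>?H. f (?d k')) \<le> 2 * K * suminf f"
    proof -
      \<comment> \<open>Grouped by the gap \<open>g\<close>: for given \<open>g\<close>,
        \<open>q 1 k'\<close> has two possible values, each taken at most \<open>K\<close>
        times.\<close>
      have "(\<Sum>k'\<in>?H. f (?d k')) = (\<Sum>g\<in>?d ` ?H. \<Sum>k'\<in>{x \<in> ?H. ?d x = g}. f (?d k'))"
        by (rule sum.image_gen) simp
      also have "\<dots> = (\<Sum>g\<in>?d ` ?H. real (card {x \<in> ?H. ?d x = g}) * f g)"
        by (intro sum.cong refl) simp
      also have "\<dots> \<le> (\<Sum>g\<in>?d ` ?H. (2 * K) * f g)"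
      proof (intro sum_mono mult_right_mono f_nonneg)
        fix g
        let ?z1 = "?t k + (2 * int n + int g)" and ?z2 = "?t k - (2 * int n + int g)"
        have "{x \<in> ?H. ?d x = g} \<subseteq> {k. ?t k = ?z1} \<union> {k. ?t k = ?z2}" by (auto simp: abs_if split: if_splits)
        then have "card {x \<in> ?H. ?d x = g} \<le> card ({k. ?t k = ?z1} \<union> {k. ?t k = ?z2})"
          using c1 by (intro card_mono) auto
        also have "\<dots> \<le> card {k. ?t k = ?z1} + card {k. ?t k = ?z2}" by (rule card_Un_le)
        finally show "real (card {x \<in> ?H. ?d x = g}) \<le> 2 * K" using c1[of ?z1] c1[of ?z2] by linarith
      qed
      also have "\<dots> = 2 * K * (\<Sum>g\<in>?d ` ?H. f g)" by (simp add: sum_distrib_left)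
      also have "\<dots> \<le> 2 * K * suminf f"
        using K_nonneg f_nonneg f_summable by (intro mult_left_mono sum_le_suminf) auto
      finally show ?thesis .
    qed
    finally show ?thesis by (simp add: algebra_simps mult_right_mono)
  qed
  have "prob (space P - (\<Union>k\<in>{1..N}. hit C k)) * (real (card {1..N}) * ?p)\<^sup>2
    \<le> (\<Sum>k\<in>{1..N}. \<Sum>k'\<in>{1..N}. prob (hit C k \<inter> hit C k')) - 2 * (real (card {1..N}) * ?p) * (\<Sum>k\<in>{1..N}. prob (hit C k)) + (real (card {1..N}) * ?p)\<^sup>2"
    by (rule second_moment) (use Cm in auto)
  also have "\<dots> = (\<Sum>k\<in>{1..N}. \<Sum>k'\<in>{1..N}. prob (hit C k \<inter> hit C k') - ?p\<^sup>2)"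
    by (simp add: ph sum_subtractf power2_eq_square algebra_simps)
  also have "\<dots> \<le> (\<Sum>k\<in>{1..N}. (2 * real (2 * n + 1) * K + 2 * K * suminf f) * ?p)" by (intro sum_mono row)
  also have "\<dots> = (2 * real (2 * n + 1) * K + 2 * K * suminf f) * (real N * ?p)" by simp
  also have "\<dots> \<le> ((4 * K + 2 * K * suminf f) * (real n + 1)) * (real N * ?p)"
  proof (rule mult_right_mono)
    have "0 \<le> K * suminf f * real n" using K_nonneg f_nonneg f_summable by (intro mult_nonneg_nonneg suminf_nonneg) auto
    then show "2 * real (2 * n + 1) * K + 2 * K * suminf f \<le> (4 * K + 2 * K * suminf f) * (real n + 1)"
      using K_nonneg by (simp add: algebra_simps)
  qed (use p in auto)
  finally have "prob (UNIV - (\<Union>k\<in>{1..N}. hit C k)) * (real N * ?p) * (real N * ?p) \<le> ((4 * K + 2 * K * suminf f) * (real n + 1)) * (real N * ?p)"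
    by (simp add: space_UNIV power2_eq_square ac_simps)
  then have "prob (UNIV - (\<Union>k\<in>{1..N}. hit C k)) * (real N * ?p) \<le> (4 * K + 2 * K * suminf f) * (real n + 1)"
    using p N by (subst (asm) mult_le_cancel_right_pos) auto
  then show ?thesis using p N by (subst pos_le_divide_eq) auto
qed

text \<open>Only indices whose windows are at least \<open>n\<close> apart are kept. Their hitting
  probabilities agree with the centre \<open>prob C ^ l\<close> up to factors
  \<open>(1 \<plusminus> f n) ^ l\<close>, so far pairs cost a relative error of order
  \<open>f n\<close>; the \<open>O(n)\<close> near partners of each index give the second
  term.\<close>

lemma prob_not_hit_multiple:
  assumes l1: "l > 1" and C: "C \<in> coord_sigma {- int n..int n}" and p: "prob C > 0" and n: "n \<ge> 1" and fn: "f n \<le> 1"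
    and N: "real N \<ge> 12 * (real l)\<^sup>2 * real n * K" "N \<ge> 1"
  shows "prob (UNIV - (\<Union>k\<in>{1..N}. hit C k)) \<le> (4 ^ l + 2 * real l) * f n + 12 * (real l)\<^sup>2 * K * 2 ^ l * real n / (real N * prob C ^ l)"
proof -
  have Cm: "C \<in> sets P" using C coord_sigma_sets by blast
  let ?W = "2 * n + n" and ?b = "prob C ^ l" and ?c = "6 * (real l)\<^sup>2 * real n * K"
  define G where "G = {k\<in>{1..N}. separated ?W k}"
  have finG: "finite G" by (simp add: G_def)
  have b: "?b > 0" using p by simp
  note ps = psi[OF l1]
  \<comment> \<open>At most \<open>2 l^2 (3 n) K\<close> indices are discarded, which is at most
    \<open>N / 2\<close>; this is the origin of the constant 12 in the hypothesis on
    \<open>N\<close>.\<close>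
  have Gcard: "real (card G) \<ge> real N / 2"
  proof -
    have "real N = real (card {1..N})" by simp
    also have "\<dots> \<le> real (card (G \<union> {k. \<not> separated ?W k}))"
      using not_separated_card(1) finG by (intro of_nat_mono card_mono) (auto simp: G_def)
    also have "\<dots> \<le> real (card G) + real (card {k. \<not> separated ?W k})" using card_Un_le by (simp flip: of_nat_add)
    also have "real (card {k. \<not> separated ?W k}) \<le> 2 * (real l)\<^sup>2 * real ?W * K" by (rule not_separated_card(2))
    also have "\<dots> \<le> real N / 2" using N by (simp add: algebra_simps)
    finally show ?thesis by simp
  qed
  then have Gpos: "real (card G) > 0" using N(2) by simp
  have up: "prob (hit C k) \<le> ((1 + f n) * prob C) ^ l" if "k \<in> G" for k
    using prob_hit_separated(1)[OF ps n C] that by (simp add: G_def)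
  have lo: "((1 - f n) * prob C) ^ l \<le> prob (hit C k)" if "k \<in> G" for k
    using prob_hit_separated(2)[OF ps n C _ fn] that by (simp add: G_def)
  have u0: "((1 + f n) * prob C) ^ l \<le> 2 ^ l * ?b"
    unfolding power_mult_distrib using fn f_nonneg[of n] by (intro mult_right_mono power_mono) auto
  have row: "(\<Sum>k'\<in>G. prob (hit C k \<inter> hit C k')) \<le> real (card G) * ((1 + f n) * prob C) ^ (2 * l) + ?c * (2 ^ l * ?b)"
    if k: "k \<in> G" for k
  proof -
    have "(\<Sum>k'\<in>G. prob (hit C k \<inter> hit C k')) \<le> (\<Sum>k'\<in>G. ((1 + f n) * prob C) ^ (2 * l) + (if k' \<in> near ?W k then 2 ^ l * ?b else 0))"
    proof (rule sum_mono)
      fix k' assume k': "k' \<in> G"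
      show "prob (hit C k \<inter> hit C k') \<le> ((1 + f n) * prob C) ^ (2 * l) + (if k' \<in> near ?W k then 2 ^ l * ?b else 0)"
      proof (cases "k' \<in> near ?W k")
        case False
        then show ?thesis using prob_hit_far[OF ps n C _ _ False] k k' by (simp add: G_def)
      next
        case True
        have "prob (hit C k \<inter> hit C k') \<le> prob (hit C k)" using Cm by (intro finite_measure_mono) auto
        also have "\<dots> \<le> 2 ^ l * ?b" using up[OF k] u0 by linarith
        finally show ?thesis using True f_nonneg[of n] by (simp add: add_increasing)
      qed
    qed
    also have "\<dots> = real (card G) * ((1 + f n) * prob C) ^ (2 * l) + real (card (G \<inter> near ?W k)) * (2 ^ l * ?b)"
      using finG by (simp add: sum.distrib sum.If_cases)
    also have "\<dots> \<le> real (card G) * ((1 + f n) * prob C) ^ (2 * l) + ?c * (2 ^ l * ?b)"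
    proof (intro add_left_mono mult_right_mono)
      have "real (card (G \<inter> near ?W k)) \<le> real (card (near ?W k))" using near_card(1) by (intro of_nat_mono card_mono) auto
      also have "\<dots> \<le> ?c" using near_card(2)[of ?W k] by (simp add: algebra_simps)
      finally show "real (card (G \<inter> near ?W k)) \<le> ?c" .
    qed simp
    finally show ?thesis .
  qed
  have e1: "((1 + f n) * prob C) ^ (2 * l) = (1 + f n) ^ (2 * l) * (prob C ^ l)\<^sup>2"
    by (simp only: power_mult_distrib mult.commute[of 2 l] power_mult)
  have e2: "((1 - f n) * prob C) ^ l = (1 - f n) ^ l * prob C ^ l" by (rule power_mult_distrib)
  let ?g = "real (card G)" and ?r = "4 ^ l + 2 * real l"
  have "prob (space P - (\<Union>k\<in>G. hit C k)) * (?g * ?b)\<^sup>2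
    \<le> (\<Sum>k\<in>G. \<Sum>k'\<in>G. prob (hit C k \<inter> hit C k')) - 2 * (?g * ?b) * (\<Sum>k\<in>G. prob (hit C k)) + (?g * ?b)\<^sup>2"
    by (rule second_moment[OF finG]) (use Cm in auto)
  also have "\<dots> \<le> ?g * (?g * ((1 + f n) * prob C) ^ (2 * l) + ?c * (2 ^ l * ?b)) - 2 * (?g * ?b) * (?g * ((1 - f n) * prob C) ^ l) + (?g * ?b)\<^sup>2"
  proof (intro add_right_mono diff_mono mult_left_mono)
    show "(\<Sum>k\<in>G. \<Sum>k'\<in>G. prob (hit C k \<inter> hit C k')) \<le> ?g * (?g * ((1 + f n) * prob C) ^ (2 * l) + ?c * (2 ^ l * ?b))"
      using sum_mono[OF row] by simp
    show "?g * ((1 - f n) * prob C) ^ l \<le> (\<Sum>k\<in>G. prob (hit C k))"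
      using sum_mono[of G "\<lambda>_. ((1 - f n) * prob C) ^ l", OF lo] by simp
  qed (use b in auto)
  also have "\<dots> = (?g * ?b)\<^sup>2 * ((1 + f n) ^ (2 * l) - 2 * (1 - f n) ^ l + 1) + ?g * ?b * (?c * 2 ^ l)"
    unfolding e1 e2 by (simp add: power2_eq_square algebra_simps)
  also have "\<dots> \<le> (?g * ?b)\<^sup>2 * (?r * f n) + ?g * ?b * (?c * 2 ^ l)"
  proof (intro add_right_mono mult_left_mono)
    \<comment> \<open>The constant terms \<open>1 - 2 + 1\<close> cancel; the chord bound and
      Bernoulli's inequality leave a multiple of \<open>f n\<close>.\<close>
    have "(1 + f n) ^ (2 * l) \<le> 1 + (2 ^ (2 * l) - 1) * f n" by (rule one_plus_power_le[OF f_nonneg fn])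
    moreover have "1 + real l * (- f n) \<le> (1 + - f n) ^ l" using fn by (intro Bernoulli_inequality) simp
    moreover have "(2::real) ^ (2 * l) = 4 ^ l" by (simp add: power_mult)
    ultimately have "(1 + f n) ^ (2 * l) - 2 * (1 - f n) ^ l + 1 \<le> (4 ^ l - 1 + 2 * real l) * f n"
      by (simp add: algebra_simps)
    also have "\<dots> \<le> ?r * f n" using f_nonneg by (intro mult_right_mono) auto
    finally show "(1 + f n) ^ (2 * l) - 2 * (1 - f n) ^ l + 1 \<le> ?r * f n" .
  qed simp
  finally have main: "prob (space P - (\<Union>k\<in>G. hit C k)) * (?g * ?b)\<^sup>2 \<le> (?g * ?b)\<^sup>2 * (?r * f n) + ?g * ?b * (?c * 2 ^ l)" .
  have gb: "?g * ?b > 0" using Gpos b by simp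
  have "prob (space P - (\<Union>k\<in>G. hit C k)) \<le> ((?g * ?b)\<^sup>2 * (?r * f n) + ?g * ?b * (?c * 2 ^ l)) / (?g * ?b)\<^sup>2"
    using main zero_less_power[OF gb, of 2] by (simp only: pos_le_divide_eq)
  also have "\<dots> = ?r * f n + ?c * 2 ^ l / (?g * ?b)"
  proof -
    have "(u\<^sup>2 * v + u * w) / u\<^sup>2 = v + w / u" if "u > 0" for u v w :: real
      using that by (simp add: add_divide_distrib power2_eq_square)
    from this[OF gb] show ?thesis .
  qed
  also have "?c * 2 ^ l / (?g * ?b) \<le> ?c * 2 ^ l / (real N / 2 * ?b)"
    using Gcard b N K_nonneg by (intro divide_left_mono mult_right_mono mult_nonneg_nonneg mult_pos_pos) (use Gpos in auto)
  also have "\<dots> = 12 * (real l)\<^sup>2 * K * 2 ^ l * real n / (real N * ?b)" by (simp add: field_simps)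
  finally have "prob (space P - (\<Union>k\<in>G. hit C k)) \<le> ?r * f n + 12 * (real l)\<^sup>2 * K * 2 ^ l * real n / (real N * ?b)" by simp
  moreover have "prob (UNIV - (\<Union>k\<in>{1..N}. hit C k)) \<le> prob (space P - (\<Union>k\<in>G. hit C k))"
    using Cm finG by (intro finite_measure_mono sets.Diff sets.top sets.finite_UN) (auto simp: G_def space_UNIV)
  ultimately show ?thesis by linarith
qed

text \<open>One constant \<open>A\<close> covers \<open>l = 1\<close> and \<open>l > 1\<close>, so
  the almost sure argument need not distinguish them.\<close>

lemma prob_not_hit:
  obtains A where "A \<ge> 0"
    "\<forall>\<^sub>F n in sequentially. \<forall>C N. C \<in> coord_sigma {- int n..int n} \<longrightarrow> prob C > 0 \<longrightarrow> N \<ge> 1 \<longrightarrow> real N \<ge> A * (real n + 1) \<longrightarrow>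
      prob (UNIV - (\<Union>k\<in>{1..N}. hit C k)) \<le> A * f n + A * (real n + 1) / (real N * prob C ^ l)"
proof (cases "l > 1")
  case False
  then have l1: "l = 1" using l by simp
  define A where "A = 4 * K + 2 * K * suminf f"
  have A: "A \<ge> 0" using K_nonneg f_nonneg f_summable by (auto simp: A_def intro!: add_nonneg_nonneg mult_nonneg_nonneg suminf_nonneg)
  show thesis
  proof (rule that[OF A], intro always_eventually allI impI)
    fix n C N assume "C \<in> coord_sigma {- int n..int n}" "prob C > 0" "N \<ge> (1::nat)"
    then have "prob (UNIV - (\<Union>k\<in>{1..N}. hit C k)) \<le> A * (real n + 1) / (real N * prob C)"
      unfolding A_def by (rule prob_not_hit_single[OF l1])
    moreover have "0 \<le> A * f n" using A f_nonneg by simp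
    ultimately show "prob (UNIV - (\<Union>k\<in>{1..N}. hit C k)) \<le> A * f n + A * (real n + 1) / (real N * prob C ^ l)"
      by (simp add: l1)
  qed
next
  case True
  define B where "B = 12 * (real l)\<^sup>2 * K * 2 ^ l"
  define A where "A = (4 ^ l + 2 * real l) + B"
  have B: "B \<ge> 0" "12 * (real l)\<^sup>2 * K \<le> B" using K_nonneg mult_left_mono[of 1 "2 ^ l" "12 * (real l)\<^sup>2 * K"] by (auto simp: B_def)
  have A: "A \<ge> 0" "A \<ge> B" "A \<ge> 4 ^ l + 2 * real l" using B by (auto simp: A_def)
  have "f \<longlonglongrightarrow> 0" by (rule summable_LIMSEQ_zero[OF f_summable])
  then have "\<forall>\<^sub>F n in sequentially. f n < 1" by (rule order_tendstoD) simp
  then have "\<forall>\<^sub>F n in sequentially. \<forall>C N. C \<in> coord_sigma {- int n..int n} \<longrightarrow> prob C > 0 \<longrightarrow> N \<ge> 1 \<longrightarrow> real N \<ge> A * (real n + 1) \<longrightarrow>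
      prob (UNIV - (\<Union>k\<in>{1..N}. hit C k)) \<le> A * f n + A * (real n + 1) / (real N * prob C ^ l)"
    using eventually_ge_at_top[of 1]
  proof eventually_elim
    case (elim n)
    show ?case
    proof (intro allI impI)
      fix C N assume C: "C \<in> coord_sigma {- int n..int n}" "prob C > 0" "N \<ge> (1::nat)" "real N \<ge> A * (real n + 1)"
      have "12 * (real l)\<^sup>2 * real n * K = 12 * (real l)\<^sup>2 * K * real n" by simp
      also have "\<dots> \<le> A * (real n + 1)" using A B by (intro mult_mono) auto
      finally have N: "real N \<ge> 12 * (real l)\<^sup>2 * real n * K" using C(4) by linarith
      have "prob (UNIV - (\<Union>k\<in>{1..N}. hit C k)) \<le> (4 ^ l + 2 * real l) * f n + B * real n / (real N * prob C ^ l)"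
        unfolding B_def using prob_not_hit_multiple[OF True C(1,2) elim(2) less_imp_le[OF elim(1)] N C(3)] .
      also have "\<dots> \<le> A * f n + A * (real n + 1) / (real N * prob C ^ l)"
        using A B f_nonneg[of n] C by (intro add_mono mult_right_mono divide_right_mono mult_mono) auto
      finally show "prob (UNIV - (\<Union>k\<in>{1..N}. hit C k)) \<le> A * f n + A * (real n + 1) / (real N * prob C ^ l)" .
    qed
  qed
  then show thesis using that A(1) by blast
qed

end

section \<open>Hitting times\<close>

lemma summable_linear_exp:
  fixes c :: real
  assumes "c > 0"
  shows "summable (\<lambda>n. (real n + 1) * exp (- (c * real n)))"
proof (rule summable_comparison_test_ev)
  have "\<forall>\<^sub>F n in sequentially. (real n + 1) * exp (- (c * real n)) \<le> exp (- (c / 2 * real n))"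
    using assms by real_asymp
  then show "\<forall>\<^sub>F n in sequentially. norm ((real n + 1) * exp (- (c * real n))) \<le> exp (- (c / 2 * real n))"
    by eventually_elim simp
  have "summable (\<lambda>n. exp (- (c / 2)) ^ n)" using assms by (intro summable_geometric) auto
  then show "summable (\<lambda>n. exp (- (c / 2 * real n)))"
    by (simp add: exp_of_nat_mult[symmetric] mult.commute)
qed

lemma nat_floor_bounds:
  fixes x :: real
  assumes "x \<ge> 1"
  shows "nat \<lfloor>x\<rfloor> \<ge> 1" "real (nat \<lfloor>x\<rfloor>) \<le> x" "x / 2 \<le> real (nat \<lfloor>x\<rfloor>)" "x < real (nat \<lfloor>x\<rfloor>) + 1"
proof -
  have f: "\<lfloor>x\<rfloor> \<ge> 1" using assms by (simp add: le_floor_iff)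
  then have e: "real (nat \<lfloor>x\<rfloor>) = of_int \<lfloor>x\<rfloor>" by simp
  have g: "of_int \<lfloor>x\<rfloor> \<le> x" "x < of_int \<lfloor>x\<rfloor> + 1" by linarith+
  have "real_of_int \<lfloor>x\<rfloor> \<ge> 1" using f by simp
  with f e g show "nat \<lfloor>x\<rfloor> \<ge> 1" "real (nat \<lfloor>x\<rfloor>) \<le> x" "x / 2 \<le> real (nat \<lfloor>x\<rfloor>)" "x < real (nat \<lfloor>x\<rfloor>) + 1"
    by linarith+
qed

text \<open>Written as an infimum over \<open>k\<close>, the logarithm of a hitting time is visibly
  measurable and easy to compare with \<open>ln N\<close>; the value \<infinity> without a hit is
  built in. The restriction \<open>1 \<le> k\<close> keeps \<open>ln\<close> monotone.\<close>

lemma ln_enat_Inf: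
  "ln_enat (Inf (enat ` {k. 1 \<le> k \<and> R k})) = (INF k. if 1 \<le> k \<and> R k then ereal (ln (real k)) else \<infinity>)"
proof (cases "\<exists>k. 1 \<le> k \<and> R k")
  case False
  then have e: "enat ` {k. 1 \<le> k \<and> R k} = {}" by auto
  have i: "(if 1 \<le> k \<and> R k then ereal (ln (real k)) else \<infinity>) = \<infinity>" for k using False by auto
  show ?thesis unfolding e i by (simp add: ln_enat_def top_enat_def)
next
  case True
  then obtain k0 where k0: "1 \<le> k0 \<and> R k0" by blast
  define m where "m = (LEAST k. 1 \<le> k \<and> R k)"
  have m: "1 \<le> m \<and> R m" unfolding m_def using k0 by (rule LeastI[where P = "\<lambda>k. 1 \<le> k \<and> R k"])
  have le: "m \<le> k" if "1 \<le> k \<and> R k" for k unfolding m_def using that by (rule Least_le[where P = "\<lambda>k. 1 \<le> k \<and> R k"])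
  have "Inf (enat ` {k. 1 \<le> k \<and> R k}) = enat m"
    using m le by (intro antisym Inf_lower Inf_greatest) auto
  moreover have "(INF k. if 1 \<le> k \<and> R k then ereal (ln (real k)) else \<infinity>) = ereal (ln (real m))"
  proof (rule antisym)
    show "(INF k. if 1 \<le> k \<and> R k then ereal (ln (real k)) else \<infinity>) \<le> ereal (ln (real m))"
      by (rule INF_lower2[of m]) (use m in auto)
    show "ereal (ln (real m)) \<le> (INF k. if 1 \<le> k \<and> R k then ereal (ln (real k)) else \<infinity>)"
    proof (rule INF_greatest)
      fix k
      show "ereal (ln (real m)) \<le> (if 1 \<le> k \<and> R k then ereal (ln (real k)) else \<infinity>)"
        using le[of k] m by auto
    qed
  qed
  ultimately show ?thesis by (simp add: ln_enat_def)
qed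

lemma prod_indicator_eq_1:
  "finite I \<Longrightarrow> (\<Prod>i\<in>I. indicator C (x i) :: real) = 1 \<longleftrightarrow> (\<forall>i\<in>I. x i \<in> C)"
proof -
  assume "finite I"
  then have "(\<Prod>i\<in>I. indicator C (x i) :: real) = (if \<forall>i\<in>I. x i \<in> C then 1 else 0)"
    by (induction I rule: finite_induct) (auto simp: indicator_def)
  then show ?thesis by simp
qed

text \<open>The sandwich with error 1 makes \<open>X n\<close> finite for large \<open>n\<close>;
  from there on the limit is one of real numbers.\<close>

lemma ereal_ratio_tendsto:
  fixes X :: "nat \<Rightarrow> ereal"
  assumes "\<And>e. e > 0 \<Longrightarrow> \<forall>\<^sub>F n in sequentially. ereal (real n * (L - e)) \<le> X n \<and> X n \<le> ereal (real n * (L + e))"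
  shows "(\<lambda>n. X n / ereal (real n)) \<longlonglongrightarrow> ereal L"
proof -
  define r where "r n = real_of_ereal (X n)" for n
  have rX: "\<forall>\<^sub>F n in sequentially. X n = ereal (r n)"
    using assms[OF zero_less_one]
  proof eventually_elim
    case (elim n)
    then show ?case unfolding r_def by (cases "X n") auto
  qed
  have "(\<lambda>n. r n / real n) \<longlonglongrightarrow> L"
  proof (rule LIMSEQ_I)
    fix e :: real assume e: "e > 0"
    then have e2: "e / 2 > 0" by simp
    have "\<forall>\<^sub>F n in sequentially. norm (r n / real n - L) < e"
      using assms[OF e2] rX eventually_gt_at_top[of 0]
    proof eventually_elim
      case (elim n)
      then have "real n * (L - e / 2) \<le> r n" "r n \<le> real n * (L + e / 2)" by auto
      then have "L - e / 2 \<le> r n / real n" "r n / real n \<le> L + e / 2" using elim(3)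
        by (simp_all add: field_simps)
      then show ?case using e by (auto simp: abs_less_iff)
    qed
    then show "\<exists>no. \<forall>n\<ge>no. norm (r n / real n - L) < e" by (simp add: eventually_sequentially)
  qed
  then have "(\<lambda>n. ereal (r n / real n)) \<longlonglongrightarrow> ereal L" by simp
  moreover have "\<forall>\<^sub>F n in sequentially. ereal (r n / real n) = X n / ereal (real n)"
    using rX eventually_gt_at_top[of 0] by eventually_elim simp
  ultimately show ?thesis by (rule Lim_transform_eventually)
qed

lemma pred_eq_countable:
  fixes u v :: "'b \<Rightarrow> 'c :: countable"
  assumes u: "u \<in> measurable M (count_space UNIV)" and v: "v \<in> measurable M (count_space UNIV)"
  shows "Measurable.pred M (\<lambda>x. u x = v x)"
proof -
  note [measurable] = u
  have "(\<lambda>x. (\<lambda>i x. u x = i) (v x) x) \<in> measurable M (count_space UNIV)"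
    by (rule measurable_compose_countable[OF _ v]) measurable
  then show ?thesis by simp
qed

section \<open>From dependence coefficients to real-valued mixing bounds\<close>

context invariant_seq
begin

lemma cyl_coord_sigma:
  fixes \<omega>' :: "int \<Rightarrow> 'a"
  shows "cyl n \<omega>' \<in> coord_sigma {- int n..int n}"
proof -
  interpret A: sigma_algebra UNIV "coord_sigma {- int n..int n} :: (int \<Rightarrow> 'a) set set" by (rule sigma_algebra_coord_sigma)
  have "{\<omega>. \<omega> i \<in> {\<omega>' i}} \<in> (coord_sigma {- int n..int n} :: (int \<Rightarrow> 'a) set set)" if "i \<in> {- int n..int n}" for i
    unfolding coord_sigma_def using that by (intro sigma_sets.Basic) blast
  then have "UNIV - (\<Union>i\<in>{- int n..int n}. UNIV - {\<omega>. \<omega> i \<in> {\<omega>' i}}) \<in> coord_sigma {- int n..int n}"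
    by (intro A.compl_sets A.finite_UN) auto
  also have "UNIV - (\<Union>i\<in>{- int n..int n}. UNIV - {\<omega>. \<omega> i \<in> {\<omega>' i}}) = cyl n \<omega>'"
  proof -
    have j: "j \<in> {- int n..int n} \<longleftrightarrow> \<bar>j\<bar> \<le> int n" for j by auto
    show ?thesis unfolding cyl_def UN_iff j set_eq_iff by (simp add: j Bex_def del: atLeastAtMost_iff)
  qed
  finally show ?thesis .
qed

lemma psi_imp_phi_bound:
  assumes f: "psi_bound f" shows "phi_bound f"
  unfolding phi_bound_def
proof (intro conjI allI impI)
  show f0: "0 \<le> f k" for k using f by (simp add: psi_bound_def)
  fix k m and \<Gamma> \<Delta> :: "(int \<Rightarrow> 'a) set"
  assume "1 \<le> k" "\<Gamma> \<in> coord_sigma {..m}" "\<Delta> \<in> coord_sigma {m + int k..}"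
  then have "\<bar>prob (\<Gamma> \<inter> \<Delta>) - prob \<Gamma> * prob \<Delta>\<bar> \<le> f k * (prob \<Gamma> * prob \<Delta>)"
    using f unfolding psi_bound_def by blast
  also have "\<dots> \<le> f k * (prob \<Gamma> * 1)" using f0 by (intro mult_left_mono) auto
  finally show "\<bar>prob (\<Gamma> \<inter> \<Delta>) - prob \<Gamma> * prob \<Delta>\<bar> \<le> f k * prob \<Gamma>" by simp
qed

text \<open>A finite series has finite terms, so \<open>enn2real\<close> loses nothing at indices
  from 1 on. Index 0 lies outside the series; \<open>phi_bound\<close> starts at 1, and one term
  does not affect summability. Null events, absent from the supremum, are treated directly.\<close>

lemma phi_mix_bound:
  assumes fin: "(\<Sum>n. phi_mix P (Suc n)) < \<infinity>"
  shows "phi_bound (\<lambda>k. enn2real (phi_mix P k))" "summable (\<lambda>k. enn2real (phi_mix P k))"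
proof -
  have lt: "phi_mix P k < \<infinity>" if "k \<ge> 1" for k
    using ennreal_suminf_lessD[OF fin, of "k - 1"] that by simp
  have "(\<Sum>n. ennreal (enn2real (phi_mix P (Suc n)))) \<noteq> top" using fin lt by (simp add: ennreal_enn2real less_top)
  then show "summable (\<lambda>k. enn2real (phi_mix P k))"
    by (subst summable_Suc_iff[symmetric]) (intro summable_suminf_not_top, auto)
  show "phi_bound (\<lambda>k. enn2real (phi_mix P k))"
    unfolding phi_bound_def
  proof (intro conjI allI impI)
    fix k m and \<Gamma> \<Delta> :: "(int \<Rightarrow> 'a) set" assume k: "1 \<le> k" and G: "\<Gamma> \<in> coord_sigma {..m}" and D: "\<Delta> \<in> coord_sigma {m + int k..}"
    have Gm: "\<Gamma> \<in> sets P" "\<Delta> \<in> sets P" using G D coord_sigma_sets by blast+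
    show "\<bar>prob (\<Gamma> \<inter> \<Delta>) - prob \<Gamma> * prob \<Delta>\<bar> \<le> enn2real (phi_mix P k) * prob \<Gamma>"
    proof (cases "prob \<Gamma> = 0")
      case True
      have "prob (\<Gamma> \<inter> \<Delta>) \<le> prob \<Gamma>" using Gm by (intro finite_measure_mono) auto
      then show ?thesis using True measure_nonneg[of P "\<Gamma> \<inter> \<Delta>"] by simp
    next
      case False
      have "ennreal \<bar>prob (\<Gamma> \<inter> \<Delta>) / prob \<Gamma> - prob \<Delta>\<bar> \<le> phi_dep P (coord_sigma {..m}) (coord_sigma {m + int k..})"
        unfolding phi_dep_def using G D False by (intro SUP_upper2[of "(\<Gamma>, \<Delta>)"]) auto
      also have "\<dots> \<le> phi_mix P k" unfolding phi_mix_def by (rule SUP_upper) simp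
      also have "\<dots> = ennreal (enn2real (phi_mix P k))" using lt[OF k] by simp
      finally have "\<bar>prob (\<Gamma> \<inter> \<Delta>) / prob \<Gamma> - prob \<Delta>\<bar> \<le> enn2real (phi_mix P k)" by (subst (asm) ennreal_le_iff) auto
      then have "\<bar>prob (\<Gamma> \<inter> \<Delta>) / prob \<Gamma> - prob \<Delta>\<bar> * prob \<Gamma> \<le> enn2real (phi_mix P k) * prob \<Gamma>" by (intro mult_right_mono) auto
      moreover have "\<bar>prob (\<Gamma> \<inter> \<Delta>) / prob \<Gamma> - prob \<Delta>\<bar> * prob \<Gamma> = \<bar>(prob (\<Gamma> \<inter> \<Delta>) / prob \<Gamma> - prob \<Delta>) * prob \<Gamma>\<bar>" by (simp add: abs_mult)
      moreover have "(prob (\<Gamma> \<inter> \<Delta>) / prob \<Gamma> - prob \<Delta>) * prob \<Gamma> = prob (\<Gamma> \<inter> \<Delta>) - prob \<Gamma> * prob \<Delta>" using False by (simp add: field_simps)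
      ultimately show ?thesis by simp
    qed
  qed simp
qed

text \<open>As for phi. Here \<open>psi_mix P 0\<close> may be infinite, in which case
  \<open>enn2real\<close> replaces it by 0.\<close>

lemma psi_mix_bound:
  assumes fin: "(\<Sum>n. psi_mix P (Suc n)) < \<infinity>"
  shows "psi_bound (\<lambda>k. enn2real (psi_mix P k))" "summable (\<lambda>k. enn2real (psi_mix P k))"
proof -
  have lt: "psi_mix P k < \<infinity>" if "k \<ge> 1" for k
    using ennreal_suminf_lessD[OF fin, of "k - 1"] that by simp
  have "(\<Sum>n. ennreal (enn2real (psi_mix P (Suc n)))) \<noteq> top" using fin lt by (simp add: ennreal_enn2real less_top)
  then show "summable (\<lambda>k. enn2real (psi_mix P k))"
    by (subst summable_Suc_iff[symmetric]) (intro summable_suminf_not_top, auto)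
  show "psi_bound (\<lambda>k. enn2real (psi_mix P k))"
    unfolding psi_bound_def
  proof (intro conjI allI impI)
    fix k m and \<Gamma> \<Delta> :: "(int \<Rightarrow> 'a) set" assume k: "1 \<le> k" and G: "\<Gamma> \<in> coord_sigma {..m}" and D: "\<Delta> \<in> coord_sigma {m + int k..}"
    have Gm: "\<Gamma> \<in> sets P" "\<Delta> \<in> sets P" using G D coord_sigma_sets by blast+
    let ?pp = "prob \<Gamma> * prob \<Delta>"
    show "\<bar>prob (\<Gamma> \<inter> \<Delta>) - ?pp\<bar> \<le> enn2real (psi_mix P k) * ?pp"
    proof (cases "?pp = 0")
      case True
      have "prob (\<Gamma> \<inter> \<Delta>) \<le> prob \<Gamma>" "prob (\<Gamma> \<inter> \<Delta>) \<le> prob \<Delta>" using Gm by (auto intro!: finite_measure_mono)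
      then show ?thesis using True measure_nonneg[of P "\<Gamma> \<inter> \<Delta>"] by auto
    next
      case False
      have "ennreal \<bar>prob (\<Gamma> \<inter> \<Delta>) / ?pp - 1\<bar> \<le> psi_dep P (coord_sigma {..m}) (coord_sigma {m + int k..})"
        unfolding psi_dep_def using G D False by (intro SUP_upper2[of "(\<Gamma>, \<Delta>)"]) auto
      also have "\<dots> \<le> psi_mix P k" unfolding psi_mix_def by (rule SUP_upper) simp
      also have "\<dots> = ennreal (enn2real (psi_mix P k))" using lt[OF k] by simp
      finally have "\<bar>prob (\<Gamma> \<inter> \<Delta>) / ?pp - 1\<bar> \<le> enn2real (psi_mix P k)" by (subst (asm) ennreal_le_iff) auto
      then have "\<bar>prob (\<Gamma> \<inter> \<Delta>) / ?pp - 1\<bar> * ?pp \<le> enn2real (psi_mix P k) * ?pp" by (intro mult_right_mono) auto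
      moreover have "\<bar>prob (\<Gamma> \<inter> \<Delta>) / ?pp - 1\<bar> * ?pp = \<bar>(prob (\<Gamma> \<inter> \<Delta>) / ?pp - 1) * ?pp\<bar>" by (simp add: abs_mult)
      moreover have "(prob (\<Gamma> \<inter> \<Delta>) / ?pp - 1) * ?pp = prob (\<Gamma> \<inter> \<Delta>) - ?pp" using False by (simp add: field_simps)
      ultimately show ?thesis by simp
    qed
  qed simp
qed

end

section \<open>Almost sure bounds for hitting the cylinders around a fixed typical point\<close>

context hitting
begin

lemma ln_hitting_time:
  "ln_enat (hitting_time l q C \<omega>) = (INF k. if 1 \<le> k \<and> \<omega> \<in> hit C k then ereal (ln (real k)) else \<infinity>)"
proof -
  have "(\<Prod>i=1..l. indicator C ((shift ^^ q i k) \<omega>) :: real) = 1 \<longleftrightarrow> \<omega> \<in> hit C k" for k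
    by (subst prod_indicator_eq_1) (auto simp: hit_def shift_pow)
  then show ?thesis unfolding hitting_time_def by (simp only: ln_enat_Inf)
qed

lemma ln_hitting_time_le:
  assumes "\<omega> \<in> (\<Union>k\<in>{1..N}. hit C k)"
  shows "ln_enat (hitting_time l q C \<omega>) \<le> ereal (ln (real N))"
proof -
  obtain k where "1 \<le> k" "k \<le> N" "\<omega> \<in> hit C k" using assms by auto
  then show ?thesis unfolding ln_hitting_time by (intro INF_lower2[of k]) auto
qed

lemma ln_hitting_time_ge:
  assumes "\<omega> \<notin> (\<Union>k\<in>{1..N}. hit C k)" "0 < x" "x \<le> real N + 1"
  shows "ereal (ln x) \<le> ln_enat (hitting_time l q C \<omega>)"
  unfolding ln_hitting_time
proof (rule INF_greatest)
  fix k
  show "ereal (ln x) \<le> (if 1 \<le> k \<and> \<omega> \<in> hit C k then ereal (ln (real k)) else \<infinity>)"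
  proof (cases "1 \<le> k \<and> \<omega> \<in> hit C k")
    case True
    then have "\<not> k \<le> N" using assms(1) by auto
    then have "real N + 1 \<le> real k" by simp
    then have "x \<le> real k" using assms(3) by linarith
    then show ?thesis using True assms(2) by simp
  qed auto
qed

lemma ln_hitting_time_nonneg:
  fixes \<omega> :: "int \<Rightarrow> 'a"
  shows "0 \<le> ln_enat (hitting_time l q C \<omega>)"
  unfolding ln_hitting_time by (rule INF_greatest) (auto simp: zero_ereal_def)

text \<open>Take \<open>N\<close> near \<open>exp (n (2 l h + \<epsilon>))\<close>. The lower bound
  for \<open>P(C)\<close> gives \<open>N P(C)^l \<ge> exp (n \<epsilon> / 2) / 2\<close>, where
  rounding costs the factor 2. The probabilities of not hitting are then bounded by multiples of
  \<open>f n\<close> and \<open>n exp (- n \<epsilon> / 2)\<close>, up to shifts of \<open>n\<close>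
  by 1.\<close>

lemma hitting_upper:
  assumes h: "h \<ge> 0" and pos: "\<And>n. prob (cyl n \<omega>') > 0"
    and smb: "\<And>e. e > 0 \<Longrightarrow> \<forall>\<^sub>F n in sequentially. - ln (prob (cyl n \<omega>')) \<le> real n * (2 * h + e)"
    and \<epsilon>: "\<epsilon> > 0"
  shows "AE \<omega> in P. \<forall>\<^sub>F n in sequentially. ln_enat (hitting_time l q (cyl n \<omega>') \<omega>) \<le> ereal (real n * (2 * real l * h + \<epsilon>))"
proof -
  let ?x = "\<lambda>n. exp (real n * (2 * real l * h + \<epsilon>))"
  let ?N = "\<lambda>n. nat \<lfloor>?x n\<rfloor>"
  let ?D = "\<lambda>n. UNIV - (\<Union>k\<in>{1..?N n}. hit (cyl n \<omega>') k)"
  have l0: "real l > 0" using l by simp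
  have x1: "?x n \<ge> 1" for n using h \<epsilon> by simp
  obtain A where A: "A \<ge> 0" and ev: "\<forall>\<^sub>F n in sequentially. \<forall>C N. C \<in> coord_sigma {- int n..int n} \<longrightarrow> prob C > 0 \<longrightarrow> N \<ge> 1 \<longrightarrow> real N \<ge> A * (real n + 1) \<longrightarrow>
      prob (UNIV - (\<Union>k\<in>{1..N}. hit C k)) \<le> A * f n + A * (real n + 1) / (real N * prob C ^ l)"
    by (rule prob_not_hit)
  \<comment> \<open>After raising to the power \<open>l\<close> this error becomes
    \<open>\<epsilon> / 2\<close>, half of the margin in \<open>N\<close>.\<close>
  have "\<epsilon> / (2 * real l) > 0" using \<epsilon> l0 by simp
  from smb[OF this] have smb': "\<forall>\<^sub>F n in sequentially. - ln (prob (cyl n \<omega>')) \<le> real n * (2 * h + \<epsilon> / (2 * real l))" .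
  have "\<forall>\<^sub>F n in sequentially. A * (real n + 1) \<le> exp (real n * \<epsilon>) / 2" using \<epsilon> by real_asymp
  with ev smb' have bound: "\<forall>\<^sub>F n in sequentially. norm (prob (?D n)) \<le> A * f n + (2 * A) * ((real n + 1) * exp (- (\<epsilon> / 2 * real n)))"
  proof eventually_elim
    case (elim n)
    let ?p = "prob (cyl n \<omega>')"
    have N: "1 \<le> ?N n" "?x n / 2 \<le> real (?N n)" using nat_floor_bounds[OF x1[of n]] by simp_all
    have "exp (real n * \<epsilon>) \<le> ?x n" using h l0 by (simp add: mult_left_mono)
    then have "A * (real n + 1) \<le> real (?N n)" using elim(3) N(2) by linarith
    then have 1: "prob (?D n) \<le> A * f n + A * (real n + 1) / (real (?N n) * ?p ^ l)"
      using elim(1) cyl_coord_sigma pos N(1) by blast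
    have "exp (- (real n * (2 * h + \<epsilon> / (2 * real l)))) \<le> exp (ln ?p)" using elim(2) by simp
    then have "exp (- (real n * (2 * h + \<epsilon> / (2 * real l)))) \<le> ?p" using pos by simp
    then have "exp (- (real n * (2 * h + \<epsilon> / (2 * real l)))) ^ l \<le> ?p ^ l" by (intro power_mono) auto
    moreover have "exp (- (real n * (2 * h + \<epsilon> / (2 * real l)))) ^ l = exp (- (real n * (2 * real l * h + \<epsilon> / 2)))"
      using l0 by (simp add: exp_of_nat_mult[symmetric] field_simps)
    ultimately have "?x n / 2 * exp (- (real n * (2 * real l * h + \<epsilon> / 2))) \<le> real (?N n) * ?p ^ l"
      using N(2) by (intro mult_mono) auto
    moreover have "?x n / 2 * exp (- (real n * (2 * real l * h + \<epsilon> / 2))) = exp (\<epsilon> / 2 * real n) / 2"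
      by (simp add: exp_add[symmetric] algebra_simps)
    ultimately have ge: "exp (\<epsilon> / 2 * real n) / 2 \<le> real (?N n) * ?p ^ l" by simp
    have e0: "0 < exp (\<epsilon> / 2 * real n) / 2" by simp
    have "A * (real n + 1) / (real (?N n) * ?p ^ l) \<le> A * (real n + 1) / (exp (\<epsilon> / 2 * real n) / 2)"
      by (rule divide_left_mono[OF ge _ mult_pos_pos[OF order_less_le_trans[OF e0 ge] e0]]) (use A in simp)
    also have "\<dots> = (2 * A) * ((real n + 1) * exp (- (\<epsilon> / 2 * real n)))" by (simp add: exp_minus field_simps)
    finally show ?case using 1 by simp
  qed
  have Dm: "?D n \<in> sets P" for n
  proof -
    have "space P - (\<Union>k\<in>{1..?N n}. hit (cyl n \<omega>') k) \<in> sets P"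
      using hit_sets[OF coord_sigma_sets[OF cyl_coord_sigma]] by (intro sets.Diff sets.top sets.finite_UN) auto
    then show ?thesis by (simp add: space_UNIV)
  qed
  have "summable (\<lambda>n. A * f n + (2 * A) * ((real n + 1) * exp (- (\<epsilon> / 2 * real n))))"
    using f_summable summable_linear_exp[of "\<epsilon> / 2"] \<epsilon> by (intro summable_add summable_mult) auto
  then have "summable (\<lambda>n. prob (?D n))" using bound by (rule summable_comparison_test_ev[rotated])
  then have "AE \<omega> in P. \<forall>\<^sub>F n in sequentially. \<omega> \<in> space P - ?D n"
    using Dm by (intro borel_cantelli_AE1) (auto simp: emeasure_eq_measure)
  then show ?thesis
  proof eventually_elim
    case (elim \<omega>)
    then show ?case
    proof eventually_elim
      case (elim n)
      then have "\<omega> \<in> (\<Union>k\<in>{1..?N n}. hit (cyl n \<omega>') k)" by blast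
      then have "ln_enat (hitting_time l q (cyl n \<omega>') \<omega>) \<le> ereal (ln (real (?N n)))" by (rule ln_hitting_time_le)
      also have "ln (real (?N n)) \<le> ln (?x n)"
      proof (rule iffD2[OF ln_le_cancel_iff])
        show "0 < real (?N n)" using nat_floor_bounds(1)[OF x1[of n]] by linarith
      qed (rule exp_gt_zero, rule nat_floor_bounds(2)[OF x1[of n]])
      finally show ?case by simp
    qed
  qed
qed

text \<open>If \<open>2 l h \<le> \<epsilon>\<close> the left side is at most 0 and the logarithm of
  a hitting time is nonnegative. Otherwise \<open>h > 0\<close>, and this positivity makes the
  overlap term of order \<open>n P(C)\<close> summable.\<close>

lemma hitting_lower:
  assumes h: "h \<ge> 0" and pos: "\<And>n. prob (cyl n \<omega>') > 0"
    and smb: "\<And>e. e > 0 \<Longrightarrow> \<forall>\<^sub>F n in sequentially. real n * (2 * h - e) \<le> - ln (prob (cyl n \<omega>'))"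
    and \<epsilon>: "\<epsilon> > 0"
  shows "AE \<omega> in P. \<forall>\<^sub>F n in sequentially. ereal (real n * (2 * real l * h - \<epsilon>)) \<le> ln_enat (hitting_time l q (cyl n \<omega>') \<omega>)"
proof (cases "2 * real l * h \<le> \<epsilon>")
  case True
  have "ereal (real n * (2 * real l * h - \<epsilon>)) \<le> ln_enat (hitting_time l q (cyl n \<omega>') \<omega>)" for n \<omega>
  proof -
    have "real n * (2 * real l * h - \<epsilon>) \<le> 0" using True by (simp add: mult_nonneg_nonpos)
    then have "ereal (real n * (2 * real l * h - \<epsilon>)) \<le> 0" by (simp add: zero_ereal_def)
    then show ?thesis using ln_hitting_time_nonneg order_trans by blast
  qed
  then show ?thesis by simp
next
  case False
  let ?x = "\<lambda>n. exp (real n * (2 * real l * h - \<epsilon>))"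
  let ?N = "\<lambda>n. nat \<lfloor>?x n\<rfloor>"
  let ?D = "\<lambda>n. (\<Union>k\<in>{1..?N n}. hit (cyl n \<omega>') k)"
  have l0: "real l > 0" using l by simp
  have "h \<noteq> 0" using False \<epsilon> by auto
  then have h0: "h > 0" using h by simp
  have x1: "?x n \<ge> 1" for n using False by simp
  \<comment> \<open>\<open>e \<le> h\<close> gives \<open>P(C) \<le> exp (- h n)\<close>, and
    \<open>l e \<le> \<epsilon> / 2\<close> gives
    \<open>N P(C)^l \<le> exp (- n \<epsilon> / 2)\<close>.\<close>
  define e where "e = min h (\<epsilon> / (2 * real l))"
  have e: "e > 0" "e \<le> h" "real l * e \<le> \<epsilon> / 2"
  proof -
    show "e > 0" "e \<le> h" using h0 \<epsilon> l0 by (auto simp: e_def)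
    have "real l * e \<le> real l * (\<epsilon> / (2 * real l))" using l0 by (intro mult_left_mono) (auto simp: e_def)
    then show "real l * e \<le> \<epsilon> / 2" using l0 by simp
  qed
  let ?c = "(1 + f 1) ^ l" and ?B = "4 * (real l)\<^sup>2 * K"
  have c: "?c \<ge> 0" "?B \<ge> 0" using f_nonneg K_nonneg by simp_all
  have "\<forall>\<^sub>F n in sequentially. norm (prob (?D n)) \<le> ?c * ((real n + 1) * exp (- (\<epsilon> / 2 * real n))) + ?B * ((real n + 1) * exp (- (h * real n)))"
    using smb[OF e(1)]
  proof eventually_elim
    case (elim n)
    let ?p = "prob (cyl n \<omega>')"
    have N: "real (?N n) \<le> ?x n" using nat_floor_bounds[OF x1[of n]] by simp
    have "exp (ln ?p) \<le> exp (- (real n * (2 * h - e)))" using elim by simp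
    then have p1: "?p \<le> exp (- (real n * (2 * h - e)))" using pos by simp
    have "?p ^ l \<le> exp (- (real n * (2 * h - e))) ^ l" using p1 by (intro power_mono) auto
    also have "\<dots> = exp (- (real n * (2 * real l * h - real l * e)))"
      by (simp add: exp_of_nat_mult[symmetric] algebra_simps)
    finally have pl: "?p ^ l \<le> exp (- (real n * (2 * real l * h - real l * e)))" .
    have "real (?N n) * ?p ^ l \<le> ?x n * exp (- (real n * (2 * real l * h - real l * e)))"
      using N pl by (intro mult_mono) auto
    also have "\<dots> = exp (real n * (real l * e - \<epsilon>))" by (simp add: exp_add[symmetric] algebra_simps)
    also have "\<dots> \<le> exp (real n * (- (\<epsilon> / 2)))" using e(3) by (subst exp_le_cancel_iff) (intro mult_left_mono, auto)
    also have "\<dots> = 1 * exp (- (\<epsilon> / 2 * real n))" by simp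
    also have "\<dots> \<le> (real n + 1) * exp (- (\<epsilon> / 2 * real n))" by (intro mult_right_mono) auto
    finally have 1: "?c * (real (?N n) * ?p ^ l) \<le> ?c * ((real n + 1) * exp (- (\<epsilon> / 2 * real n)))"
      using c by (intro mult_left_mono) auto
    have "?p \<le> exp (- (h * real n))"
    proof (rule order_trans[OF p1])
      have "h * real n \<le> (2 * h - e) * real n" using e(2) by (intro mult_right_mono) auto
      then show "exp (- (real n * (2 * h - e))) \<le> exp (- (h * real n))" by (simp add: mult.commute)
    qed
    then have 2: "2 * (real l)\<^sup>2 * real (2 * n + 1) * K * ?p \<le> ?B * ((real n + 1) * exp (- (h * real n)))"
    proof -
      assume le: "?p \<le> exp (- (h * real n))"
      have "2 * (real l)\<^sup>2 * real (2 * n + 1) * K * ?p = (2 * (real l)\<^sup>2 * K) * (real (2 * n + 1) * ?p)" by simp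
      also have "\<dots> \<le> (2 * (real l)\<^sup>2 * K) * ((2 * (real n + 1)) * exp (- (h * real n)))"
        using le K_nonneg by (intro mult_left_mono mult_mono) auto
      finally show ?thesis by (simp add: algebra_simps)
    qed
    have "prob (?D n) \<le> real (?N n) * ((1 + f 1) * ?p) ^ l + 2 * (real l)\<^sup>2 * real (2 * n + 1) * K * ?p"
      by (rule prob_hit_before[OF cyl_coord_sigma])
    also have "real (?N n) * ((1 + f 1) * ?p) ^ l = ?c * (real (?N n) * ?p ^ l)" by (simp add: power_mult_distrib)
    also have "?c * (real (?N n) * ?p ^ l) + 2 * (real l)\<^sup>2 * real (2 * n + 1) * K * ?p
        \<le> ?c * ((real n + 1) * exp (- (\<epsilon> / 2 * real n))) + ?B * ((real n + 1) * exp (- (h * real n)))"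
      by (rule add_mono[OF 1 2])
    finally show ?case unfolding real_norm_def abs_of_nonneg[OF measure_nonneg] .
  qed
  moreover have "summable (\<lambda>n. ?c * ((real n + 1) * exp (- (\<epsilon> / 2 * real n))) + ?B * ((real n + 1) * exp (- (h * real n))))"
    using summable_linear_exp[of "\<epsilon> / 2"] summable_linear_exp[OF h0] \<epsilon> by (intro summable_add summable_mult) auto
  ultimately have "summable (\<lambda>n. prob (?D n))" by (rule summable_comparison_test_ev)
  then have "AE \<omega> in P. \<forall>\<^sub>F n in sequentially. \<omega> \<in> space P - ?D n"
    using hit_sets[OF coord_sigma_sets[OF cyl_coord_sigma]]
    by (intro borel_cantelli_AE1) (auto simp: emeasure_eq_measure)
  then show ?thesis
  proof eventually_elim
    case (elim \<omega>)
    then show ?case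
    proof eventually_elim
      case (elim n)
      \<comment> \<open>Without a hit up to \<open>N\<close> the hitting time is at least
        \<open>N + 1\<close>, which exceeds the number that was rounded down to
        \<open>N\<close>.\<close>
      have "ereal (ln (?x n)) \<le> ln_enat (hitting_time l q (cyl n \<omega>') \<omega>)"
        using nat_floor_bounds(4)[OF x1[of n]] elim by (intro ln_hitting_time_ge[where N = "?N n"]) auto
      then show ?case by simp
    qed
  qed
qed

text \<open>Required to pass from fixed \<open>\<omega>'\<close> to the product measure. In both
  variables jointly, a hit is a finite conjunction of equalities between coordinates with values in
  a countable set.\<close>

lemma ln_hitting_time_measurable:
  "(\<lambda>z. ln_enat (hitting_time l q (cyl n (snd z)) (fst z))) \<in> borel_measurable (P \<Otimes>\<^sub>M P)"
proof -
  have "Measurable.pred (P \<Otimes>\<^sub>M P) (\<lambda>z. fst z \<in> hit (cyl n (snd z)) k)" for k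
  proof -
    have eq: "fst z \<in> hit (cyl n (snd z)) k \<longleftrightarrow> (\<forall>i\<in>{1..l}. \<forall>j\<in>{- int n..int n}. fst z (j + int (q i k)) = snd z j)" for z :: "(int \<Rightarrow> 'a) \<times> (int \<Rightarrow> 'a)"
    proof -
      have j: "j \<in> {- int n..int n} \<longleftrightarrow> \<bar>j\<bar> \<le> int n" for j by auto
      show ?thesis unfolding hit_def cyl_def translate_def mem_Collect_eq Ball_def j ..
    qed
    have "Measurable.pred (P \<Otimes>\<^sub>M P) (\<lambda>z. fst z (j + int (q i k)) = snd z j)" for i j
      by (rule pred_eq_countable) measurable
    then show ?thesis unfolding eq by (intro pred_intros_finite) auto
  qed
  note [measurable] = this
  show ?thesis unfolding ln_hitting_time by measurable
qed

end

theorem theorem2p6: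
  fixes P :: "(int \<Rightarrow> 'a :: countable) measure"
    and l :: nat
    and q :: "nat \<Rightarrow> nat \<Rightarrow> nat"
    and K :: real
  assumes "\<exists>a b :: 'a. a \<noteq> b"
    and "invariant_prob P"
    and "\<And>a. measure P {\<omega>. \<omega> 0 = a} > 0"
    and "l \<ge> 1"
    and "(\<lambda>a. - (measure P {\<omega>. \<omega> 0 = a} * ln (measure P {\<omega>. \<omega> 0 = a}))) summable_on UNIV"
    and "l = 1 \<Longrightarrow> (\<Sum>n. phi_mix P (Suc n)) < \<infinity>"
    and "l > 1 \<Longrightarrow> (\<Sum>n. psi_mix P (Suc n)) < \<infinity>"
    and "K > 0"
    and "\<And>i j k. i \<in> {1..l} \<Longrightarrow> j \<in> {1..l} \<Longrightarrow> i \<noteq> j \<Longrightarrow>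
           finite {n. int (q i n) - int (q j n) = k \<or> int (q i n) = k} \<and>
           real (card {n. int (q i n) - int (q j n) = k \<or> int (q i n) = k}) \<le> K"
    and "\<And>k. l = 1 \<Longrightarrow> finite {n. int (q 1 n) = k} \<and> real (card {n. int (q 1 n) = k}) \<le> K"
    and "finite {(m, n). m < n \<and> (MAX i\<in>{1..l}. q i n) \<le> (MAX i\<in>{1..l}. q i m)} \<and>
         real (card {(m, n). m < n \<and> (MAX i\<in>{1..l}. q i n) \<le> (MAX i\<in>{1..l}. q i m)}) \<le> K"
  shows "AE (\<omega>, \<omega>') in P \<Otimes>\<^sub>M P.
           (\<lambda>n. ln_enat (hitting_time l q (cyl n \<omega>') \<omega>) / ereal (real n))
             \<longlonglongrightarrow> ereal (2 * real l) * KS_entropy P shift"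
proof -
  interpret invariant_seq P by unfold_locales (rule assms(2))
  \<comment> \<open>One sequence serves both cases; \<open>psi_bound\<close> implies
    \<open>phi_bound\<close>, so the latter is available for every \<open>l\<close>.\<close>
  define f where "f k = enn2real (if l = 1 then phi_mix P k else psi_mix P k)" for k
  have f: "phi_bound f" "l > 1 \<Longrightarrow> psi_bound f" "summable f"
  proof -
    show psi: "psi_bound f" if "l > 1" using psi_mix_bound(1)[OF assms(7)[OF that]] that by (simp add: f_def[abs_def])
    show "phi_bound f"
    proof (cases "l = 1")
      case True
      then show ?thesis using phi_mix_bound(1)[OF assms(6)] by (simp add: f_def[abs_def])
    next
      case False
      then show ?thesis using psi psi_imp_phi_bound assms(4) by simp
    qed
    show "summable f"
    proof (cases "l = 1")
      case True
      then show ?thesis using phi_mix_bound(2)[OF assms(6)] by (simp add: f_def[abs_def])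
    next
      case False
      then show ?thesis using psi_mix_bound(2)[OF assms(7)] assms(4) by (simp add: f_def[abs_def])
    qed
  qed
  interpret hitting P l q K f
  proof unfold_locales
    show "1 \<le> l" by (rule assms(4))
    show "finite {n. int (q i n) = z} \<and> real (card {n. int (q i n) = z}) \<le> K" if i: "i \<in> {1..l}" for i z
    proof (cases "l = 1")
      case True
      then show ?thesis using assms(10)[OF True, of z] i by simp
    next
      case False
      \<comment> \<open>For \<open>l > 1\<close> the bound on the multiplicity of a single
        \<open>q i\<close> is part of the condition on pairs, with any other index as
        \<open>j\<close>.\<close>
      then obtain j where j: "j \<in> {1..l}" "i \<noteq> j"
        using assms(4) by (cases "i = 1") (auto intro: that[of 2] that[of 1])
      let ?A = "{n. int (q i n) - int (q j n) = z \<or> int (q i n) = z}"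
      have A: "finite ?A" "real (card ?A) \<le> K" using assms(9)[OF i j] by blast+
      moreover have "{n. int (q i n) = z} \<subseteq> ?A" by auto
      ultimately show ?thesis by (meson card_mono finite_subset of_nat_mono order_trans)
    qed
    show "finite {n. int (q i n) - int (q j n) = z} \<and> real (card {n. int (q i n) - int (q j n) = z}) \<le> K"
      if "i \<in> {1..l}" "j \<in> {1..l}" "i \<noteq> j" for i j z
    proof -
      let ?A = "{n. int (q i n) - int (q j n) = z \<or> int (q i n) = z}"
      have A: "finite ?A" "real (card ?A) \<le> K" using assms(9)[OF that] by blast+
      moreover have "{n. int (q i n) - int (q j n) = z} \<subseteq> ?A" by auto
      ultimately show ?thesis by (meson card_mono finite_subset of_nat_mono order_trans)
    qed
  qed (use f in auto)
  interpret finite_entropy_seq P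
  proof unfold_locales
    show "prob A = 0 \<or> prob A = 1" if "A \<in> sets P" "translate 1 -` A = A" for A
      by (rule phi_bound_ergodic[OF f(1) summable_LIMSEQ_zero[OF f(3)] that])
  qed (rule assms(3), rule assms(5))
  obtain h where h: "KS_entropy P shift = ereal h" "h \<ge> 0"
    and smb: "\<And>e. e > 0 \<Longrightarrow> AE \<omega> in P. \<forall>\<^sub>F n in sequentially.
       real n * (2 * h - e) \<le> - ln (prob (cyl n \<omega>)) \<and> - ln (prob (cyl n \<omega>)) \<le> real n * (2 * h + e)"
    by (rule shannon_mcmillan_breiman) (rule that)
  let ?T = "\<lambda>n \<omega> \<omega>'. ln_enat (hitting_time l q (cyl n \<omega>') \<omega>)"
  let ?Q = "\<lambda>\<omega> \<omega>'. (\<lambda>n. ?T n \<omega> \<omega>' / ereal (real n)) \<longlonglongrightarrow> ereal (2 * real l * h)"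
  have "AE \<omega>' in P. \<forall>n. prob (cyl n \<omega>') > 0"
    unfolding cyl_eq_cell using AE_cell_pos[OF countable_cells_cell[OF letter_measurable]]
    by (simp add: AE_all_countable)
  \<comment> \<open>Countably many errors \<open>1 / real (Suc j)\<close> give one null set of
    \<open>\<omega>'\<close> outside which every error is covered.\<close>
  moreover have "AE \<omega>' in P. \<forall>j. \<forall>\<^sub>F n in sequentially. real n * (2 * h - 1 / real (Suc j)) \<le> - ln (prob (cyl n \<omega>'))
       \<and> - ln (prob (cyl n \<omega>')) \<le> real n * (2 * h + 1 / real (Suc j))"
    using smb by (simp add: AE_all_countable)
  ultimately have "AE \<omega>' in P. AE \<omega> in P. ?Q \<omega> \<omega>'"
  proof eventually_elim
    case (elim \<omega>')
    have lim: "\<forall>\<^sub>F n in sequentially. real n * (2 * h - e) \<le> - ln (prob (cyl n \<omega>')) \<and> - ln (prob (cyl n \<omega>')) \<le> real n * (2 * h + e)"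
      if e0: "e > 0" for e
    proof -
      obtain j where j: "1 / real (Suc j) < e" by (rule nat_approx_posE[OF e0])
      from elim(2)[rule_format, of j] show ?thesis
      proof eventually_elim
        case (elim n)
        have "real n * (2 * h - e) \<le> real n * (2 * h - 1 / real (Suc j))" "real n * (2 * h + 1 / real (Suc j)) \<le> real n * (2 * h + e)"
          using j by (intro mult_left_mono; simp)+
        then show ?case using elim by linarith
      qed
    qed
    have low: "\<forall>\<^sub>F n in sequentially. real n * (2 * h - e) \<le> - ln (prob (cyl n \<omega>'))" if "e > 0" for e
      using lim[OF that] by (rule eventually_mono) blast
    have upp: "\<forall>\<^sub>F n in sequentially. - ln (prob (cyl n \<omega>')) \<le> real n * (2 * h + e)" if "e > 0" for e
      using lim[OF that] by (rule eventually_mono) blast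
    have "AE \<omega> in P. \<forall>j. \<forall>\<^sub>F n in sequentially. ereal (real n * (2 * real l * h - 1 / real (Suc j))) \<le> ?T n \<omega> \<omega>'"
      unfolding AE_all_countable by (intro allI hitting_lower low h(2) elim(1)[rule_format]) simp_all
    moreover have "AE \<omega> in P. \<forall>j. \<forall>\<^sub>F n in sequentially. ?T n \<omega> \<omega>' \<le> ereal (real n * (2 * real l * h + 1 / real (Suc j)))"
      unfolding AE_all_countable by (intro allI hitting_upper upp h(2) elim(1)[rule_format]) simp_all
    ultimately show ?case
    proof eventually_elim
      case (elim \<omega>)
      show ?case
      proof (rule ereal_ratio_tendsto)
        fix e :: real assume "e > 0"
        then obtain j where j: "1 / real (Suc j) < e" by (rule nat_approx_posE)
        from elim(1)[rule_format, of j] elim(2)[rule_format, of j]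
        show "\<forall>\<^sub>F n in sequentially. ereal (real n * (2 * real l * h - e)) \<le> ?T n \<omega> \<omega>' \<and> ?T n \<omega> \<omega>' \<le> ereal (real n * (2 * real l * h + e))"
        proof eventually_elim
          case (elim n)
          have "real n * (2 * real l * h - e) \<le> real n * (2 * real l * h - 1 / real (Suc j))"
            "real n * (2 * real l * h + 1 / real (Suc j)) \<le> real n * (2 * real l * h + e)"
            using j by (intro mult_left_mono; simp)+
          then show ?case using elim by (meson ereal_less_eq(3) order_trans)
        qed
      qed
    qed
  qed
  interpret PP: pair_prob_space P P ..
  have meas: "{z \<in> space (P \<Otimes>\<^sub>M P). ?Q (fst z) (snd z)} \<in> sets (P \<Otimes>\<^sub>M P)"
  proof -
    note [measurable] = ln_hitting_time_measurable
    \<comment> \<open>Convergence to a prescribed limit means that the lower and the upper limit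
      both equal it, and these are measurable.\<close>
    have "?Q (fst z) (snd z) \<longleftrightarrow>
        liminf (\<lambda>n. ?T n (fst z) (snd z) / ereal (real n)) \<le> ereal (2 * real l * h) \<and>
        ereal (2 * real l * h) \<le> liminf (\<lambda>n. ?T n (fst z) (snd z) / ereal (real n)) \<and>
        limsup (\<lambda>n. ?T n (fst z) (snd z) / ereal (real n)) \<le> ereal (2 * real l * h) \<and>
        ereal (2 * real l * h) \<le> limsup (\<lambda>n. ?T n (fst z) (snd z) / ereal (real n))" for z
      by (subst tendsto_iff_Liminf_eq_Limsup) auto
    then show ?thesis by simp
  qed
  \<comment> \<open>The estimates fix \<open>\<omega>'\<close> and vary \<open>\<omega>\<close>; the
    product form needs the opposite order, which the measurability of the event permits.\<close>
  have "AE \<omega> in P. AE \<omega>' in P. ?Q \<omega> \<omega>'"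
    by (rule iffD2[OF PP.AE_commute]) (use meas \<open>AE \<omega>' in P. AE \<omega> in P. ?Q \<omega> \<omega>'\<close> in auto)
  then have "AE z in P \<Otimes>\<^sub>M P. ?Q (fst z) (snd z)"
    by (intro PP.AE_pair_measure) (use meas in auto)
  then show ?thesis by (simp add: h(1) split_beta')
qed

end
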